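(* Let $p$ be an odd prime, let $G=\langle g\rangle$ be the cyclic group of order $p$ generated by $g=\begin{pmatrix}1&1\\0&1\end{pmatrix}$ acting linearly on $V=\mathbb{F}_p^2$ with basis $v_1,v_2$ (so ${}^gv_1=v_1$ and ${}^gv_2=v_1+v_2$). Up to a coboundary, there are exactly $p^{2p+1}$ Drinfeld orbifold algebras $\mathcal{H}_{\lambda,\kappa}$ (counted by their parameter pairs $(\lambda,\kappa)$), and they are given by the following procedure. Fix $b=\sum_{j=0}^{p-1}b_jg^j\in\mathbb{F}_pG$, let $k\in\{0,\dots,p\}$ be the unique integer such that $b=(g-1)^k\,\tilde b$ for some $\tilde b=\sum_i\tilde b_ig^i\in\mathbb{F}_pG$ with $\sum_i\tilde b_i\neq0$, and fix $\mathbf{d}=(d_1,\dots,d_k)\in\mathbb{F}_p^k$ and $\kappa^C\in\mathbb{F}_pG$. Then $\mathcal{H}_{\lambda,\kappa}$ is a Drinfeld orbifold algebra, where for $0\le i\le p-1$ $$\lambda(g^i,v_1)=i\,b\,g^i,$$ $$\lambda(g^i,v_2)=\sum_{j=0}^{p-1}\left(\binom{i}{2}+i\,j^{p-2}\binom{j+1}{2}\right)b_j\,g^{i+j}+i\sum_{j=0}^{p-1}j^{p-2}\mu(\mathbf{d},j)\,g^{i+j},$$ and $$\kappa(v_1,v_2)=\big(d_1-d_2+\cdots+(-1)^{k+1}d_k\big)v_1+\sum_{j=0}^{p-1}j\,b_j\,v_2\,g^j+\kappa^C .$$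
   Context: All integer coefficients and binomial coefficients are read in $\mathbb{F}_p$. For $\mathbf{d}=(d_1,\dots,d_k)$ and $j\in\{0,\dots,p-1\}$, $$\mu(\mathbf{d},j)=(-1)^{p-j}\left(\binom{p-1}{p-j}d_1-\binom{p-2}{p-j}d_2+\cdots+(-1)^{k+1}\binom{p-k}{p-j}d_k\right)$$ (empty sums are $0$). The skew group algebra $S\rtimes G$ of an algebra $S$ with $G$ acting by automorphisms is $S\otimes\mathbb{F}_pG$ with $(a\otimes h)(a'\otimes h')=a({}^ha')\otimes hh'$; one writes $ah$ for $a\otimes h$. Given a bilinear map $\lambda:\mathbb{F}_pG\times V\to\mathbb{F}_pG$ and an alternating bilinear map $\kappa:V\times V\to\mathbb{F}_pG\oplus(V\otimes\mathbb{F}_pG)$, set $$\mathcal{H}_{\lambda,\kappa}=(T(V)\rtimes G)\big/\big(hv-{}^hv\,h-\lambda(h,v),\ vw-wv-\kappa(v,w)\ :\ h\in G,\ v,w\in V\big),$$ where $T(V)$ is the tensor algebra. It is filtered by giving each $v\in V$ degree $1$ and each $h\in G$ degree $0$. $\mathcal{H}_{\lambda,\kappa}$ is a Drinfeld orbifold algebra if it is a PBW deformation of $S(V)\rtimes G$ ($S(V)$ the symmetric algebra), i.e. $\operatorname{gr}(\mathcal{H}_{\lambda,\kappa})\cong S(V)\rtimes G$ as graded algebras. Coboundaries: for an $\mathbb{F}_p$-linear $f:V\to\mathbb{F}_pG$, $f(v)=\sum_{j=0}^{p-1}f_j(v)g^j$, the associated coboundary is the pair $(\lambda_f,\kappa_f)$,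 with $\lambda_f$ bilinear and $\kappa_f$ alternating bilinear, given by $\lambda_f(g^i,v_1)=0$, $\lambda_f(g^i,v_2)=-i\big(\sum_{j=0}^{p-1}f_j(v_1)g^j\big)g^i$ for $0\le i\le p-1$, and $\kappa_f(v_1,v_2)=\sum_{j=0}^{p-1}j\,f_j(v_1)\,v_1\,g^j$. "Up to a coboundary" means that pairs $(\lambda,\kappa)$ and $(\lambda+\lambda_f,\kappa+\kappa_f)$ are identified.
   Formalization: H is taken as a quotient of the free product of T(V) and F_pG instead of the skew group algebra T(V)⋊G, where hv = ^hv h already holds, so the relation would force λ(h,v)=0 in H (for b=1 it gives g=0, hence H=0) and the claim would fail. *)

theory Defs
  imports
    "Berlekamp_Zassenhaus.Finite_Field"
    "HOL-Analysis.Cartesian_Space"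
    "HOL-Algebra.QuotRing"
    "HOL-Library.Poly_Mapping"
begin

hide_const (open) Poly_Mapping.range Poly_Mapping.map Poly_Mapping.nth

text \<open>
  The field with \<open>p\<close> elements is \<open>'p mod_ring\<close> with \<open>'p :: prime_card\<close> and \<open>p = CARD('p)\<close>.
\<close>

type_synonym 'p V = "('p mod_ring, 2) vec"

abbreviation v1 :: "'p::prime_card V" where "v1 \<equiv> axis 1 1"
abbreviation v2 :: "'p::prime_card V" where "v2 \<equiv> axis 2 1"

definition gmat :: "(('p::prime_card mod_ring, 2) vec, 2) vec" where
  "gmat = vector [vector [1, 1], vector [0, 1]]"

definition gmat_pow :: "nat \<Rightarrow> (('p::prime_card mod_ring, 2) vec, 2) vec" where
  "gmat_pow i = (((**) gmat) ^^ i) (mat 1)"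

lemma gmat_pow_explicit:
  "gmat_pow i = (vector [vector [1, of_nat i], vector [0, 1]] :: (('p::prime_card mod_ring, 2) vec, 2) vec)"
proof (induction i)
  case 0
  show ?case
    by (simp add: gmat_pow_def vec_eq_iff forall_2 vector_2 mat_def)
next
  case (Suc i)
  have "gmat_pow (Suc i) = (gmat ** gmat_pow i :: (('p mod_ring, 2) vec, 2) vec)"
    by (simp add: gmat_pow_def)
  then show ?case
    unfolding Suc
    by (simp add: gmat_def vec_eq_iff forall_2 vector_2 matrix_matrix_mult_def sum_2 add.commute)
qed

lemma gmat_pow_add:
  "gmat_pow (i + j) = (gmat_pow i ** gmat_pow j :: (('p::prime_card mod_ring, 2) vec, 2) vec)"
  by (simp add: gmat_pow_explicit vec_eq_iff forall_2 vector_2 matrix_matrix_mult_def sum_2 add.commute)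

text \<open>
  The cyclic matrix group generated by \<open>gmat\<close>. It has finite order, so the nonnegative
  powers already form a group. The group law is matrix multiplication; it is written additively
  because the convolution product of \<^typ>\<open>'a \<Rightarrow>\<^sub>0 'b\<close> expects \<open>+\<close> on the keys.
\<close>

typedef (overloaded) 'p cyc =
  "range gmat_pow :: (('p::prime_card mod_ring, 2) vec, 2) vec set"
  by auto

setup_lifting type_definition_cyc

instantiation cyc :: (prime_card) comm_monoid_add
begin

lift_definition zero_cyc :: "'a cyc" is "mat 1"
proof -
  have "mat 1 = (gmat_pow 0 :: (('a mod_ring, 2) vec, 2) vec)"
    by (simp add: gmat_pow_def)
  then show "mat 1 \<in> range (gmat_pow :: nat \<Rightarrow> (('a mod_ring, 2) vec, 2) vec)"
    by (rule range_eqI)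
qed

lift_definition plus_cyc :: "'a cyc \<Rightarrow> 'a cyc \<Rightarrow> 'a cyc" is "(**)"
  by (metis (no_types, lifting) gmat_pow_add image_iff rangeI)

instance
proof
  fix a b c :: "'a cyc"
  show "a + b + c = a + (b + c)"
    by transfer (simp add: matrix_mul_assoc)
  show "0 + a = a"
    by transfer simp
  show "a + b = b + a"
    by transfer (metis (no_types, lifting) add.commute gmat_pow_add image_iff)
qed

end

lift_definition gpow :: "nat \<Rightarrow> 'p::prime_card cyc" is gmat_pow
  by simp

definition act :: "'p::prime_card cyc \<Rightarrow> 'p V \<Rightarrow> 'p V" where
  "act h v = Rep_cyc h *v v"

lemma gpow_add: "gpow (i + j) = gpow i + gpow j"
  by transfer (rule gmat_pow_add)

lemma act_gpow:
  "act (gpow i) v1 = v1" "act (gpow i) v2 = of_nat i *s v1 + v2"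
  by (simp_all add: act_def gpow.rep_eq gmat_pow_explicit vec_eq_iff forall_2 vector_2
      matrix_vector_mult_def sum_2 axis_def)

lemma gpow_eq_iff:
  "gpow i = (gpow j :: 'p::prime_card cyc) \<longleftrightarrow> i mod CARD('p) = j mod CARD('p)"
proof -
  have "gpow i = (gpow j :: 'p cyc) \<longleftrightarrow> (of_nat i :: 'p mod_ring) = of_nat j"
    by transfer (simp add: gmat_pow_explicit vec_eq_iff forall_2 vector_2)
  also have "\<dots> \<longleftrightarrow> int i mod int CARD('p) = int j mod int CARD('p)"
    unfolding of_nat_of_int_mod_ring o_def by transfer simp
  also have "\<dots> \<longleftrightarrow> i mod CARD('p) = j mod CARD('p)"
    by (metis of_nat_eq_iff zmod_int)
  finally show ?thesis .
qed

lemma bij_betw_gpow: "bij_betw gpow {..<CARD('p)} (UNIV :: 'p::prime_card cyc set)"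
proof -
  have "\<exists>i<CARD('p). h = gpow i" for h :: "'p cyc"
  proof -
    obtain n where "h = gpow n"
      by (metis Rep_cyc Rep_cyc_inverse gpow.abs_eq image_iff)
    then have "h = gpow (n mod CARD('p))"
      by (simp add: gpow_eq_iff)
    then show ?thesis
      by (metis mod_less_divisor zero_less_card_finite)
  qed
  then have "gpow ` {..<CARD('p)} = (UNIV :: 'p cyc set)"
    by auto
  moreover have "inj_on (gpow :: nat \<Rightarrow> 'p cyc) {..<CARD('p)}"
    by (auto intro: inj_onI simp: gpow_eq_iff)
  ultimately show ?thesis
    by (simp add: bij_betw_def)
qed

text \<open>
  The group algebra is a monoid algebra, multiplied by convolution. An element
  \<open>\<Sum>h. u h \<otimes> h\<close> of the tensor product of \<open>V\<close> with the group algebra is stored as its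
  coefficient function \<open>u\<close>. The parameter \<open>\<lambda>\<close> is called \<open>L\<close> in formulas.
\<close>

type_synonym 'p FG = "'p cyc \<Rightarrow>\<^sub>0 'p mod_ring"
type_synonym 'p VFG = "'p cyc \<Rightarrow>\<^sub>0 'p V"

definition scale_FG :: "'p::prime_card mod_ring \<Rightarrow> 'p FG \<Rightarrow> 'p FG" where
  "scale_FG c = Poly_Mapping.map ((*) c)"

definition scale_VFG :: "'p::prime_card mod_ring \<Rightarrow> 'p VFG \<Rightarrow> 'p VFG" where
  "scale_VFG c = Poly_Mapping.map ((*s) c)"

definition scale_sum :: "'p::prime_card mod_ring \<Rightarrow> 'p FG \<times> 'p VFG \<Rightarrow> 'p FG \<times> 'p VFG" where
  "scale_sum c = map_prod (scale_FG c) (scale_VFG c)"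

type_synonym 'p lam = "'p FG \<Rightarrow> 'p V \<Rightarrow> 'p FG"
type_synonym 'p kap = "'p V \<Rightarrow> 'p V \<Rightarrow> 'p FG \<times> 'p VFG"

definition bilinear_lam :: "'p::prime_card lam \<Rightarrow> bool" where
  "bilinear_lam L \<longleftrightarrow>
     (\<forall>x. Vector_Spaces.linear (*s) scale_FG (\<lambda>v. L x v)) \<and>
     (\<forall>v. Vector_Spaces.linear scale_FG scale_FG (\<lambda>x. L x v))"

definition alternating_kap :: "'p::prime_card kap \<Rightarrow> bool" where
  "alternating_kap \<kappa> \<longleftrightarrow>
     (\<forall>v. Vector_Spaces.linear (*s) scale_sum (\<lambda>w. \<kappa> v w)) \<and>
     (\<forall>w. Vector_Spaces.linear (*s) scale_sum (\<lambda>v. \<kappa> v w)) \<and>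
     (\<forall>v. \<kappa> v v = 0)"

definition parameters :: "('p::prime_card lam \<times> 'p kap) set" where
  "parameters = {(L, \<kappa>). bilinear_lam L \<and> alternating_kap \<kappa>}"

definition type_ring :: "'a::ring_1 ring" where
  "type_ring = \<lparr>carrier = UNIV, monoid.mult = (*), one = 1, zero = 0, add = (+)\<rparr>"

lemma ring_type_ring: "ring (type_ring :: 'a::ring_1 ring)"
proof (rule ringI)
  show "abelian_group (type_ring :: 'a ring)"
  proof (rule abelian_groupI)
    fix x :: 'a
    show "\<exists>y\<in>carrier type_ring. y \<oplus>\<^bsub>type_ring\<^esub> x = \<zero>\<^bsub>type_ring\<^esub>"
      by (rule bexI[of _ "- x"]) (simp_all add: type_ring_def)
  qed (simp_all add: type_ring_def algebra_simps)
  show "Group.monoid (type_ring :: 'a ring)"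
    by (rule monoidI) (simp_all add: type_ring_def algebra_simps)
qed (simp_all add: type_ring_def algebra_simps)

text \<open>
  A filtration \<open>F 0 \<subseteq> F 1 \<subseteq> \<dots>\<close> is a function on the naturals, with \<open>F (-1) = 0\<close>. An element of the
  associated graded ring is a finitely supported sequence of cosets \<open>c n \<in> F n / F (n - 1)\<close>.
\<close>

definition filt_below :: "('a, 'm) ring_scheme \<Rightarrow> (nat \<Rightarrow> 'a set) \<Rightarrow> nat \<Rightarrow> 'a set" where
  "filt_below R F n = (case n of 0 \<Rightarrow> {\<zero>\<^bsub>R\<^esub>} | Suc m \<Rightarrow> F m)"

text \<open>
  In degree \<open>n\<close>, the product of two sequences is the coset of \<open>\<Sum>i\<le>n. x i * y (n - i)\<close> for
  arbitrary representatives \<open>x i\<close> and \<open>y i\<close>.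
\<close>

definition gr_ring :: "('a, 'm) ring_scheme \<Rightarrow> (nat \<Rightarrow> 'a set) \<Rightarrow> (nat \<Rightarrow> 'a set) ring" where
  "gr_ring R F =
    \<lparr>carrier = {c. (\<forall>n. \<exists>x\<in>F n. c n = filt_below R F n +>\<^bsub>R\<^esub> x) \<and>
                   finite {n. c n \<noteq> filt_below R F n}},
     monoid.mult = (\<lambda>c d n. {(\<Oplus>\<^bsub>R\<^esub>i\<in>{..n}. x i \<otimes>\<^bsub>R\<^esub> y (n - i)) \<oplus>\<^bsub>R\<^esub> z | x y z.
                        (\<forall>i\<le>n. x i \<in> c i \<and> y i \<in> d i) \<and> z \<in> filt_below R F n}),
     one = (\<lambda>n. if n = 0 then filt_below R F 0 +>\<^bsub>R\<^esub> \<one>\<^bsub>R\<^esub> else filt_below R F n),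
     zero = filt_below R F,
     add = (\<lambda>c d n. c n <+>\<^bsub>R\<^esub> d n)\<rparr>"

definition gr_part :: "('a, 'm) ring_scheme \<Rightarrow> (nat \<Rightarrow> 'a set) \<Rightarrow> nat \<Rightarrow> (nat \<Rightarrow> 'a set) set" where
  "gr_part R F n = {c \<in> carrier (gr_ring R F). \<forall>m. m \<noteq> n \<longrightarrow> c m = filt_below R F m}"

datatype 'x word = Word (letters: "'x list")

instantiation word :: (type) monoid_add
begin
definition zero_word_def: "0 = Word []"
definition plus_word_def: "u + w = Word (letters u @ letters w)"
instance
  by standard (simp_all add: zero_word_def plus_word_def)
end

text \<open>
  Generators: the basis vectors \<open>v1, v2\<close> of \<open>V\<close>, indexed by the type \<^typ>\<open>2\<close>, and the group elements.
\<close>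

datatype 'g gen = Vgen 2 | Ggen 'g

type_synonym 'p free_alg = "'p cyc gen word \<Rightarrow>\<^sub>0 'p mod_ring"

definition in_V :: "'p::prime_card V \<Rightarrow> 'p free_alg" where
  "in_V v = (\<Sum>i\<in>UNIV. Poly_Mapping.single (Word [Vgen i]) (v $ i))"

definition in_G :: "'p::prime_card cyc \<Rightarrow> 'p free_alg" where
  "in_G h = Poly_Mapping.single (Word [Ggen h]) 1"

definition in_FG :: "'p::prime_card FG \<Rightarrow> 'p free_alg" where
  "in_FG x = (\<Sum>h\<in>Poly_Mapping.keys x. Poly_Mapping.single (Word [Ggen h]) (Poly_Mapping.lookup x h))"

definition in_VFG :: "'p::prime_card VFG \<Rightarrow> 'p free_alg" where
  "in_VFG x = (\<Sum>h\<in>Poly_Mapping.keys x. in_V (Poly_Mapping.lookup x h) * in_G h)"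

text \<open>
  \<open>H\<close> is the algebra generated by \<open>V\<close> and the group algebra, subject only to
  \<open>h v - (h . v) h = L(h,v)\<close> and \<open>v w - w v = \<kappa>(v,w)\<close>: the quotient of the free product of the tensor
  algebra \<open>T(V)\<close> and the group algebra. Free product, not smash product: in the latter
  \<open>h v = (h . v) h\<close> already holds, so the first relation would impose \<open>L(h,v) = 0\<close>. The free product is
  presented here as the free algebra on a basis of \<open>V\<close> and on the group elements, modulo the
  multiplication table of the group; these are the first two families of relations.
\<close>

definition relations :: "'p::prime_card lam \<Rightarrow> 'p kap \<Rightarrow> 'p free_alg set" where
  "relations L \<kappa> =
     {in_G h * in_G h' - in_G (h + h') | h h'. True} \<union>
     {in_G 0 - 1} \<union>
     {in_G h * in_V v - in_V (act h v) * in_G h - in_FG (L (Poly_Mapping.single h 1) v) | h v. True} \<union>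
     {in_V v * in_V w - in_V w * in_V v - (in_FG (fst (\<kappa> v w)) + in_VFG (snd (\<kappa> v w))) | v w. True}"

definition rel_ideal :: "'p::prime_card lam \<Rightarrow> 'p kap \<Rightarrow> 'p free_alg set" where
  "rel_ideal L \<kappa> = Idl\<^bsub>type_ring\<^esub> (relations L \<kappa>)"

definition H_alg :: "'p::prime_card lam \<Rightarrow> 'p kap \<Rightarrow> 'p free_alg set ring" where
  "H_alg L \<kappa> = type_ring Quot (rel_ideal L \<kappa>)"

definition vdeg :: "'g gen word \<Rightarrow> nat" where
  "vdeg w = length (filter (\<lambda>x. case x of Vgen _ \<Rightarrow> True | Ggen _ \<Rightarrow> False) (letters w))"

definition H_filt :: "'p::prime_card lam \<Rightarrow> 'p kap \<Rightarrow> nat \<Rightarrow> 'p free_alg set set" where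
  "H_filt L \<kappa> n =
     {rel_ideal L \<kappa> +>\<^bsub>type_ring\<^esub> a | a. \<forall>w\<in>Poly_Mapping.keys a. vdeg w \<le> n}"

text \<open>An element \<open>\<Sum>h. a h \<otimes> h\<close> is stored as its coefficient function \<open>a\<close>.\<close>

definition skew_group_ring :: "('g \<Rightarrow> 's \<Rightarrow> 's) \<Rightarrow> ('g::monoid_add \<Rightarrow>\<^sub>0 's::ring_1) ring" where
  "skew_group_ring \<alpha> =
    \<lparr>carrier = UNIV,
     monoid.mult = (\<lambda>x y. \<Sum>h\<in>Poly_Mapping.keys x. \<Sum>h'\<in>Poly_Mapping.keys y.
        Poly_Mapping.single (h + h') (Poly_Mapping.lookup x h * \<alpha> h (Poly_Mapping.lookup y h'))),
     one = Poly_Mapping.single 0 1,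
     zero = 0,
     add = (+)\<rparr>"

text \<open>
  \<open>S(V)\<close> is the polynomial ring in \<open>v1, v2\<close>; keys are exponent vectors. The group acts by the
  algebra automorphisms extending its linear action on \<open>V\<close>.
\<close>

type_synonym 'p SV = "(2 \<Rightarrow>\<^sub>0 nat) \<Rightarrow>\<^sub>0 'p mod_ring"

definition SV_of_V :: "'p::prime_card V \<Rightarrow> 'p SV" where
  "SV_of_V v = (\<Sum>i\<in>UNIV. Poly_Mapping.single (Poly_Mapping.single i 1) (v $ i))"

definition act_SV :: "'p::prime_card cyc \<Rightarrow> 'p SV \<Rightarrow> 'p SV" where
  "act_SV h f = (\<Sum>m\<in>Poly_Mapping.keys f. Poly_Mapping.single 0 (Poly_Mapping.lookup f m) *
      (\<Prod>i\<in>UNIV. SV_of_V (act h (axis i 1)) ^ Poly_Mapping.lookup m i))"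

definition SVG_part :: "nat \<Rightarrow> ('p::prime_card cyc \<Rightarrow>\<^sub>0 'p SV) set" where
  "SVG_part n = {x. \<forall>h. \<forall>m\<in>Poly_Mapping.keys (Poly_Mapping.lookup x h).
      (\<Sum>i\<in>UNIV. Poly_Mapping.lookup m i) = n}"

text \<open>
  Compatibility of \<open>\<phi>\<close> with scalars is not stated separately: over a prime field every additive
  map is linear.
\<close>

definition PBW_deformation :: "'p::prime_card lam \<Rightarrow> 'p kap \<Rightarrow> bool" where
  "PBW_deformation L \<kappa> \<longleftrightarrow>
     (\<exists>\<phi> \<in> ring_iso (gr_ring (H_alg L \<kappa>) (H_filt L \<kappa>)) (skew_group_ring (act_SV :: 'p cyc \<Rightarrow> _)).
        \<forall>n. \<phi> ` gr_part (H_alg L \<kappa>) (H_filt L \<kappa>) n = SVG_part n)"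

definition drinfeld_orbifold :: "('p::prime_card lam \<times> 'p kap) set" where
  "drinfeld_orbifold = {(L, \<kappa>) \<in> parameters. PBW_deformation L \<kappa>}"

abbreviation gp :: "nat \<Rightarrow> 'p::prime_card FG" where
  "gp i \<equiv> Poly_Mapping.single (gpow i) 1"

abbreviation gcoeff :: "'p::prime_card FG \<Rightarrow> nat \<Rightarrow> 'p mod_ring" where
  "gcoeff x j \<equiv> Poly_Mapping.lookup x (gpow j)"

definition is_coboundary :: "('p::prime_card V \<Rightarrow> 'p FG) \<Rightarrow> 'p lam \<times> 'p kap \<Rightarrow> bool" where
  "is_coboundary f = (\<lambda>(Lf, \<kappa>f).
     (Lf, \<kappa>f) \<in> parameters \<and>
     (\<forall>i<CARD('p). Lf (gp i) v1 = 0 \<and> Lf (gp i) v2 = - (of_nat i * f v1 * gp i)) \<and>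
     \<kappa>f v1 v2 = (0, \<Sum>j<CARD('p). Poly_Mapping.single (gpow j) ((of_nat j * gcoeff (f v1) j) *s v1)))"

definition coboundary_rel :: "(('p::prime_card lam \<times> 'p kap) \<times> ('p lam \<times> 'p kap)) set" where
  "coboundary_rel = {((L, \<kappa>), (L', \<kappa>')).
     (L, \<kappa>) \<in> parameters \<and> (L', \<kappa>') \<in> parameters \<and>
     (\<exists>f Lf \<kappa>f. Vector_Spaces.linear (*s) scale_FG f \<and> is_coboundary f (Lf, \<kappa>f) \<and>
        (\<forall>x v. L' x v = L x v + Lf x v) \<and> (\<forall>v w. \<kappa>' v w = \<kappa> v w + \<kappa>f v w))}"

definition aug_exponent :: "'p::prime_card FG \<Rightarrow> nat \<Rightarrow> bool" where
  "aug_exponent b k \<longleftrightarrow> k \<le> CARD('p) \<and>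
     (\<exists>b'. b = (gp 1 - 1) ^ k * b' \<and> (\<Sum>i<CARD('p). gcoeff b' i) \<noteq> 0)"

text \<open>The entry \<open>d\<^sub>l\<close>, counted from 1, is \<open>d ! (l - 1)\<close>.\<close>

definition mu :: "'p::prime_card mod_ring list \<Rightarrow> nat \<Rightarrow> 'p mod_ring" where
  "mu d j = (-1) ^ (CARD('p) - j) *
     (\<Sum>l=1..length d. (-1) ^ (l + 1) * of_nat ((CARD('p) - l) choose (CARD('p) - j)) * d ! (l - 1))"

definition family :: "'p::prime_card FG \<Rightarrow> 'p mod_ring list \<Rightarrow> 'p FG \<Rightarrow> 'p lam \<times> 'p kap \<Rightarrow> bool" where
  "family b d \<kappa>C = (\<lambda>(L, \<kappa>).
     (L, \<kappa>) \<in> parameters \<and>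
     (\<forall>i<CARD('p).
        L (gp i) v1 = of_nat i * b * gp i \<and>
        L (gp i) v2 =
          (\<Sum>j<CARD('p). Poly_Mapping.single (gpow (i + j))
             ((of_nat (i choose 2) + of_nat i * of_nat j ^ (CARD('p) - 2) * of_nat ((j + 1) choose 2))
                * gcoeff b j)) +
          of_nat i * (\<Sum>j<CARD('p). Poly_Mapping.single (gpow (i + j))
             (of_nat j ^ (CARD('p) - 2) * mu d j))) \<and>
     \<kappa> v1 v2 =
       (\<kappa>C,
        Poly_Mapping.single 0 ((\<Sum>l=1..length d. (-1) ^ (l + 1) * d ! (l - 1)) *s v1) +
        (\<Sum>j<CARD('p). Poly_Mapping.single (gpow j) ((of_nat j * gcoeff b j) *s v2))))"

end

theory Submission
  imports Defs "HOL-Library.Function_Algebras"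
begin

text \<open>
  Let \<open>R\<close> be the group algebra, \<open>D\<close> its derivation \<open>g\<^sup>i \<mapsto> i g\<^sup>i\<close> (\<open>eul\<close> below) and \<open>D\<^sub>2 = (D\<^sup>2 - D) / 2\<close>
  (\<open>eul2\<close>). The proof replaces a parameter pair by five elements \<open>a, b, x, y, C\<close> of \<open>R\<close>, for which
  \<open>\<lambda>(r, v\<^sub>1) = b D r\<close>, \<open>\<lambda>(r, v\<^sub>2) = a D r + b D\<^sub>2 r\<close> and \<open>\<kappa>(v\<^sub>1, v\<^sub>2) = C + v\<^sub>1 x + v\<^sub>2 y\<close>
  (\<open>param\<close>). The pairs with the PBW property are exactly those of this form with \<open>y = D b\<close> and
  \<open>b m = 0\<close>, where \<open>m = x + D a - D b - D\<^sub>2 b\<close> (\<open>drinfeld_orbifold_conditions\<close>,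
  \<open>param_drinfeld_orbifold\<close>). The theorem is then commutative algebra. A coboundary subtracts an
  arbitrary \<open>F\<close> from \<open>a\<close> and adds \<open>D F\<close> to \<open>x\<close>, so that \<open>(b, m, C)\<close> is a complete invariant of
  the classes. With \<open>t = g - 1\<close> the ring \<open>R\<close> is \<open>F\<^sub>p[t] / (t\<^sup>p)\<close>; if \<open>b\<close> is a unit times
  \<open>t\<^sup>k\<close>, then the elements \<open>m\<close> with \<open>b m = 0\<close> are the combinations of the \<open>k\<close> powers
  \<open>(1 - g\<^sup>-\<^sup>1)\<^sup>p\<^sup>-\<^sup>l\<close>, \<open>1 \<le> l \<le> k\<close>, and the coefficients are the entries of \<open>d\<close>
  (\<open>s_comb_surj\<close>, \<open>fam_invariant\<close>). There are \<open>p\<^sup>p\<^sup>+\<^sup>1\<close> pairs \<open>(b, m)\<close> with \<open>b m = 0\<close>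
  (\<open>card_annihilating_pairs\<close>) and \<open>p\<^sup>p\<close> choices of \<open>C\<close>.

  The PBW property is first turned into linear algebra. The associated graded algebra of \<open>H\<close> is
  always a quotient of \<open>S(V) \<rtimes> G\<close>, whose homogeneous parts are finite. Hence any graded isomorphism
  whatever forces the quotient map to be injective, and the property says that the monomials
  \<open>v\<^sub>2\<^sup>j v\<^sub>1\<^sup>i h\<close> are linearly independent in \<open>H\<close> (\<open>PBW_iff_independent\<close>).

  If they are independent, rewriting \<open>h h' v\<close> and \<open>g v\<^sub>1 v\<^sub>2\<close> in two ways and comparing coefficients
  yields the shape of \<open>\<lambda>\<close> and the two conditions (\<open>l1_add\<close>, \<open>l2_add\<close>, \<open>PBW_conditions\<close>).
  Conversely, under the conditions \<open>H\<close> is an iterated Ore extension of \<open>R\<close>. This is made concrete by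
  the right module that would be \<open>Hom\<^sub>R(H, R)\<close>: a functional is a double sequence of values
  on the \<open>v\<^sub>2\<^sup>n v\<^sub>1\<^sup>k\<close>, and the action of the generators is defined by recursion on \<open>n\<close>
  (\<open>op_relations\<close>). Coordinate functionals separate the monomials (\<open>nf_independent\<close>).
\<close>

abbreviation single :: "'k \<Rightarrow> 'a::zero \<Rightarrow> 'k \<Rightarrow>\<^sub>0 'a" where "single \<equiv> Poly_Mapping.single"
abbreviation lookup :: "('k \<Rightarrow>\<^sub>0 'a::zero) \<Rightarrow> 'k \<Rightarrow> 'a" where "lookup \<equiv> Poly_Mapping.lookup"
abbreviation keys :: "('k \<Rightarrow>\<^sub>0 'a::zero) \<Rightarrow> 'k set" where "keys \<equiv> Poly_Mapping.keys"

section \<open>Additive maps on finitely supported functions\<close>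

text \<open>
  The maps \<open>F k\<close> will be additive. Over a prime field additive maps are linear, so this is the
  map out of the free module with basis \<open>'k\<close> that is prescribed on the basis.
\<close>

definition lin_ext :: "('k \<Rightarrow> 'a::zero \<Rightarrow> 'b::comm_monoid_add) \<Rightarrow> ('k \<Rightarrow>\<^sub>0 'a) \<Rightarrow> 'b" where
  "lin_ext F u = (\<Sum>k\<in>keys u. F k (lookup u k))"

lemma lin_ext_superset:
  assumes "\<And>k. F k 0 = 0" "finite S" "keys u \<subseteq> S"
  shows "lin_ext F u = (\<Sum>k\<in>S. F k (lookup u k))"
  unfolding lin_ext_def using assms by (intro sum.mono_neutral_left) (auto simp: in_keys_iff)

lemma lin_ext_single [simp]: "F k 0 = 0 \<Longrightarrow> lin_ext F (single k a) = F k a"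
  by (cases "a = 0") (simp_all add: lin_ext_def)

lemma additive_lin_ext:
  fixes F :: "'k \<Rightarrow> 'a::ab_group_add \<Rightarrow> 'b::ab_group_add"
  assumes "\<And>k. additive (F k)"
  shows "additive (lin_ext F)"
proof (rule additive.intro)
  fix u v :: "'k \<Rightarrow>\<^sub>0 'a"
  let ?S = "keys u \<union> keys v"
  have F0: "F k 0 = 0" for k using additive.zero[OF assms] .
  have "keys (u + v) \<subseteq> ?S" by (rule Poly_Mapping.keys_add)
  then show "lin_ext F (u + v) = lin_ext F u + lin_ext F v"
    by (simp add: lin_ext_superset[of F, OF F0, of ?S] lookup_add additive.add[OF assms] sum.distrib)
qed

lemma additive_compose: "additive f \<Longrightarrow> additive g \<Longrightarrow> additive (\<lambda>x. f (g x))"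
  by (simp add: additive_def)

lemma additive_plus: "additive f \<Longrightarrow> additive g \<Longrightarrow> additive (\<lambda>x. f x + g x)"
  by (simp add: additive_def)

lemma additive_minus: "additive f \<Longrightarrow> additive g \<Longrightarrow> additive (\<lambda>x. f x - g x)"
  by (simp add: additive_def)

lemma additive_ident: "additive (\<lambda>x. x)"
  by (simp add: additive_def)

lemma additive_mult_left: "additive (\<lambda>x. a * x :: 'a :: ring)"
  by (simp add: additive_def distrib_left)

lemma additive_mult_right: "additive (\<lambda>x. x * a :: 'a :: ring)"
  by (simp add: additive_def distrib_right)

lemma additive_single: "additive (single k)"
  by (simp add: additive_def single_add)

lemma additive_lookup: "additive (\<lambda>u. lookup u k)"
  by (simp add: additive_def lookup_add)

lemmas additive_intros = additive_lin_ext additive_plus additive_minus additive_ident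
  additive_mult_left additive_mult_right additive_single additive_lookup

lemma sum_single_keys: "(\<Sum>k\<in>keys u. single k (lookup u k)) = u"
proof (rule poly_mapping_eqI)
  fix k
  have "lookup (\<Sum>k\<in>keys u. single k (lookup u k)) k = (\<Sum>k'\<in>keys u. if k' = k then lookup u k' else 0)"
    by (simp add: lookup_sum lookup_single when_def)
  also have "\<dots> = lookup u k"
    by (simp add: in_keys_iff)
  finally show "lookup (\<Sum>k\<in>keys u. single k (lookup u k)) k = lookup u k" .
qed

lemma poly_mapping_additive_induct [case_names single add]:
  assumes "\<And>k a. P (single k a)" and "\<And>u v. P u \<Longrightarrow> P v \<Longrightarrow> P (u + v)"
  shows "P (u :: 'k \<Rightarrow>\<^sub>0 'a::comm_monoid_add)"
proof -
  have P0: "P 0" using assms(1)[of undefined 0] by simp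
  have "P (\<Sum>k\<in>S. single k (lookup u k))" if "finite S" for S
    using that by (induction S rule: finite_induct) (simp_all add: assms P0)
  from this[OF finite_keys[of u]] show ?thesis by (simp add: sum_single_keys)
qed

lemma additive_eqI:
  fixes f :: "('k \<Rightarrow>\<^sub>0 'a::ab_group_add) \<Rightarrow> 'b::ab_group_add"
  assumes "additive f" "additive g" "\<And>k a. f (single k a) = g (single k a)"
  shows "f u = g u"
  by (induction u rule: poly_mapping_additive_induct) (simp_all add: assms additive.add)

text \<open>
  The form in which identities between products, in the free algebra, the group algebra and the skew
  group algebra alike, are reduced to the basis.
\<close>

lemma biadditive_eqI:
  fixes f :: "('k \<Rightarrow>\<^sub>0 'a::ab_group_add) \<Rightarrow> ('l \<Rightarrow>\<^sub>0 'c::ab_group_add) \<Rightarrow> 'b::ab_group_add"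
  assumes "\<And>v. additive (\<lambda>u. f u v)" "\<And>v. additive (\<lambda>u. g u v)"
    and "\<And>u. additive (f u)" "\<And>u. additive (g u)"
    and "\<And>k a l c. f (single k a) (single l c) = g (single k a) (single l c)"
  shows "f u v = g u v"
proof (rule additive_eqI[of "\<lambda>u. f u v" "\<lambda>u. g u v"])
  show "f (single k a) v = g (single k a) v" for k a
    by (rule additive_eqI) (fact assms)+
qed (fact assms)+

definition restr :: "('k \<Rightarrow> bool) \<Rightarrow> ('k \<Rightarrow>\<^sub>0 'a::comm_monoid_add) \<Rightarrow> 'k \<Rightarrow>\<^sub>0 'a" where
  "restr P = lin_ext (\<lambda>k a. if P k then single k a else 0)"

lemma additive_restr: "additive (restr P :: ('k \<Rightarrow>\<^sub>0 'a::ab_group_add) \<Rightarrow> _)"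
  unfolding restr_def by (rule additive_lin_ext) (auto simp: additive_def single_add)

lemma lookup_restr: "lookup (restr P u) k = (if P k then lookup u k else 0)"
proof -
  have "lookup (restr P u) k = (\<Sum>k'\<in>keys u. if k' = k then (if P k then lookup u k else 0) else 0)"
    unfolding restr_def lin_ext_def lookup_sum
    by (intro sum.cong) (auto simp: lookup_single when_def)
  also have "\<dots> = (if P k then lookup u k else 0)"
    by (simp add: in_keys_iff)
  finally show ?thesis .
qed

section \<open>The group algebra and its Euler derivation\<close>

text \<open>
  The discrete logarithm of a group element, defined modulo \<open>p\<close> and so an element of the field.
\<close>

definition ix :: "'p::prime_card cyc \<Rightarrow> 'p mod_ring" where
  "ix h = Rep_cyc h $ 1 $ 2"

lemma ix_gpow [simp]: "ix (gpow i) = of_nat i"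
  by (simp add: ix_def gpow.rep_eq gmat_pow_explicit)

lemma gpow_surj: obtains i where "i < CARD('p)" "h = (gpow i :: 'p::prime_card cyc)"
  using bij_betw_gpow[where 'p = 'p] by (auto simp: bij_betw_def image_iff)

lemma finite_cyc: "finite (UNIV :: 'p::prime_card cyc set)"
  using bij_betw_gpow[where 'p = 'p] bij_betw_finite by blast

lemma gpow_0 [simp]: "gpow 0 = 0"
  by transfer (simp add: gmat_pow_def)

lemma ix_add [simp]: "ix (h + h') = ix h + ix h'"
  by (metis gpow_add gpow_surj ix_gpow of_nat_add)

lemma ix_0 [simp]: "ix 0 = 0"
  by (metis gpow_0 ix_gpow of_nat_0)

lemma act_v1 [simp]: "act h v1 = v1" and act_v2: "act h v2 = ix h *s v1 + v2"
  by (metis act_gpow(1) gpow_surj) (metis act_gpow(2) gpow_surj ix_gpow)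

definition wt :: "('p mod_ring \<Rightarrow> 'p mod_ring) \<Rightarrow> 'p::prime_card FG \<Rightarrow> 'p FG" where
  "wt c = lin_ext (\<lambda>h a. single h (c (ix h) * a))"

text \<open>
  These are \<open>g d/dg\<close> and the divided power \<open>g\<^sup>2/2 d\<^sup>2/dg\<^sup>2\<close>, with eigenvalues \<open>i\<close> and \<open>i choose 2\<close>
  on \<open>g\<^sup>i\<close>. Moving \<open>g\<^sup>i\<close> past \<open>v2\<close> adds up \<open>i\<close> copies of one term and \<open>i choose 2\<close> copies of another.
\<close>

definition eul :: "'p::prime_card FG \<Rightarrow> 'p FG" where "eul = wt (\<lambda>i. i)"
definition eul2 :: "'p::prime_card FG \<Rightarrow> 'p FG" where "eul2 = wt (\<lambda>i. i * (i - 1) / 2)"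

lemma additive_wt: "additive (wt c)"
  unfolding wt_def by (rule additive_lin_ext) (simp add: additive_def single_add distrib_left)

lemma wt_single [simp]: "wt c (single h a) = single h (c (ix h) * a)"
  by (simp add: wt_def)

lemma lookup_wt: "lookup (wt c u) h = c (ix h) * lookup u h"
  by (rule additive_eqI[of "\<lambda>u. lookup (wt c u) h" "\<lambda>u. c (ix h) * lookup u h"])
    (auto simp: additive_def additive.add[OF additive_wt] lookup_add distrib_left lookup_single when_def)

lemma eul_simps:
  "eul (u + v) = eul u + eul v" "eul (u - v) = eul u - eul v" "eul (- u) = - eul u"
  "eul 0 = 0" "eul 1 = 0" "eul (single h a) = single h (ix h * a)" "lookup (eul u) h = ix h * lookup u h"
  using additive.add[OF additive_wt] additive.diff[OF additive_wt] additive.minus[OF additive_wt]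
    additive.zero[OF additive_wt]
  by (auto simp: eul_def lookup_wt simp flip: single_one)

lemma eul2_simps:
  "eul2 (u + v) = eul2 u + eul2 v" "eul2 (u - v) = eul2 u - eul2 v" "eul2 (- u) = - eul2 u"
  "eul2 0 = 0" "eul2 1 = 0" "eul2 (single h a) = single h (ix h * (ix h - 1) / 2 * a)"
  "lookup (eul2 u) h = ix h * (ix h - 1) / 2 * lookup u h"
  using additive.add[OF additive_wt] additive.diff[OF additive_wt] additive.minus[OF additive_wt]
    additive.zero[OF additive_wt]
  by (auto simp: eul2_def lookup_wt simp flip: single_one)

lemma lookup_const_mult: "lookup (single 0 c * r) h = c * lookup r h" for r :: "'p::prime_card FG"
  by (rule additive_eqI[of "\<lambda>r. lookup (single 0 c * r) h" "\<lambda>r. c * lookup r h"])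
    (auto simp: additive_def distrib_left lookup_add mult_single lookup_single when_def)

lemma eul_mult: "eul (u * v) = u * eul v + v * eul u"
  by (rule biadditive_eqI[of "\<lambda>u v. eul (u * v)" "\<lambda>u v. u * eul v + v * eul u"])
    (simp_all add: additive_def eul_simps algebra_simps mult_single flip: single_add)

lemma two_neq_0: "odd CARD('p) \<Longrightarrow> (2 :: 'p::prime_card mod_ring) \<noteq> 0"
  using of_nat_0_mod_ring_dvd[of 2, where 'a = 'p] prime_card[where 'a = 'p]
  by (metis dvd_refl of_nat_numeral primes_dvd_imp_eq two_is_prime_nat)

text \<open>
  On a product \<open>g\<^sup>i g\<^sup>j\<close> this is Vandermonde's identity for \<open>i + j choose 2\<close>, in which the mixed term
  \<open>i j\<close> is the last summand.
\<close>

lemma eul2_mult: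
  assumes "odd CARD('p::prime_card)"
  shows "eul2 (u * v :: 'p FG) = u * eul2 v + v * eul2 u + eul u * eul v"
proof (rule biadditive_eqI[of "\<lambda>u v. eul2 (u * v)" "\<lambda>u v. u * eul2 v + v * eul2 u + eul u * eul v"])
  fix h h' :: "'p cyc" and a c :: "'p mod_ring"
  define k :: "'p mod_ring" where "k = inverse 2"
  have "k + k = 1"
    using two_neq_0[OF assms] by (simp add: k_def flip: mult_2)
  then have split: "ix h * a * (ix h' * c) = (k + k) * (ix h * a * (ix h' * c))"
    by simp
  have "(ix h + ix h') * (ix h + ix h' - 1) / 2 * (a * c) =
    a * (ix h' * (ix h' - 1) / 2 * c) + c * (ix h * (ix h - 1) / 2 * a) + ix h * a * (ix h' * c)"
    unfolding divide_inverse k_def[symmetric] by (subst split) (simp add: algebra_simps)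
  then show "eul2 (single h a * single h' c) =
      single h a * eul2 (single h' c) + single h' c * eul2 (single h a) + eul (single h a) * eul (single h' c)"
    by (simp only: mult_single eul2_simps eul_simps ix_add add.commute[of h' h] flip: single_add)
qed (simp_all add: additive_def eul2_simps eul_simps distrib_left distrib_right add_ac)

lemma two_eul2:
  assumes "odd CARD('p::prime_card)"
  shows "eul2 u + eul2 u = eul (eul (u :: 'p FG)) - eul u"
proof (rule poly_mapping_eqI)
  fix h :: "'p cyc"
  have *: "2 * (ix h * (ix h - 1) / 2) = ix h * (ix h - 1)"
    using two_neq_0[OF assms] by simp
  have "lookup (eul2 u + eul2 u) h = 2 * (ix h * (ix h - 1) / 2) * lookup u h"
    by (simp only: lookup_add eul2_simps mult_2 distrib_right)
  then have "lookup (eul2 u + eul2 u) h = ix h * (ix h - 1) * lookup u h"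
    by (simp only: *)
  also have "\<dots> = lookup (eul (eul u) - eul u) h"
    by (simp add: lookup_minus eul_simps algebra_simps)
  finally show "lookup (eul2 u + eul2 u) h = lookup (eul (eul u) - eul u) h" .
qed

section \<open>The filtration of the group algebra by powers of \<open>g - 1\<close>\<close>

lemma gp_add: "gp (i + j) = gp i * gp j"
  by (simp add: mult_single gpow_add)

lemma gp_power: "gp (i * n) = gp i ^ n"
  by (induction n) (simp_all add: gp_add)

lemma gp_card: "gp CARD('p) = (1 :: 'p::prime_card FG)"
  using gpow_eq_iff[of "CARD('p)" 0, where 'p = 'p] by simp

lemma single_power: "single (gpow i) a ^ n = (single (gpow (i * n)) (a ^ n) :: 'p::prime_card FG)"
  by (induction n) (simp_all add: mult_single gpow_add)

lemma CHAR_FG: "CHAR('p::prime_card FG) = CARD('p)"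
proof (rule CHAR_eqI)
  show "of_nat CARD('p) = (0 :: 'p FG)"
    by (metis of_nat_card_eq_0 single_of_nat single_zero)
  show "CARD('p) dvd n" if "of_nat n = (0 :: 'p FG)" for n
    using that by (metis of_nat_0_mod_ring_dvd inj_single injD single_of_nat single_zero)
qed

text \<open>
  Fermat's theorem, by induction with the Frobenius identity.
\<close>

lemma mod_ring_power_card: "a ^ CARD('p) = (a :: 'p::prime_card mod_ring)"
proof -
  obtain i where a: "a = of_nat i" using surj_of_nat_mod_ring by blast
  have "prime CHAR('p mod_ring)" by (simp add: prime_card)
  then show ?thesis unfolding a
    by (induction i) (simp_all add: freshmans_dream[of "CARD('p)"] zero_power)
qed

text \<open>
  The group algebra is the truncated polynomial ring in this element.
\<close>

definition aug_gen :: "'p::prime_card FG" (\<open>\<t>\<close>) where "\<t> = gp 1 - 1"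

lemma gp_1_eq: "gp 1 = \<t> + 1"
  by (simp add: aug_gen_def)

lemma t_power_card: "\<t> ^ CARD('p) = (0 :: 'p::prime_card FG)"
proof -
  have *: "(\<t> + 1) ^ CARD('p) = \<t> ^ CARD('p) + (1 :: 'p FG) ^ CARD('p)"
    by (rule freshmans_dream) (simp_all only: CHAR_FG prime_card)
  have "(\<t> + 1) ^ CARD('p) = (1 :: 'p FG)"
    using gp_power[of 1 "CARD('p)", where 'a = 'p] gp_card[where 'p = 'p] by (simp flip: gp_1_eq)
  with * show ?thesis by simp
qed

lemma gpow_eq_less: "i < CARD('p) \<Longrightarrow> j < CARD('p) \<Longrightarrow> gpow i = (gpow j :: 'p::prime_card cyc) \<longleftrightarrow> i = j"
  by (simp add: gpow_eq_iff)

lemma t_power_less_card: "\<t> ^ (CARD('p) - 1) \<noteq> (0 :: 'p::prime_card FG)"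
proof -
  let ?n = "CARD('p) - 1"
  have n: "i < CARD('p)" if "i \<le> ?n" for i using that zero_less_card_finite[where 'a = 'p] by linarith
  have "\<t> ^ ?n = (\<Sum>k\<le>?n. of_nat (?n choose k) * gp 1 ^ k * (- 1) ^ (?n - k) :: 'p FG)"
    using binomial_ring[of "gp 1" "- 1 :: 'p FG" ?n] by (simp add: aug_gen_def)
  also have "\<dots> = (\<Sum>k\<le>?n. single (gpow k) (of_nat (?n choose k) * (- 1) ^ (?n - k)))"
  proof (rule sum.cong[OF refl])
    fix k
    have "(- 1 :: 'p FG) ^ m = single 0 ((- 1) ^ m)" for m
      by (induction m) (simp_all add: mult_single single_uminus)
    moreover have "gp 1 ^ k = (gp k :: 'p FG)" by (simp flip: gp_power)
    ultimately show "of_nat (?n choose k) * gp 1 ^ k * (- 1) ^ (?n - k) =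
        single (gpow k) (of_nat (?n choose k) * (- 1) ^ (?n - k) :: 'p mod_ring)"
      by (simp only: mult_single flip: single_of_nat) simp
  qed
  finally have "lookup (\<t> ^ ?n) (gpow ?n) =
      (\<Sum>k\<le>?n. if k = ?n then of_nat (?n choose k) * (- 1) ^ (?n - k) else (0 :: 'p mod_ring))"
    by (simp add: lookup_sum lookup_single when_def gpow_eq_less n cong: if_cong)
  then have "lookup (\<t> ^ ?n) (gpow ?n) = (1 :: 'p mod_ring)" by simp
  then show ?thesis by auto
qed

lemma t_power_eq_0_iff: "\<t> ^ n = (0 :: 'p::prime_card FG) \<longleftrightarrow> CARD('p) \<le> n"
proof
  assume 0: "\<t> ^ n = (0 :: 'p FG)"
  show "CARD('p) \<le> n"
  proof (rule ccontr)
    assume "\<not> CARD('p) \<le> n"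
    then have "\<t> ^ (CARD('p) - 1) = \<t> ^ n * (\<t> ^ (CARD('p) - 1 - n) :: 'p FG)"
      by (simp flip: power_add)
    with 0 t_power_less_card show False by (metis mult_zero_left)
  qed
next
  assume "CARD('p) \<le> n"
  then have "\<t> ^ n = \<t> ^ CARD('p) * (\<t> ^ (n - CARD('p)) :: 'p FG)" by (simp flip: power_add)
  then show "\<t> ^ n = (0 :: 'p FG)" by (simp add: t_power_card)
qed

definition aug :: "'p::prime_card FG \<Rightarrow> 'p mod_ring" where "aug = lin_ext (\<lambda>h a. a)"

lemma aug_single [simp]: "aug (single h a) = a"
  by (simp add: aug_def)

lemma aug_eq_sum: "aug b = (\<Sum>i<CARD('p). gcoeff b i)" for b :: "'p::prime_card FG"
proof -
  have "aug b = (\<Sum>h\<in>UNIV. lookup b h)"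
    unfolding aug_def by (rule lin_ext_superset) (simp_all add: finite_cyc)
  also have "\<dots> = (\<Sum>i<CARD('p). gcoeff b i)"
    by (rule sum.reindex_bij_betw[OF bij_betw_gpow, symmetric])
  finally show ?thesis .
qed

lemma FG_eq_sum: "b = (\<Sum>i<CARD('p). single (gpow i) (gcoeff b i))" for b :: "'p::prime_card FG"
proof -
  have "b = (\<Sum>h\<in>keys b. single h (lookup b h))" by (simp add: sum_single_keys)
  also have "\<dots> = (\<Sum>h\<in>UNIV. single h (lookup b h))"
    by (rule sum.mono_neutral_left) (simp_all add: finite_cyc in_keys_iff)
  also have "\<dots> = (\<Sum>i<CARD('p). single (gpow i) (gcoeff b i))"
    by (rule sum.reindex_bij_betw[OF bij_betw_gpow, symmetric])
  finally show ?thesis .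
qed

lemma FG_eqI: "(\<And>i. i < CARD('p) \<Longrightarrow> gcoeff b i = gcoeff c i) \<Longrightarrow> b = c" for b c :: "'p::prime_card FG"
  by (subst (1 2) FG_eq_sum) simp

text \<open>
  Frobenius maps every group element to the identity. Consequently an element is a unit or nilpotent
  according to whether its augmentation vanishes.
\<close>

lemma power_card_eq_aug: "b ^ CARD('p) = single 0 (aug b)" for b :: "'p::prime_card FG"
proof -
  have "b ^ CARD('p) = (\<Sum>i<CARD('p). single (gpow i) (gcoeff b i)) ^ CARD('p)"
    by (simp flip: FG_eq_sum)
  also have "\<dots> = (\<Sum>i<CARD('p). single (gpow i) (gcoeff b i) ^ CARD('p))"
    by (rule freshmans_dream_sum) (simp_all only: CHAR_FG prime_card)
  also have "\<dots> = (\<Sum>i<CARD('p). single 0 (gcoeff b i))"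
  proof (rule sum.cong[OF refl])
    fix i
    have "gpow (i * CARD('p)) = (gpow 0 :: 'p cyc)" by (simp only: gpow_eq_iff) simp
    then show "single (gpow i) (gcoeff b i) ^ CARD('p) = single (0 :: 'p cyc) (gcoeff b i)"
      by (simp only: single_power mod_ring_power_card gpow_0)
  qed
  also have "\<dots> = single 0 (aug b)"
    by (simp add: aug_eq_sum additive.sum[OF additive_single])
  finally show ?thesis .
qed

lemma aug_unit:
  assumes "aug b \<noteq> 0" obtains c where "b * c = (1 :: 'p::prime_card FG)"
proof
  have "b * b ^ (CARD('p) - 1) = b ^ CARD('p)"
    by (metis One_nat_def Suc_pred power_Suc zero_less_card_finite)
  then show "b * (b ^ (CARD('p) - 1) * single 0 (inverse (aug b))) = 1"
    using assms by (simp add: power_card_eq_aug mult_single flip: mult.assoc)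
qed

lemma t_dvd_minus_aug: "\<t> dvd b - single 0 (aug b)" for b :: "'p::prime_card FG"
proof -
  have "b - single 0 (aug b) = (\<Sum>i<CARD('p). single 0 (gcoeff b i) * (gp 1 ^ i - 1))"
    using gp_power[of 1, where 'a = 'p] FG_eq_sum[of b]
    by (simp add: aug_eq_sum additive.sum[OF additive_single] right_diff_distrib sum_subtractf mult_single
        del: One_nat_def flip: gp_power)
  moreover have "\<t> dvd gp 1 ^ i - (1 :: 'p FG)" for i
    by (simp add: aug_gen_def power_diff_1_eq)
  ultimately show ?thesis by (simp add: dvd_sum)
qed

lemma t_decompose: obtains w where "b = single 0 (aug b) + \<t> * (w :: 'p::prime_card FG)"
  using t_dvd_minus_aug[of b] by (auto simp: dvd_def algebra_simps)

lemma aug_exponent_iff: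
  "aug_exponent b k \<longleftrightarrow> k \<le> CARD('p) \<and> (\<exists>u. b = \<t> ^ k * u \<and> aug u \<noteq> 0)" for b :: "'p::prime_card FG"
  by (simp add: aug_exponent_def aug_eq_sum aug_gen_def)

text \<open>
  The exponent is the largest power of \<open>\<t>\<close> that divides \<open>b\<close>: a cofactor with augmentation zero would
  be divisible by \<open>\<t>\<close> once more.
\<close>

lemma aug_exponent_ex: "\<exists>k. aug_exponent (b :: 'p::prime_card FG) k"
proof -
  let ?P = "\<lambda>k. k \<le> CARD('p) \<and> \<t> ^ k dvd b"
  define k where "k = (GREATEST k. ?P k)"
  have k: "?P k" unfolding k_def by (rule GreatestI_nat[of ?P 0 "CARD('p)"]) auto
  then obtain u where u: "b = \<t> ^ k * u" by (auto simp: dvd_def)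
  show ?thesis
  proof (cases "aug u = 0")
    case False
    with k u show ?thesis by (auto simp: aug_exponent_iff)
  next
    case True
    then obtain w where "u = \<t> * w" using t_decompose[of u] by auto
    then have *: "b = \<t> ^ Suc k * w" by (simp add: u ac_simps)
    have "k = CARD('p)"
    proof (rule ccontr)
      assume "k \<noteq> CARD('p)"
      then have "?P (Suc k)" using k * by simp
      then have "Suc k \<le> k" unfolding k_def by (rule Greatest_le_nat[of ?P _ "CARD('p)"]) auto
      then show False by simp
    qed
    \<comment> \<open>Exponent \<open>p\<close> means \<open>b = 0\<close>, and then the cofactor may be replaced by \<open>1\<close>.\<close>
    then have "b = \<t> ^ CARD('p) * 1" using u by (simp add: t_power_card)
    moreover have "aug (1 :: 'p FG) \<noteq> 0" by (simp flip: single_one)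
    ultimately have "aug_exponent b CARD('p)" unfolding aug_exponent_iff by blast
    then show ?thesis ..
  qed
qed

lemma t_power_dvd_exponent:
  assumes "aug_exponent (b :: 'p::prime_card FG) k" "\<t> ^ l dvd b" "l \<le> CARD('p)"
  shows "l \<le> k"
proof (rule ccontr)
  assume "\<not> l \<le> k"
  from assms(1) obtain u where u: "b = \<t> ^ k * u" "aug u \<noteq> 0" by (auto simp: aug_exponent_iff)
  obtain c where c: "u * c = 1" using aug_unit[OF u(2)] .
  have "\<t> ^ k = b * c" using c by (simp add: u mult.assoc)
  with assms(2) have "\<t> ^ l dvd (\<t> ^ k :: 'p FG)" by simp
  then obtain w where w: "\<t> ^ k = \<t> ^ l * (w :: 'p FG)" by (auto simp: dvd_def)
  have "\<t> ^ (CARD('p) - l + k) = \<t> ^ (CARD('p) - l + l) * w"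
    by (simp add: power_add w mult.assoc)
  also have "\<dots> = 0" using assms(3) by (simp add: t_power_card)
  finally show False using \<open>\<not> l \<le> k\<close> assms(3) by (simp add: t_power_eq_0_iff)
qed

lemma aug_exponent_ex1: "\<exists>!k. aug_exponent (b :: 'p::prime_card FG) k"
proof -
  have "l \<le> k" if "aug_exponent b l" "aug_exponent b k" for k l
    using that(1) by (intro t_power_dvd_exponent[OF that(2)]) (auto simp: aug_exponent_iff)
  then show ?thesis using aug_exponent_ex[of b] by (metis le_antisym)
qed

text \<open>
  Up to a unit \<open>b\<close> is \<open>\<t>\<^sup>k\<close>, and \<open>\<t>\<^sup>k \<t>\<^sup>l = 0\<close> if and only if \<open>k + l \<ge> p\<close>.
\<close>

lemma annihilator:
  assumes "aug_exponent (b :: 'p::prime_card FG) k"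
  shows "b * m = 0 \<longleftrightarrow> \<t> ^ (CARD('p) - k) dvd m"
proof
  from assms obtain u where u: "b = \<t> ^ k * u" "aug u \<noteq> 0" and k: "k \<le> CARD('p)"
    by (auto simp: aug_exponent_iff)
  {
    assume "\<t> ^ (CARD('p) - k) dvd m"
    then obtain w where "m = \<t> ^ (CARD('p) - k) * w" by (auto simp: dvd_def)
    then have "b * m = \<t> ^ (k + (CARD('p) - k)) * (u * w)" by (simp add: u power_add ac_simps)
    then show "b * m = 0" using k by (simp add: t_power_card)
  }
  assume "b * m = 0"
  obtain c where c: "u * c = 1" using aug_unit[OF u(2)] .
  obtain l where "aug_exponent m l" using aug_exponent_ex by blast
  then obtain u' where u': "m = \<t> ^ l * u'" "aug u' \<noteq> 0" by (auto simp: aug_exponent_iff)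
  obtain c' where c': "u' * c' = 1" using aug_unit[OF u'(2)] .
  have "\<t> ^ (k + l) = (u * c) * (u' * c') * (\<t> ^ (k + l) :: 'p FG)" by (simp add: c c')
  also have "\<dots> = b * m * (c * c')" by (simp add: u u' power_add ac_simps)
  finally have "CARD('p) \<le> k + l" using \<open>b * m = 0\<close> by (simp add: t_power_eq_0_iff)
  then have "CARD('p) - k \<le> l" by simp
  then show "\<t> ^ (CARD('p) - k) dvd m" by (simp add: u' le_imp_power_dvd dvd_mult2)
qed

text \<open>
  Each multiple of \<open>\<t>\<^sup>k\<close> has a unique leading coefficient at \<open>\<t>\<^sup>k\<close>, so the number of multiples
  is divided by \<open>p\<close> when \<open>k\<close> grows by one.
\<close>

lemma card_t_power_multiples:
  assumes "k \<le> CARD('p)"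
  shows "finite {b :: 'p::prime_card FG. \<t> ^ k dvd b} \<and> card {b :: 'p FG. \<t> ^ k dvd b} = CARD('p) ^ (CARD('p) - k)"
  using assms
proof (induction k rule: inc_induct)
  case base
  have "{b :: 'p FG. \<t> ^ CARD('p) dvd b} = {0}" by (simp add: t_power_card)
  then show ?case by simp
next
  case (step k)
  let ?Z = "\<lambda>k. {b :: 'p FG. \<t> ^ k dvd b}"
  let ?f = "\<lambda>(c, z). single 0 c * \<t> ^ k + z :: 'p FG"
  have "inj_on ?f (UNIV \<times> ?Z (Suc k))"
  proof (rule inj_onI, clarify)
    fix c c' :: "'p mod_ring" and z z' :: "'p FG"
    assume z: "\<t> ^ Suc k dvd z" "\<t> ^ Suc k dvd z'" and eq: "single 0 c * \<t> ^ k + z = single 0 c' * \<t> ^ k + z'"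
    have "c = c'"
    proof (rule ccontr)
      assume "c \<noteq> c'"
      then have "aug_exponent (single 0 (c - c') * \<t> ^ k :: 'p FG) k"
        using step.hyps unfolding aug_exponent_iff by (intro conjI exI[of _ "single 0 (c - c')"]) (auto simp: mult.commute)
      moreover have "single 0 (c - c') * \<t> ^ k = z' - z"
        using eq by (simp add: single_diff algebra_simps)
      then have "\<t> ^ Suc k dvd single 0 (c - c') * (\<t> ^ k :: 'p FG)" using z by (simp only: dvd_diff)
      ultimately show False using t_power_dvd_exponent[of _ k "Suc k"] step.hyps by (metis Suc_leI not_less_eq_eq order_refl)
    qed
    with eq show "c = c' \<and> z = z'" by simp
  qed
  moreover have "?f ` (UNIV \<times> ?Z (Suc k)) = ?Z k"
  proof (intro equalityI subsetI)
    fix b assume "b \<in> ?Z k"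
    then obtain u where u: "b = \<t> ^ k * u" by (auto simp: dvd_def)
    obtain w where w: "u = single 0 (aug u) + \<t> * w" by (rule t_decompose)
    have "b = ?f (aug u, \<t> ^ Suc k * w)" by (subst u, subst w) (simp add: algebra_simps)
    then show "b \<in> ?f ` (UNIV \<times> ?Z (Suc k))" by (rule image_eqI) simp
  qed (auto intro!: dvd_add dest: dvd_mult_right)
  ultimately have bij: "bij_betw ?f (UNIV \<times> ?Z (Suc k)) (?Z k)" by (simp add: bij_betw_def)
  have "finite (?Z k)" using bij_betw_finite[OF bij] step.IH by simp
  moreover have "card (?Z k) = card ((UNIV :: 'p mod_ring set) \<times> ?Z (Suc k))" using bij_betw_same_card[OF bij] by (rule sym)
  then have "card (?Z k) = CARD('p) * CARD('p) ^ (CARD('p) - Suc k)"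
    using step.IH by (simp add: card_cartesian_product)
  then have "card (?Z k) = CARD('p) ^ (CARD('p) - k)"
    using step.hyps by (simp add: Suc_diff_Suc flip: power_Suc)
  ultimately show ?case by simp
qed

lemma finite_FG: "finite (UNIV :: 'p::prime_card FG set)" and card_FG: "card (UNIV :: 'p FG set) = CARD('p) ^ CARD('p)"
  using card_t_power_multiples[of 0, where 'p = 'p] by simp_all

lemma aug_exponent_iff_dvd:
  assumes "k < CARD('p)"
  shows "aug_exponent b k \<longleftrightarrow> \<t> ^ k dvd b \<and> \<not> \<t> ^ Suc k dvd (b :: 'p::prime_card FG)"
proof
  assume b: "aug_exponent b k"
  then have "\<t> ^ k dvd b" by (auto simp: aug_exponent_iff)
  moreover have "\<not> \<t> ^ Suc k dvd b"
    using t_power_dvd_exponent[OF b, of "Suc k"] assms by linarith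
  ultimately show "\<t> ^ k dvd b \<and> \<not> \<t> ^ Suc k dvd b" ..
next
  assume b: "\<t> ^ k dvd b \<and> \<not> \<t> ^ Suc k dvd b"
  obtain l where l: "aug_exponent b l" using aug_exponent_ex by blast
  then have "\<t> ^ l dvd b" by (auto simp: aug_exponent_iff)
  then have "\<not> Suc k \<le> l" using b by (meson dvd_trans le_imp_power_dvd)
  moreover have "k \<le> l" using t_power_dvd_exponent[OF l, of k] b assms by simp
  ultimately have "l = k" by simp
  with l show "aug_exponent b k" by simp
qed

text \<open>
  The pairs are sorted by the exponent of \<open>b\<close>. There are \<open>p\<^sup>j\<^sup>+\<^sup>1 - p\<^sup>j\<close> elements \<open>b\<close> of exponent
  \<open>p - j - 1\<close>, and each is annihilated by \<open>p\<^sup>p\<^sup>-\<^sup>j\<^sup>-\<^sup>1\<close> elements. So every exponent below \<open>p\<close>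
  contributes \<open>p\<^sup>p - p\<^sup>p\<^sup>-\<^sup>1\<close> pairs, and \<open>b = 0\<close> contributes \<open>p\<^sup>p\<close>.
\<close>

lemma card_annihilating_pairs:
  "card {(b, m). b * m = (0 :: 'p::prime_card FG)} = CARD('p) ^ (CARD('p) + 1)"
proof -
  define p where "p = CARD('p)"
  define Z where "Z k = {b :: 'p FG. \<t> ^ k dvd b}" for k
  define S where "S j = {(b, m). b * m = (0 :: 'p FG) \<and> b \<in> Z (p - j)}" for j
  have p0: "p \<noteq> 0" by (simp add: p_def)
  have fin: "finite X" for X :: "('p FG \<times> 'p FG) set"
    using finite_Prod_UNIV[OF finite_FG finite_FG] by (rule finite_subset[rotated]) simp
  have fin1: "finite X" for X :: "'p FG set"
    using finite_FG by (rule finite_subset[rotated]) simp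
  have card_Z: "card (Z k) = p ^ (p - k)" if "k \<le> p" for k
    using card_t_power_multiples[of k, where 'p = 'p] that by (simp add: Z_def p_def)
  have "card (S j) + j * p ^ (p - 1) = p ^ p + j * p ^ p" if "j \<le> p" for j
    using that
  proof (induction j)
    case 0
    have "S 0 = {0} \<times> UNIV" by (auto simp: S_def Z_def p_def t_power_card)
    then show ?case by (simp add: card_cartesian_product card_FG p_def)
  next
    case (Suc j)
    define k where "k = p - Suc j"
    have k: "p - j = Suc k" "k < p" "p - k = Suc j" "p - Suc k = j" using Suc.prems by (auto simp: k_def)
    define W where "W = Z k - Z (Suc k)"
    have Z_Suc: "Z (Suc k) \<subseteq> Z k" by (auto simp: Z_def dest: dvd_mult_right)
    have ann: "b * m = 0 \<longleftrightarrow> m \<in> Z (Suc j)" if "b \<in> W" for b m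
    proof -
      have "aug_exponent b k"
        using that k(2) by (simp add: aug_exponent_iff_dvd W_def Z_def p_def)
      from annihilator[OF this] show ?thesis using k(3) by (simp add: Z_def p_def)
    qed
    have "S (Suc j) = S j \<union> W \<times> Z (Suc j)"
    proof (intro equalityI subsetI)
      fix x assume "x \<in> S (Suc j)"
      then obtain b m where x: "x = (b, m)" "b * m = 0" "b \<in> Z k" by (auto simp: S_def k_def)
      show "x \<in> S j \<union> W \<times> Z (Suc j)"
      proof (cases "b \<in> Z (Suc k)")
        case True
        with x show ?thesis by (simp add: S_def k)
      next
        case False
        with x have "b \<in> W" by (simp add: W_def)
        with x ann show ?thesis by simp
      qed
    next
      fix x assume "x \<in> S j \<union> W \<times> Z (Suc j)"
      then show "x \<in> S (Suc j)"
        using Z_Suc ann by (auto simp: S_def k W_def simp flip: k_def)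
    qed
    moreover have "S j \<inter> W \<times> Z (Suc j) = {}" by (auto simp: S_def W_def k)
    ultimately have card_S: "card (S (Suc j)) = card (S j) + card W * card (Z (Suc j))"
      by (simp add: card_Un_disjoint fin card_cartesian_product)
    have "card W + p ^ j = p ^ Suc j"
    proof -
      have "card W = card (Z k) - card (Z (Suc k))"
        unfolding W_def by (rule card_Diff_subset[OF fin1 Z_Suc])
      moreover have "card (Z (Suc k)) \<le> card (Z k)" by (rule card_mono[OF fin1 Z_Suc])
      moreover have "card (Z (Suc k)) = p ^ j" using card_Z[of "Suc k"] k by simp
      moreover have "card (Z k) = p ^ Suc j" using card_Z[of k] k by simp
      ultimately show ?thesis by simp
    qed
    then have "(card W + p ^ j) * p ^ k = p ^ Suc j * p ^ k" by simp
    then have "card W * p ^ k + p ^ (j + k) = p ^ (Suc j + k)"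
      by (simp only: distrib_right power_add)
    moreover have "j + k = p - 1" "Suc j + k = p" using k by auto
    ultimately have "card W * p ^ k + p ^ (p - 1) = p ^ p" by simp
    moreover have "card (Z (Suc j)) = p ^ k"
      using card_Z[OF Suc.prems] by (simp add: k_def)
    ultimately show ?case using Suc card_S by simp
  qed
  from this[of p] have "card (S p) + p * p ^ (p - 1) = p ^ p + p * p ^ p" by simp
  moreover have "p * p ^ (p - 1) = p ^ p" using p0 by (simp add: power_eq_if)
  moreover have "S p = {(b, m). b * m = 0}" by (simp add: S_def Z_def)
  ultimately show ?thesis by (simp add: p_def)
qed

text \<open>
  Expanding these powers of \<open>1 - g\<^sup>-\<^sup>1\<close> produces the signs and binomial coefficients of \<open>mu\<close>. The
  inverse of \<open>g\<close> is written \<open>gpow (p - 1)\<close>.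
\<close>

definition s_comb :: "'p mod_ring list \<Rightarrow> 'p::prime_card FG" where
  "s_comb d = (\<Sum>l=1..length d. single 0 ((-1) ^ (l + 1) * d ! (l - 1)) * (1 - gp (CARD('p) - 1)) ^ (CARD('p) - l))"

lemma s_eq: "1 - gp (CARD('p) - 1) = gp (CARD('p) - 1) * (\<t> :: 'p::prime_card FG)"
  and t_eq: "\<t> = gp 1 * (1 - gp (CARD('p) - 1) :: 'p FG)"
proof -
  have "gp (CARD('p) - 1) * gp 1 = (gp (CARD('p) - 1 + 1) :: 'p FG)" by (simp only: gp_add)
  also have "CARD('p) - 1 + 1 = CARD('p)" using zero_less_card_finite[where 'a = 'p] by linarith
  finally have *: "gp (CARD('p) - 1) * gp 1 = (1 :: 'p FG)" by (simp only: gp_card)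
  then show "1 - gp (CARD('p) - 1) = gp (CARD('p) - 1) * (\<t> :: 'p FG)"
    by (simp only: aug_gen_def right_diff_distrib mult_1_right)
  from * show "\<t> = gp 1 * (1 - gp (CARD('p) - 1) :: 'p FG)"
    by (simp only: aug_gen_def right_diff_distrib mult_1_right mult.commute[of "gp 1"])
qed

lemma t_power_dvd_s_comb: "\<t> ^ (CARD('p) - length d) dvd (s_comb d :: 'p::prime_card FG)"
  unfolding s_comb_def
proof (rule dvd_sum)
  fix l assume "l \<in> {1..length d}"
  then have "\<t> ^ (CARD('p) - length d) dvd (\<t> ^ (CARD('p) - l) :: 'p FG)"
    by (intro le_imp_power_dvd diff_le_mono2) simp
  then show "\<t> ^ (CARD('p) - length d) dvd
      single 0 ((-1) ^ (l + 1) * d ! (l - 1)) * (1 - gp (CARD('p) - 1) :: 'p FG) ^ (CARD('p) - l)"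
    by (simp only: s_eq power_mult_distrib dvd_mult)
qed

text \<open>
  Since \<open>1 - g\<^sup>-\<^sup>1\<close> is a unit times \<open>\<t>\<close>, the two have the same powers up to units. The lowest
  coefficient of \<open>m\<close> becomes the last entry of \<open>d\<close>, and what remains has one factor \<open>\<t>\<close> more.
\<close>

lemma s_comb_surj:
  assumes "k \<le> CARD('p)" "\<t> ^ (CARD('p) - k) dvd (m :: 'p::prime_card FG)"
  shows "\<exists>d. length d = k \<and> m = s_comb d"
  using assms
proof (induction k arbitrary: m)
  case 0
  then show ?case by (simp add: s_comb_def t_power_card)
next
  case (Suc k)
  let ?n = "CARD('p) - Suc k" and ?s = "1 - gp (CARD('p) - 1) :: 'p FG"
  have n: "CARD('p) - k = Suc ?n" using Suc.prems by simp
  from Suc.prems(2) obtain w where "m = \<t> ^ ?n * w" by (auto simp: dvd_def)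
  then have m: "m = ?s ^ ?n * (gp 1 ^ ?n * w)"
    unfolding t_eq by (simp only: power_mult_distrib ac_simps)
  obtain w' where w': "gp 1 ^ ?n * w = single 0 (aug (gp 1 ^ ?n * w)) + \<t> * w'" by (rule t_decompose)
  define c where "c = aug (gp 1 ^ ?n * w)"
  have "\<t> ^ (CARD('p) - k) dvd ?s ^ ?n * (\<t> * w')"
    unfolding n s_eq power_mult_distrib by (simp add: dvd_def) (metis (no_types, lifting) mult.commute mult.left_commute)
  then obtain d where d: "length d = k" "?s ^ ?n * (\<t> * w') = s_comb d"
    using Suc by auto
  let ?d = "d @ [(-1) ^ (Suc k + 1) * c]"
  have sq: "(-1) ^ (Suc k + 1) * ((-1) ^ (Suc k + 1) * c) = c"
    by (simp flip: mult.assoc power_add mult_2)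
  have "s_comb ?d = s_comb d + single 0 ((-1) ^ (Suc k + 1) * ((-1) ^ (Suc k + 1) * c)) * ?s ^ ?n"
  proof -
    let ?F = "\<lambda>d l. single 0 ((-1) ^ (l + 1) * d ! (l - 1)) * ?s ^ (CARD('p) - l)"
    have "(\<Sum>l=1..k. ?F ?d l) = (\<Sum>l=1..k. ?F d l)"
      using d(1) by (intro sum.cong refl) (auto simp: nth_append)
    moreover have "?d ! k = (-1) ^ (Suc k + 1) * c"
      using d(1) by (simp add: nth_append)
    ultimately show ?thesis using d(1) by (simp add: s_comb_def)
  qed
  also have "\<dots> = single 0 c * ?s ^ ?n + ?s ^ ?n * (\<t> * w')"
    unfolding sq d(2) by (rule add.commute)
  also have "\<dots> = m" unfolding m by (subst w') (simp only: c_def distrib_left ac_simps)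
  finally show ?case using d(1) by (intro exI[of _ ?d]) simp
qed

text \<open>
  The term \<open>g\<^sup>-\<^sup>i\<close> of the binomial expansion sits at \<open>g\<^sup>p\<^sup>-\<^sup>i\<close> for \<open>i > 0\<close> and at \<open>g\<^sup>0\<close> for
  \<open>i = 0\<close>. No two terms meet because \<open>n < p\<close>.
\<close>

lemma gcoeff_s_power:
  assumes "n < CARD('p)" "j < CARD('p)"
  shows "gcoeff ((1 - gp (CARD('p) - 1)) ^ n :: 'p::prime_card FG) j =
    (if j = 0 then 1 else (-1) ^ (CARD('p) - j) * of_nat (n choose (CARD('p) - j)))"
proof -
  let ?p = "CARD('p)"
  have inj: "gpow ((?p - 1) * i) = (gpow j :: 'p cyc) \<longleftrightarrow> i = (if j = 0 then 0 else ?p - j)" if "i \<le> n" for i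
  proof -
    have "gpow ((?p - 1) * i) = (gpow ((?p - i) mod ?p) :: 'p cyc)"
    proof -
      have "(?p - 1) * i + i = i * ?p" using zero_less_card_finite[where 'a = 'p]
        by (simp add: algebra_simps) 
      then have "((?p - 1) * i + i) mod ?p = ((?p - i) + i) mod ?p" using that assms by simp
      then have "((?p - 1) * i) mod ?p = (?p - i) mod ?p"
        by (metis add_right_cancel cong_add_rcancel_nat cong_def)
      then show ?thesis by (simp add: gpow_eq_iff)
    qed
    then have "gpow ((?p - 1) * i) = (gpow j :: 'p cyc) \<longleftrightarrow> (?p - i) mod ?p = j"
      using assms by (simp add: gpow_eq_iff)
    also have "\<dots> \<longleftrightarrow> i = (if j = 0 then 0 else ?p - j)"
      using that assms by (cases "i = 0") auto
    finally show ?thesis .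
  qed
  have "(1 - gp (?p - 1)) ^ n = (\<Sum>i\<le>n. of_nat (n choose i) * (- gp (?p - 1)) ^ i :: 'p FG)"
    using binomial_ring[of "- gp (?p - 1)" "1 :: 'p FG" n] by (simp add: add.commute)
  also have "\<dots> = (\<Sum>i\<le>n. single (gpow ((?p - 1) * i)) ((-1) ^ i * of_nat (n choose i)))"
  proof (rule sum.cong[OF refl])
    fix i
    have "(- gp (?p - 1)) ^ i = (single (gpow ((?p - 1) * i)) ((- 1) ^ i) :: 'p FG)"
      by (simp only: single_power flip: single_uminus)
    then show "of_nat (n choose i) * (- gp (?p - 1)) ^ i = (single (gpow ((?p - 1) * i)) ((-1) ^ i * of_nat (n choose i)) :: 'p FG)"
      by (simp add: mult_single mult.commute flip: single_of_nat)
  qed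
  finally have "gcoeff ((1 - gp (?p - 1)) ^ n :: 'p FG) j =
      (\<Sum>i\<le>n. if i = (if j = 0 then 0 else ?p - j) then (-1) ^ i * of_nat (n choose i) else 0)"
    by (simp only: lookup_sum) (rule sum.cong[OF refl], simp add: lookup_single when_def inj del: One_nat_def)
  then show ?thesis by (simp add: binomial_eq_0)
qed

section \<open>The quotient algebra and its filtration\<close>

lemma type_ring_simps [simp]:
  "carrier type_ring = UNIV" "x \<otimes>\<^bsub>type_ring\<^esub> y = x * y" "\<one>\<^bsub>type_ring\<^esub> = 1"
  "\<zero>\<^bsub>type_ring\<^esub> = 0" "x \<oplus>\<^bsub>type_ring\<^esub> y = x + y"
  by (simp_all add: type_ring_def)

lemma type_ring_a_inv [simp]: "\<ominus>\<^bsub>type_ring\<^esub> x = - (x :: 'a::ring_1)"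
proof -
  interpret ring "type_ring :: 'a ring" by (rule ring_type_ring)
  show ?thesis by (rule minus_equality) simp_all
qed

definition deg_lt :: "nat \<Rightarrow> 'p::prime_card free_alg set" where
  "deg_lt n = {a. \<forall>w\<in>keys a. vdeg w < n}"

lemma deg_lt_zero [simp]: "0 \<in> deg_lt n" by (simp add: deg_lt_def)

lemma deg_lt_add: "a \<in> deg_lt n \<Longrightarrow> b \<in> deg_lt n \<Longrightarrow> a + b \<in> deg_lt n"
  using Poly_Mapping.keys_add[of a b] by (auto simp: deg_lt_def)

lemma deg_lt_uminus: "a \<in> deg_lt n \<Longrightarrow> - a \<in> deg_lt n" for a :: "'p::prime_card free_alg"
  by (simp add: deg_lt_def in_keys_iff)

lemma vdeg_add [simp]: "vdeg (u + w) = vdeg u + vdeg w"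
  by (simp add: vdeg_def plus_word_def)

lemma vdeg_zero [simp]: "vdeg 0 = 0"
  by (simp add: vdeg_def zero_word_def)

lemma deg_lt_mult: "(a :: 'p::prime_card free_alg) \<in> deg_lt (Suc m) \<Longrightarrow> b \<in> deg_lt n \<Longrightarrow> a * b \<in> deg_lt (m + n)"
  and deg_lt_mult': "b \<in> deg_lt n \<Longrightarrow> a \<in> deg_lt (Suc m) \<Longrightarrow> b * a \<in> deg_lt (n + m)"
  using keys_mult[of a b] keys_mult[of b a] by (fastforce simp: deg_lt_def less_Suc_eq_le)+

lemma deg_lt_mono: "m \<le> n \<Longrightarrow> deg_lt m \<subseteq> deg_lt n"
  by (fastforce simp: deg_lt_def)

locale lam_kap =
  fixes L :: "'p::prime_card lam" and \<kappa> :: "'p kap"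
begin

abbreviation "I \<equiv> rel_ideal L \<kappa>"

lemma ideal_I: "ideal I type_ring"
  unfolding rel_ideal_def by (rule ring.genideal_ideal[OF ring_type_ring]) simp

lemma relations_in_I: "relations L \<kappa> \<subseteq> I"
  unfolding rel_ideal_def by (rule ring.genideal_self[OF ring_type_ring]) simp

text \<open>
  Applied to the annihilator of a module, this shows that the quotient algebra acts on the module.
\<close>

lemma I_subset:
  assumes "relations L \<kappa> \<subseteq> K" "0 \<in> K" "\<And>a b. a \<in> K \<Longrightarrow> b \<in> K \<Longrightarrow> a - b \<in> K"
    and "\<And>a x. a \<in> K \<Longrightarrow> x * a \<in> K" "\<And>a x. a \<in> K \<Longrightarrow> a * x \<in> K"
  shows "I \<subseteq> K"
  unfolding rel_ideal_def
proof (rule ring.genideal_minimal[OF ring_type_ring _ assms(1)])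
  have uminus: "- a \<in> K" if "a \<in> K" for a using assms(3)[OF assms(2) that] by simp
  have "a + b \<in> K" if "a \<in> K" "b \<in> K" for a b using assms(3)[OF that(1) uminus[OF that(2)]] by simp
  then show "ideal K type_ring"
    using assms uminus
    by (intro idealI ring_type_ring) (auto intro!: subgroup.intro simp: type_ring_a_inv[unfolded a_inv_def, simplified])
qed

lemma I_zero [simp]: "0 \<in> I"
  using additive_subgroup.zero_closed[OF ideal.axioms(1)[OF ideal_I]] by simp

lemma I_add: "a \<in> I \<Longrightarrow> b \<in> I \<Longrightarrow> a + b \<in> I"
  using additive_subgroup.a_closed[OF ideal.axioms(1)[OF ideal_I]] by simp

lemma I_uminus: "a \<in> I \<Longrightarrow> - a \<in> I"
  using additive_subgroup.a_inv_closed[OF ideal.axioms(1)[OF ideal_I]] by simp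

lemma I_diff: "a \<in> I \<Longrightarrow> b \<in> I \<Longrightarrow> a - b \<in> I"
  using I_add[OF _ I_uminus] by simp

lemma I_mult_left: "a \<in> I \<Longrightarrow> x * a \<in> I"
  using ideal.I_l_closed[OF ideal_I] by simp

lemma I_mult_right: "a \<in> I \<Longrightarrow> a * x \<in> I"
  using ideal.I_r_closed[OF ideal_I] by simp

definition cls :: "'p free_alg \<Rightarrow> 'p free_alg set" where
  "cls a = I +>\<^bsub>type_ring\<^esub> a"

lemma cls_eq: "cls a = {i + a | i. i \<in> I}"
  by (auto simp: cls_def a_r_coset_def')

lemma cls_eq_iff: "cls a = cls b \<longleftrightarrow> a - b \<in> I"
proof
  assume "cls a = cls b"
  moreover have "a \<in> cls a" unfolding cls_eq using I_zero by force
  ultimately show "a - b \<in> I" by (auto simp: cls_eq)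
next
  assume ab: "a - b \<in> I"
  have "x \<in> cls b" if "x \<in> cls a" "a - b \<in> I" for x a b
  proof -
    from that(1) obtain i where "i \<in> I" "x = (i + (a - b)) + b" by (auto simp: cls_eq)
    then show ?thesis using I_add[OF _ that(2)] unfolding cls_eq by blast
  qed
  from this[of _ a b] this[of _ b a] show "cls a = cls b"
    using ab I_uminus[OF ab] by auto
qed

abbreviation "H \<equiv> H_alg L \<kappa>"

lemma H_simps:
  "carrier H = range cls" "cls a \<otimes>\<^bsub>H\<^esub> cls b = cls (a * b)" "cls a \<oplus>\<^bsub>H\<^esub> cls b = cls (a + b)"
  "\<one>\<^bsub>H\<^esub> = cls 1" "\<zero>\<^bsub>H\<^esub> = cls 0"
proof -
  interpret ideal I "type_ring :: 'p free_alg ring" by (rule ideal_I)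
  show "carrier H = range cls" by (auto simp: H_alg_def FactRing_def A_RCOSETS_def' cls_def a_r_coset_def')
  show "cls a \<otimes>\<^bsub>H\<^esub> cls b = cls (a * b)"
    using rcoset_mult_add[of a b] by (simp add: H_alg_def FactRing_def cls_def)
  show "cls a \<oplus>\<^bsub>H\<^esub> cls b = cls (a + b)"
    using a_rcos_sum[of a b] by (simp add: H_alg_def FactRing_def cls_def)
  show "\<one>\<^bsub>H\<^esub> = cls 1" by (simp add: H_alg_def FactRing_def cls_def)
  show "\<zero>\<^bsub>H\<^esub> = cls 0" by (simp add: H_alg_def FactRing_def cls_eq)
qed

lemma ring_H: "ring H"
  unfolding H_alg_def by (rule ideal.quotient_is_ring[OF ideal_I])

lemma finsum_cls: "finite S \<Longrightarrow> (\<Oplus>\<^bsub>H\<^esub>i\<in>S. cls (f i)) = cls (\<Sum>i\<in>S. f i)"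
proof (induction S rule: finite_induct)
  interpret ring H by (rule ring_H)
  case empty
  then show ?case by (simp add: H_simps)
next
  interpret ring H by (rule ring_H)
  case (insert x S)
  then show ?case by (subst finsum_insert) (auto simp: H_simps)
qed

abbreviation "F \<equiv> H_filt L \<kappa>"

lemma F_eq: "F n = cls ` deg_lt (Suc n)"
  by (auto simp: H_filt_def deg_lt_def cls_def less_Suc_eq_le)

lemma filt_below_eq: "filt_below H F n = cls ` deg_lt n"
proof (cases n)
  case 0
  have "deg_lt 0 = {0 :: 'p free_alg}" by (auto simp: deg_lt_def)
  with 0 show ?thesis by (simp add: filt_below_def H_simps)
next
  case (Suc m)
  then show ?thesis by (simp add: filt_below_def F_eq)
qed

text \<open>
  Two elements of the free algebra of degree at most \<open>n\<close> have the same class in the \<open>n\<close>-th graded piece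
  of the quotient if and only if their difference lies in \<open>low n\<close>.
\<close>

definition low :: "nat \<Rightarrow> 'p free_alg set" where
  "low n = {e + i | e i. e \<in> deg_lt n \<and> i \<in> I}"

lemma coset_eq: "filt_below H F n +>\<^bsub>H\<^esub> cls a = {cls b | b. b - a \<in> low n}"
proof -
  have "filt_below H F n +>\<^bsub>H\<^esub> cls a = {cls (e + a) | e. e \<in> deg_lt n}"
    by (auto simp: a_r_coset_def' filt_below_eq H_simps)
  also have "\<dots> = {cls b | b. b - a \<in> low n}"
  proof (intro equalityI subsetI)
    fix x assume "x \<in> {cls (e + a) | e. e \<in> deg_lt n}"
    then obtain e where e: "x = cls (e + a)" "e \<in> deg_lt n" by auto
    then have "(e + a) - a \<in> low n" unfolding low_def using I_zero by force
    with e show "x \<in> {cls b | b. b - a \<in> low n}" by blast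
  next
    fix x assume "x \<in> {cls b | b. b - a \<in> low n}"
    then obtain b e i where b: "x = cls b" "b - a = e + i" "e \<in> deg_lt n" "i \<in> I" by (auto simp: low_def)
    have "b - (e + a) = i" using b(2) by (simp add: algebra_simps)
    then have "x = cls (e + a)" using b by (simp add: cls_eq_iff)
    with b show "x \<in> {cls (e + a) | e. e \<in> deg_lt n}" by blast
  qed
  finally show ?thesis .
qed

lemma low_zero [simp]: "0 \<in> low n"
  unfolding low_def by (rule CollectI, rule exI[of _ 0], rule exI[of _ 0]) simp

lemma low_add: "a \<in> low n \<Longrightarrow> b \<in> low n \<Longrightarrow> a + b \<in> low n"
proof -
  assume "a \<in> low n" "b \<in> low n"
  then obtain e i e' i' where "e \<in> deg_lt n" "i \<in> I" "a = e + i" "e' \<in> deg_lt n" "i' \<in> I" "b = e' + i'"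
    by (auto simp: low_def)
  moreover from this have "a + b = (e + e') + (i + i')" by simp
  ultimately show ?thesis unfolding low_def using deg_lt_add I_add by blast
qed

lemma low_uminus: "a \<in> low n \<Longrightarrow> - a \<in> low n"
  unfolding low_def by clarify (metis I_uminus deg_lt_uminus minus_add_distrib)

lemma low_diff: "a \<in> low n \<Longrightarrow> b \<in> low n \<Longrightarrow> a - b \<in> low n"
  using low_add[OF _ low_uminus] by simp

lemma low_sum: "(\<And>i. i \<in> S \<Longrightarrow> f i \<in> low n) \<Longrightarrow> sum f S \<in> low n"
  by (induction S rule: infinite_finite_induct) (auto intro: low_add)

lemma I_low: "a \<in> I \<Longrightarrow> a \<in> low n"
  unfolding low_def using deg_lt_zero by force

lemma deg_lt_low: "a \<in> deg_lt n \<Longrightarrow> a \<in> low n"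
  unfolding low_def using I_zero by force

lemma low_mult_left: "a \<in> deg_lt (Suc m) \<Longrightarrow> b \<in> low n \<Longrightarrow> a * b \<in> low (m + n)"
  unfolding low_def by clarify (metis I_mult_left deg_lt_mult distrib_left)

lemma low_mult_right: "b \<in> low n \<Longrightarrow> a \<in> deg_lt (Suc m) \<Longrightarrow> b * a \<in> low (n + m)"
  unfolding low_def by clarify (metis I_mult_right deg_lt_mult' distrib_right)

end

section \<open>The action on the symmetric algebra\<close>

definition X1 :: "'p::prime_card SV" where "X1 = single (single 1 1) 1"
definition X2 :: "'p::prime_card SV" where "X2 = single (single 2 1) 1"

lemma exp2_eqI: "lookup m 1 = lookup m' 1 \<Longrightarrow> lookup m 2 = lookup m' 2 \<Longrightarrow> m = (m' :: 2 \<Rightarrow>\<^sub>0 nat)"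
proof (rule poly_mapping_eqI)
  fix k :: 2 assume "lookup m 1 = lookup m' 1" "lookup m 2 = lookup m' 2"
  then show "lookup m k = lookup m' k" using exhaust_2[of k] by auto
qed

lemma SV_of_V_eq: "SV_of_V v = single 0 (v $ 1) * X1 + single 0 (v $ 2) * X2"
  by (simp add: SV_of_V_def UNIV_2 X1_def X2_def mult_single)

lemma X_power: "X1 ^ i = single (single 1 i) 1" "X2 ^ i = single (single 2 i) 1"
proof -
  have step: "single k 1 + single k i = single k (Suc i)" for k :: 2 and i
    by (metis plus_1_eq_Suc single_add)
  show "X1 ^ i = single (single 1 i) 1"
    by (induction i) (simp_all add: X1_def mult_single step del: One_nat_def)
  show "X2 ^ i = single (single 2 i) 1"
    by (induction i) (simp_all add: X2_def mult_single step del: One_nat_def)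
qed

lemma SV_monomial: "single m c = single 0 c * (X1 ^ lookup m 1 * X2 ^ lookup m 2)"
proof -
  have "m = single 1 (lookup m 1) + single 2 (lookup m 2)"
    by (rule exp2_eqI) (simp_all add: lookup_add lookup_single)
  then show ?thesis by (simp add: X_power mult_single)
qed

text \<open>
  The image of a monomial: \<open>h\<close> fixes the first variable and adds \<open>ix h\<close> times it to the second.
\<close>

definition act_mon :: "'p::prime_card cyc \<Rightarrow> (2 \<Rightarrow>\<^sub>0 nat) \<Rightarrow> 'p SV" where
  "act_mon h m = X1 ^ lookup m 1 * (single 0 (ix h) * X1 + X2) ^ lookup m 2"

lemma act_SV_eq: "act_SV h = lin_ext (\<lambda>m c. single 0 c * act_mon h m)"
proof -
  have "SV_of_V (act h v1) = X1" "SV_of_V (act h v2) = single 0 (ix h) * X1 + X2"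
    unfolding act_v1 act_v2 SV_of_V_eq by (simp_all add: axis_def)
  then have "(\<Prod>i\<in>UNIV. SV_of_V (act h (axis i 1)) ^ lookup m i) = act_mon h m" for m
    by (simp add: UNIV_2 act_mon_def)
  then show ?thesis by (simp add: fun_eq_iff act_SV_def lin_ext_def)
qed

lemma additive_act_SV: "additive (act_SV h)"
  unfolding act_SV_eq by (rule additive_lin_ext) (simp add: additive_def single_add distrib_right)

lemma act_SV_single: "act_SV h (single m c) = single 0 c * act_mon h m"
  by (simp add: act_SV_eq)

lemma act_SV_mult: "act_SV h (f * f') = act_SV h f * act_SV h f'"
proof (rule biadditive_eqI[of "\<lambda>f f'. act_SV h (f * f')" "\<lambda>f f'. act_SV h f * act_SV h f'"])
  fix m m' :: "2 \<Rightarrow>\<^sub>0 nat" and c c' :: "'a mod_ring"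
  have cc: "single 0 (c * c') = (single 0 c * single 0 c' :: 'a SV)" by (simp add: mult_single)
  have mm: "act_mon h (m + m') = act_mon h m * act_mon h m'"
    by (simp add: act_mon_def lookup_add power_add ac_simps)
  show "act_SV h (single m c * single m' c') = act_SV h (single m c) * act_SV h (single m' c')"
    by (simp only: mult_single[of m c m' c'] act_SV_single cc mm) (simp only: ac_simps)
qed (simp_all add: additive_def additive.add[OF additive_act_SV] distrib_left distrib_right)

lemma act_SV_simps:
  "act_SV h (single 0 c) = single 0 c" "act_SV h 1 = 1" "act_SV h X1 = X1"
  "act_SV h X2 = single 0 (ix h) * X1 + X2" "act_SV h 0 = 0"
  "act_SV h (f + f') = act_SV h f + act_SV h f'"
  using act_SV_single[of h 0 1]
  by (simp_all add: X1_def X2_def act_SV_single act_mon_def lookup_single additive.zero[OF additive_act_SV]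
      additive.add[OF additive_act_SV])

lemma act_SV_power: "act_SV h (f ^ n) = act_SV h f ^ n"
  by (induction n) (simp_all add: act_SV_simps act_SV_mult)

lemma act_SV_0: "act_SV 0 f = f"
proof (rule additive_eqI[OF additive_act_SV additive_ident])
  show "act_SV 0 (single m c) = single m c" for m :: "2 \<Rightarrow>\<^sub>0 nat" and c :: "'a mod_ring"
    unfolding SV_monomial[of m c] by (simp add: act_SV_mult act_SV_power act_SV_simps)
qed

lemma act_SV_add: "act_SV (h + h') f = act_SV h (act_SV h' f)"
proof (rule additive_eqI[OF additive_act_SV additive_compose[OF additive_act_SV additive_act_SV]])
  fix m :: "2 \<Rightarrow>\<^sub>0 nat" and c :: "'a mod_ring"
  have "single 0 (ix (h + h')) * X1 + X2 = act_SV h (single 0 (ix h') * X1 + X2)"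
    unfolding act_SV_simps act_SV_mult ix_add single_add distrib_right by (simp only: add_ac)
  then show "act_SV (h + h') (single m c) = act_SV h (act_SV h' (single m c))"
    by (simp only: act_SV_single[of _ m c] act_mon_def act_SV_mult act_SV_power act_SV_simps)
qed

definition mdeg :: "(2 \<Rightarrow>\<^sub>0 nat) \<Rightarrow> nat" where "mdeg m = lookup m 1 + lookup m 2"

lemma mdeg_add [simp]: "mdeg (m + m') = mdeg m + mdeg m'"
  by (simp add: mdeg_def lookup_add)

lemma mdeg_eq: "(\<Sum>i\<in>UNIV. lookup m i) = mdeg m"
  by (simp add: UNIV_2 mdeg_def)

definition homog :: "nat \<Rightarrow> 'p::prime_card SV set" where
  "homog n = {f. \<forall>m\<in>keys f. mdeg m = n}"

lemma homog_add: "f \<in> homog n \<Longrightarrow> f' \<in> homog n \<Longrightarrow> f + f' \<in> homog n"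
  using Poly_Mapping.keys_add[of f f'] by (auto simp: homog_def)

lemma homog_0 [simp]: "0 \<in> homog n" by (simp add: homog_def)

lemma homog_mult: "f \<in> homog n \<Longrightarrow> f' \<in> homog n' \<Longrightarrow> f * f' \<in> homog (n + n')"
  using keys_mult[of f f'] by (fastforce simp: homog_def)

lemma homog_power: "f \<in> homog n \<Longrightarrow> f ^ k \<in> homog (k * n)"
proof (induction k)
  case 0
  then show ?case by (simp add: homog_def mdeg_def)
next
  case (Suc k)
  from homog_mult[OF Suc.prems Suc.IH[OF Suc.prems]] show ?case by simp
qed

lemma homog_const: "single 0 c \<in> homog 0" and homog_X1: "X1 \<in> homog 1" and homog_X2: "X2 \<in> homog 1"
  by (auto simp: homog_def X1_def X2_def mdeg_def lookup_single)

lemma homog_act_SV: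
  assumes "f \<in> homog n" shows "act_SV h f \<in> homog n"
proof -
  have "single 0 c * act_mon h m \<in> homog (mdeg m)" for c m
  proof -
    have "single 0 (ix h) * X1 + X2 \<in> homog 1"
      using homog_mult[OF homog_const homog_X1] homog_X2 by (intro homog_add) simp_all
    from homog_mult[OF homog_const homog_mult[OF homog_power[OF homog_X1] homog_power[OF this]]]
    show ?thesis by (simp add: act_mon_def mdeg_def)
  qed
  then have *: "single 0 c * act_mon h m \<in> homog n" if "m \<in> keys f" for c m
    using that assms by (simp add: homog_def)
  have sum: "(\<And>m. m \<in> S \<Longrightarrow> g m \<in> homog n) \<Longrightarrow> sum g S \<in> homog n" for g :: "_ \<Rightarrow> 'a SV" and S
    by (induction S rule: infinite_finite_induct) (auto intro: homog_add)
  show ?thesis unfolding act_SV_eq lin_ext_def by (rule sum) (rule *)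
qed

section \<open>The skew group algebra\<close>

type_synonym 'p SVG = "'p cyc \<Rightarrow>\<^sub>0 'p SV"

definition skew :: "'p::prime_card SVG \<Rightarrow> 'p SVG \<Rightarrow> 'p SVG" where
  "skew x y = lin_ext (\<lambda>h s. lin_ext (\<lambda>h' s'. single (h + h') (s * act_SV h s')) y) x"

lemma skew_group_ring_simps:
  "carrier (skew_group_ring (act_SV :: 'p cyc \<Rightarrow> 'p::prime_card SV \<Rightarrow> 'p SV)) = UNIV"
  "x \<otimes>\<^bsub>skew_group_ring (act_SV :: 'p cyc \<Rightarrow> 'p SV \<Rightarrow> 'p SV)\<^esub> y = skew x y"
  "\<one>\<^bsub>skew_group_ring (act_SV :: 'p cyc \<Rightarrow> 'p SV \<Rightarrow> 'p SV)\<^esub> = single 0 1"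
  "x \<oplus>\<^bsub>skew_group_ring (act_SV :: 'p cyc \<Rightarrow> 'p SV \<Rightarrow> 'p SV)\<^esub> y = x + y"
  by (simp_all add: skew_group_ring_def skew_def lin_ext_def)

lemma additive_skew_left: "additive (\<lambda>x. skew x y)"
  unfolding skew_def
proof (rule additive_lin_ext, rule additive.intro)
  fix h and s s' :: "'a SV"
  show "lin_ext (\<lambda>h' t. single (h + h') ((s + s') * act_SV h t)) y =
    lin_ext (\<lambda>h' t. single (h + h') (s * act_SV h t)) y + lin_ext (\<lambda>h' t. single (h + h') (s' * act_SV h t)) y"
    by (simp add: lin_ext_def distrib_right single_add sum.distrib)
qed

lemma additive_skew_right: "additive (skew x)"
proof -
  have "additive (lin_ext (\<lambda>h' s'. single (h + h') (s * act_SV h s')))" for h :: "'a cyc" and s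
    by (rule additive_lin_ext) (simp add: additive_def single_add distrib_left act_SV_simps)
  moreover have "lin_ext (\<lambda>h s. A h s + B h s) x = lin_ext A x + lin_ext B x" for A B :: "'a cyc \<Rightarrow> 'a SV \<Rightarrow> 'a SVG"
    by (simp add: lin_ext_def sum.distrib)
  ultimately show ?thesis
    unfolding additive_def skew_def by simp
qed

lemma skew_single: "skew (single h s) (single h' s') = single (h + h') (s * act_SV h s')"
  by (simp add: skew_def lin_ext_def[of _ 0] act_SV_simps)

definition hpart :: "nat \<Rightarrow> 'p::prime_card SVG \<Rightarrow> 'p SVG" where
  "hpart n = lin_ext (\<lambda>h s. single h (restr (\<lambda>m. mdeg m = n) s))"

lemma additive_hpart: "additive (hpart n)"
  unfolding hpart_def
  by (rule additive_lin_ext) (simp add: additive_def additive.add[OF additive_restr] single_add)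

lemma hpart_single: "hpart n (single h s) = single h (restr (\<lambda>m. mdeg m = n) s)"
  by (simp add: hpart_def additive.zero[OF additive_restr])

lemma lookup_hpart: "lookup (hpart n x) h = restr (\<lambda>m. mdeg m = n) (lookup x h)"
  by (rule additive_eqI[of "\<lambda>x. lookup (hpart n x) h" "\<lambda>x. restr (\<lambda>m. mdeg m = n) (lookup x h)"])
    (simp_all add: additive_def additive.add[OF additive_hpart] additive.add[OF additive_restr] lookup_add
      hpart_single lookup_single when_def additive.zero[OF additive_restr])

lemma SVG_part_iff: "x \<in> SVG_part n \<longleftrightarrow> (\<forall>h. lookup x h \<in> homog n)"
  by (simp add: SVG_part_def homog_def mdeg_eq)

lemma SVG_eqI: "(\<And>n. hpart n x = hpart n y) \<Longrightarrow> x = y"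
proof (rule poly_mapping_eqI, rule poly_mapping_eqI)
  fix h m assume "\<And>n. hpart n x = hpart n y"
  then have "lookup (lookup (hpart (mdeg m) x) h) m = lookup (lookup (hpart (mdeg m) y) h) m" by simp
  then show "lookup (lookup x h) m = lookup (lookup y h) m" by (simp add: lookup_hpart lookup_restr)
qed

lemma hpart_in_SVG_part: "hpart n x \<in> SVG_part n"
  by (auto simp: SVG_part_iff homog_def lookup_hpart lookup_restr in_keys_iff split: if_splits)

lemma SVG_part_hpart:
  assumes "x \<in> SVG_part n" shows "hpart m x = (if m = n then x else 0)"
proof (rule poly_mapping_eqI, rule poly_mapping_eqI)
  fix h k
  have "mdeg k = n" if "lookup (lookup x h) k \<noteq> 0"
    using assms that by (auto simp: SVG_part_iff homog_def in_keys_iff)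
  then show "lookup (lookup (hpart m x) h) k = lookup (lookup (if m = n then x else 0) h) k"
    by (auto simp: lookup_hpart lookup_restr)
qed

lemma hpart_eq_imp_SVG_part: "(\<And>m. m \<noteq> n \<Longrightarrow> hpart m x = 0) \<Longrightarrow> x \<in> SVG_part n"
proof -
  assume *: "\<And>m. m \<noteq> n \<Longrightarrow> hpart m x = 0"
  have "lookup (lookup x h) m = 0" if "mdeg m \<noteq> n" for h m
  proof -
    have "lookup (lookup (hpart (mdeg m) x) h) m = 0" using *[OF that] by simp
    then show ?thesis by (simp add: lookup_hpart lookup_restr)
  qed
  then show ?thesis by (auto simp: SVG_part_iff homog_def in_keys_iff)
qed

lemma SVG_part_add: "x \<in> SVG_part n \<Longrightarrow> y \<in> SVG_part n \<Longrightarrow> x + y \<in> SVG_part n"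
  by (simp add: SVG_part_iff lookup_add homog_add)

lemma SVG_part_0 [simp]: "0 \<in> SVG_part n"
  by (simp add: SVG_part_iff)

lemma SVG_part_sum: "(\<And>i. i \<in> S \<Longrightarrow> f i \<in> SVG_part n) \<Longrightarrow> sum f S \<in> SVG_part n"
  by (induction S rule: infinite_finite_induct) (auto intro: SVG_part_add)

lemma SVG_part_single: "s \<in> homog n \<Longrightarrow> single h s \<in> SVG_part n"
  by (simp add: SVG_part_iff lookup_single when_def)

lemma skew_SVG_part: 
  assumes "x \<in> SVG_part n" "y \<in> SVG_part m" shows "skew x y \<in> SVG_part (n + m)"
  unfolding skew_def lin_ext_def
  using assms by (intro SVG_part_sum SVG_part_single homog_mult homog_act_SV) (auto simp: SVG_part_iff)

lemma SVG_bound: obtains N where "\<And>n. n \<ge> N \<Longrightarrow> hpart n x = 0"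
proof -
  let ?D = "mdeg ` (\<Union>h\<in>keys x. keys (lookup x h))"
  have fin: "finite ?D" by auto
  have "hpart n x = 0" if "n \<ge> Suc (Max ?D)" for n
  proof (rule poly_mapping_eqI, rule poly_mapping_eqI)
    fix h m
    have "mdeg m \<le> Max ?D" if "lookup (lookup x h) m \<noteq> 0"
    proof (rule Max_ge[OF fin])
      have "h \<in> keys x" "m \<in> keys (lookup x h)" using that by (auto simp: in_keys_iff)
      then show "mdeg m \<in> ?D" by blast
    qed
    with \<open>n \<ge> Suc (Max ?D)\<close> show "lookup (lookup (hpart n x) h) m = lookup (lookup 0 h) m"
      by (cases "lookup (lookup x h) m = 0") (auto simp: lookup_hpart lookup_restr)
  qed
  then show ?thesis by (rule that)
qed

lemma SVG_sum_hpart: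
  assumes "\<And>n. n \<ge> N \<Longrightarrow> hpart n x = 0" shows "x = (\<Sum>n<N. hpart n x)"
proof (rule SVG_eqI)
  fix m
  have "hpart m (\<Sum>n<N. hpart n x) = (\<Sum>n<N. if m = n then hpart n x else 0)"
    by (simp add: additive.sum[OF additive_hpart] SVG_part_hpart[OF hpart_in_SVG_part])
  also have "\<dots> = hpart m x" using assms[of m] by (simp add: not_less)
  finally show "hpart m x = hpart m (\<Sum>n<N. hpart n x)" by simp
qed

text \<open>
  The skew group algebra is graded, the group being in degree zero and acting by linear substitutions.
\<close>

lemma hpart_skew: "hpart n (skew x y) = (\<Sum>i\<le>n. skew (hpart i x) (hpart (n - i) y))"
proof -
  obtain N where N: "\<And>n. n \<ge> N \<Longrightarrow> hpart n x = 0" by (rule SVG_bound[of x]) blast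
  obtain M where M: "\<And>n. n \<ge> M \<Longrightarrow> hpart n y = 0" by (rule SVG_bound[of y]) blast
  define K where "K = N + M + Suc n"
  have "skew x y = (\<Sum>i<K. \<Sum>j<K. skew (hpart i x) (hpart j y))"
    apply (subst SVG_sum_hpart[of K x], use N in \<open>simp add: K_def\<close>)
    apply (subst SVG_sum_hpart[of K y], use M in \<open>simp add: K_def\<close>)
    by (simp only: additive.sum[OF additive_skew_left] additive.sum[OF additive_skew_right]) (rule sum.swap)
  then have "hpart n (skew x y) = (\<Sum>i<K. \<Sum>j<K. if n = i + j then skew (hpart i x) (hpart j y) else 0)"
    by (simp only: additive.sum[OF additive_hpart] SVG_part_hpart[OF skew_SVG_part[OF hpart_in_SVG_part hpart_in_SVG_part]])
  also have "\<dots> = (\<Sum>i<K. if i \<le> n then skew (hpart i x) (hpart (n - i) y) else 0)"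
  proof (rule sum.cong[OF refl])
    fix i
    have "(\<Sum>j<K. if n = i + j then skew (hpart i x) (hpart j y) else 0) =
       (\<Sum>j<K. if j = n - i then (if i \<le> n then skew (hpart i x) (hpart (n - i) y) else 0) else 0)"
      by (rule sum.cong) auto
    moreover have "n - i < K" by (simp add: K_def)
    ultimately show "(\<Sum>j<K. if n = i + j then skew (hpart i x) (hpart j y) else 0) =
       (if i \<le> n then skew (hpart i x) (hpart (n - i) y) else 0)" by simp
  qed
  also have "\<dots> = (\<Sum>i\<le>n. skew (hpart i x) (hpart (n - i) y))"
    by (rule sum.mono_neutral_cong_right) (auto simp: K_def)
  finally show ?thesis .
qed

section \<open>Symbols and normal forms\<close>

text \<open>
  In \<open>S(V) \<rtimes> G\<close> every word in the generators equals a polynomial times a group element. This computes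
  the two factors.
\<close>

fun symw :: "'p::prime_card cyc gen list \<Rightarrow> 'p SV \<times> 'p cyc" where
  "symw [] = (1, 0)"
| "symw (Vgen i # w) = (single (single i 1) 1 * fst (symw w), snd (symw w))"
| "symw (Ggen h # w) = (act_SV h (fst (symw w)), h + snd (symw w))"

lemma symw_append:
  "symw (u @ w) = (fst (symw u) * act_SV (snd (symw u)) (fst (symw w)), snd (symw u) + snd (symw w))"
  by (induction u rule: symw.induct)
    (simp_all add: act_SV_0 act_SV_mult act_SV_add add.assoc mult.assoc)

lemma symw_homog: "fst (symw (letters w)) \<in> homog (vdeg w)"
proof -
  have "fst (symw u) \<in> homog (vdeg (Word u))" for u :: "'a cyc gen list"
  proof (induction u)
    case Nil
    then show ?case by (simp add: vdeg_def homog_def mdeg_def)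
  next
    case (Cons l u)
    show ?case
    proof (cases l)
      case (Vgen i)
      have "single (single i 1) 1 \<in> homog 1"
        using exhaust_2[of i] by (auto simp: homog_def mdeg_def lookup_single)
      from homog_mult[OF this Cons] show ?thesis by (simp add: vdeg_def Vgen)
    next
      case (Ggen h)
      from homog_act_SV[OF Cons] show ?thesis by (simp add: vdeg_def Ggen)
    qed
  qed
  from this[of "letters w"] show ?thesis by simp
qed

text \<open>
  The homomorphism from the free algebra onto \<open>S(V) \<rtimes> G\<close>. On an element of degree at most \<open>n\<close> its
  degree \<open>n\<close> part depends only on the top terms and is the symbol of the class in \<open>H\<close>.
\<close>

definition symb :: "'p::prime_card free_alg \<Rightarrow> 'p SVG" where
  "symb = lin_ext (\<lambda>w c. single (snd (symw (letters w))) (single 0 c * fst (symw (letters w))))"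

lemma additive_symb: "additive symb"
  unfolding symb_def by (rule additive_lin_ext) (simp add: additive_def single_add distrib_right)

lemma symb_single: "symb (single w c) = single (snd (symw (letters w))) (single 0 c * fst (symw (letters w)))"
  by (simp add: symb_def)

lemma symb_mult: "symb (a * b) = skew (symb a) (symb b)"
proof (rule biadditive_eqI[of "\<lambda>a b. symb (a * b)" "\<lambda>a b. skew (symb a) (symb b)"])
  fix w w' :: "'a cyc gen word" and c c' :: "'a mod_ring"
  have "single 0 (c * c') = (single 0 c * single 0 c' :: 'a SV)" by (simp add: mult_single)
  then show "symb (single w c * single w' c') = skew (symb (single w c)) (symb (single w' c'))"
    by (simp add: mult_single[of w] symb_single plus_word_def symw_append skew_single act_SV_mult act_SV_simps mult_ac)
qed (simp_all add: additive_def additive.add[OF additive_symb] additive.add[OF additive_skew_left]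
    additive.add[OF additive_skew_right] distrib_left distrib_right)

text \<open>
  The group element stands on the right because reduction appends letters on the right, and \<open>v2\<close> stands
  before \<open>v1\<close> because the functionals used below are tabulated on \<open>v2\<^sup>n v1\<^sup>k\<close>.
\<close>

definition nf_word :: "(2 \<Rightarrow>\<^sub>0 nat) \<Rightarrow> 'g \<Rightarrow> 'g gen word" where
  "nf_word m h = Word (replicate (lookup m 2) (Vgen 2) @ replicate (lookup m 1) (Vgen 1) @ [Ggen h])"

definition nf :: "'p::prime_card SVG \<Rightarrow> 'p free_alg" where
  "nf = lin_ext (\<lambda>h. lin_ext (\<lambda>m. single (nf_word m h)))"

lemma additive_nf: "additive nf"
  unfolding nf_def by (intro additive_intros)

lemma nf_single: "nf (single h (single m c)) = single (nf_word m h) c"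
  by (simp add: nf_def lin_ext_def[of _ 0])

lemma SVG_part_induct [consumes 1, case_names single add]:
  assumes "x \<in> SVG_part n"
    and "\<And>h m c. mdeg m = n \<Longrightarrow> P (single h (single m c))"
    and "\<And>x y. P x \<Longrightarrow> P y \<Longrightarrow> P (x + y)"
  shows "P (x :: 'p::prime_card SVG)"
proof -
  have "P (single 0 (single (single 1 n) 0))" by (rule assms(2)) (simp add: mdeg_def lookup_single)
  then have P0: "P 0" by simp
  have sum: "P (sum f S)" if "\<And>i. i \<in> S \<Longrightarrow> P (f i)" for f :: "'i \<Rightarrow> 'p SVG" and S
    using that by (induction S rule: infinite_finite_induct) (auto intro: assms(3) P0)
  have "x = (\<Sum>h\<in>keys x. single h (\<Sum>m\<in>keys (lookup x h). single m (lookup (lookup x h) m)))"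
    by (simp only: sum_single_keys)
  also have "\<dots> = (\<Sum>h\<in>keys x. \<Sum>m\<in>keys (lookup x h). single h (single m (lookup (lookup x h) m)))"
    by (simp only: additive.sum[OF additive_single])
  also have "P \<dots>"
    using assms(1) by (intro sum assms(2)) (auto simp: SVG_part_iff homog_def)
  finally show ?thesis .
qed

lemma vdeg_nf_word: "vdeg (nf_word m h) = mdeg m"
  by (simp add: vdeg_def nf_word_def mdeg_def)

lemma deg_lt_single: "vdeg w < n \<Longrightarrow> single w c \<in> deg_lt n"
  by (simp add: deg_lt_def)

lemma nf_deg: "x \<in> SVG_part n \<Longrightarrow> nf x \<in> deg_lt (Suc n)"
  by (induction rule: SVG_part_induct)
    (simp_all add: nf_single deg_lt_single vdeg_nf_word deg_lt_add additive.add[OF additive_nf])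

abbreviation "A1 \<equiv> (single (Word [Vgen 1]) 1 :: 'p::prime_card free_alg)"
abbreviation "A2 \<equiv> (single (Word [Vgen 2]) 1 :: 'p::prime_card free_alg)"
abbreviation "cst c \<equiv> (single 0 c :: 'p::prime_card free_alg)"

lemma cst_commute: "cst c * a = a * cst c"
  by (rule additive_eqI[OF additive_mult_left additive_mult_right]) (simp add: mult_single mult.commute)

lemma A_power: "A1 ^ i = single (Word (replicate i (Vgen 1))) 1" "A2 ^ i = single (Word (replicate i (Vgen 2))) 1"
  by (induction i) (simp_all add: mult_single plus_word_def flip: single_one zero_word_def)

lemma nf_word_eq: "single (nf_word m h) c = A2 ^ lookup m 2 * A1 ^ lookup m 1 * in_G h * cst c"
  by (simp add: A_power in_G_def mult_single nf_word_def plus_word_def zero_word_def)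

lemma power_commutes_assoc: "a ^ n * (a * b) = a * (a ^ n * (b :: 'a::monoid_mult))"
  by (simp add: power_commutes flip: mult.assoc)

lemma in_V_eq: "in_V v = cst (v $ 1) * A1 + cst (v $ 2) * A2"
  by (simp add: in_V_def UNIV_2 mult_single)

lemma in_V_v: "in_V v1 = A1" "in_V v2 = A2"
  by (simp_all add: in_V_eq axis_def)

lemma A_deg: "A1 \<in> deg_lt (Suc 1)" "A2 \<in> deg_lt (Suc 1)" "in_G h \<in> deg_lt (Suc 0)" "cst c \<in> deg_lt (Suc 0)"
  by (simp_all add: deg_lt_def vdeg_def in_G_def zero_word_def)

lemma A_power_deg: "A1 ^ i \<in> deg_lt (Suc i)" "A2 ^ i \<in> deg_lt (Suc i)"
  by (simp_all add: A_power deg_lt_def vdeg_def)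

lemma deg_lt_sum: "(\<And>i. i \<in> S \<Longrightarrow> f i \<in> deg_lt n) \<Longrightarrow> sum f S \<in> deg_lt n" for f :: "_ \<Rightarrow> 'p::prime_card free_alg"
  by (induction S rule: infinite_finite_induct) (auto intro: deg_lt_add)

lemma in_FG_deg: "in_FG x \<in> deg_lt (Suc 0)"
  unfolding in_FG_def by (intro deg_lt_sum deg_lt_single) (simp add: vdeg_def)

lemma in_V_deg: "in_V v \<in> deg_lt (Suc 1)"
  unfolding in_V_def by (intro deg_lt_sum deg_lt_single) (simp add: vdeg_def)

lemma in_VFG_deg: "in_VFG x \<in> deg_lt (Suc 1)"
  unfolding in_VFG_def using deg_lt_mult'[OF in_V_deg A_deg(3)] by (intro deg_lt_sum) simp

context lam_kap
begin

lemma rel_G: "in_G h * in_G h' - in_G (h + h') \<in> I"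
  and rel_1: "in_G 0 - 1 \<in> I"
  and rel_L: "in_G h * in_V v - in_V (act h v) * in_G h - in_FG (L (single h 1) v) \<in> I"
  and rel_K: "in_V v * in_V w - in_V w * in_V v - (in_FG (fst (\<kappa> v w)) + in_VFG (snd (\<kappa> v w))) \<in> I"
  by (rule subsetD[OF relations_in_I], force simp: relations_def)+

lemma swap_G: "in_G h * A1 - A1 * in_G h \<in> low 1"
  "in_G h * A2 - (cst (ix h) * A1 + A2) * in_G h \<in> low 1"
proof -
  have *: "in_G h * in_V v - in_V (act h v) * in_G h \<in> low 1" for v
  proof -
    have "in_FG (L (single h 1) v) \<in> low 1"
      using deg_lt_low[OF in_FG_deg] by simp
    from low_add[OF I_low[OF rel_L[of h v]] this] show ?thesis by simp
  qed
  show "in_G h * A1 - A1 * in_G h \<in> low 1"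
    using *[of v1] by (simp add: in_V_v)
  show "in_G h * A2 - (cst (ix h) * A1 + A2) * in_G h \<in> low 1"
    using *[of v2] by (simp add: in_V_v act_v2) (simp add: in_V_eq axis_def)
qed

lemma swap_A: "A1 ^ i * A2 - A2 * A1 ^ i \<in> low (i + 1)"
proof (induction i)
  case 0
  then show ?case by simp
next
  case (Suc i)
  have "in_FG (fst (\<kappa> v1 v2)) \<in> deg_lt (Suc 1)"
    using in_FG_deg deg_lt_mono[of "Suc 0" "Suc 1"] by auto
  then have "in_FG (fst (\<kappa> v1 v2)) + in_VFG (snd (\<kappa> v1 v2)) \<in> low 2"
    using deg_lt_low[OF deg_lt_add[OF _ in_VFG_deg]] by (simp add: numeral_2_eq_2)
  from low_add[OF I_low[OF rel_K[of v1 v2]] this] have "A1 * A2 - A2 * A1 \<in> low 2"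
    by (simp add: in_V_v)
  from low_mult_right[OF this A_power_deg(1)[of i]] have 1: "(A1 * A2 - A2 * A1) * A1 ^ i \<in> low (Suc i + 1)" by simp
  from low_mult_left[OF A_deg(1) Suc] have 2: "A1 * (A1 ^ i * A2 - A2 * A1 ^ i) \<in> low (Suc i + 1)" by simp
  from low_add[OF 1 2] show ?case by (simp add: algebra_simps)
qed

text \<open>
  Modulo lower degree a letter moves to its place as it does in \<open>S(V) \<rtimes> G\<close>: group letters combine
  exactly, \<open>v1\<close> has to pass \<open>h\<close>, and \<open>v2\<close> has to pass \<open>h\<close> and then a power of \<open>v1\<close>.
\<close>

lemma nf_mult_letter:
  assumes "x \<in> SVG_part n"
  shows "nf x * single (Word [l]) 1 - nf (skew x (symb (single (Word [l]) 1))) \<in> low (n + vdeg (Word [l]))"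
  using assms
proof (induction rule: SVG_part_induct)
  case (add x y)
  from low_add[OF add] show ?case
    by (simp add: additive.add[OF additive_nf] additive.add[OF additive_skew_left] algebra_simps)
next
  case (single h m c)
  define j i where ji: "j = lookup m 2" "i = lookup m 1"
  define M where "M = A2 ^ j * (A1 ^ i :: 'p free_alg)"
  have n: "n = j + i" using single by (simp add: mdeg_def ji)
  have M: "M \<in> deg_lt (Suc n)" unfolding M_def n by (rule deg_lt_mult[OF A_power_deg(2), of _ "Suc _", simplified]) (rule A_power_deg)
  have nf1: "nf (single h (single m c)) = M * in_G h * cst c"
    by (simp add: nf_single nf_word_eq M_def ji)
  have X1: "single m c * X1 = single (m + single 1 1) c" and X2: "single m c * X2 = single (m + single 2 1) c"
    by (simp_all add: X1_def X2_def mult_single)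
  let ?x = "single h (single m c)"
  let ?l = "single (Word [l]) 1" and ?N = "nf (skew ?x (symb (single (Word [l]) 1)))"
  show ?case
  proof (cases l)
    case (Ggen h')
    have "?N = M * in_G (h + h') * cst c"
      using Ggen by (simp add: symb_single skew_single act_SV_simps nf_single nf_word_eq M_def ji)
    moreover have "M * in_G h * cst c * in_G h' = M * (in_G h * in_G h') * cst c"
      by (simp only: mult.assoc cst_commute)
    ultimately have "nf ?x * ?l - ?N
      = M * (in_G h * in_G h' - in_G (h + h')) * cst c"
      using Ggen by (simp add: nf1 algebra_simps flip: in_G_def)
    then show ?thesis
      using I_low[OF I_mult_right[OF I_mult_left[OF rel_G]]] by simp
  next
    case (Vgen k)
    have deg: "n + vdeg (Word [l]) = Suc n" using Vgen by (simp add: vdeg_def)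
    consider "k = 1" | "k = 2" using exhaust_2[of k] by auto
    then show ?thesis
    proof cases
      case 1
      have "?N = nf (single h (single m c * X1))"
        using Vgen 1 by (simp add: symb_single skew_single act_SV_simps flip: X1_def One_nat_def)
      also have "\<dots> = M * A1 * in_G h * cst c"
        by (simp add: X1 nf_single nf_word_eq M_def ji lookup_add lookup_single power_add mult.assoc
            power_commutes_assoc)
      finally have 2: "?N = M * A1 * in_G h * cst c" .
      have "M * in_G h * cst c * A1 = M * (in_G h * A1) * cst c"
        by (simp only: mult.assoc cst_commute)
      then have "nf ?x * ?l - ?N
        = M * (in_G h * A1 - A1 * in_G h) * cst c"
        unfolding 2 using Vgen 1 by (simp add: nf1 algebra_simps)
      then show ?thesis
        using low_mult_right[OF low_mult_left[OF M swap_G(1)] A_deg(4)] by (simp add: deg)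
    next
      case 2
      have "?N =
          nf (single h (single m c * (single 0 (ix h) * X1 + X2)))"
        using Vgen 2 by (simp add: symb_single skew_single act_SV_simps flip: X2_def One_nat_def)
      also have "single m c * (single 0 (ix h) * X1 + X2) = single (m + single 1 1) (ix h * c) + single (m + single 2 1) c"
        by (simp add: X1_def X2_def mult_single distrib_left mult.commute)
      also have "nf (single h \<dots>) = M * A1 * in_G h * cst (ix h * c) + A2 * M * in_G h * cst c"
        by (simp add: single_add additive.add[OF additive_nf] nf_single nf_word_eq M_def ji lookup_add lookup_single
           power_add mult.assoc power_commutes)
      also have "cst (ix h * c) = cst (ix h) * cst c" by (simp add: mult_single)
      also have "M * A1 * in_G h * (cst (ix h) * cst c) = M * (cst (ix h) * A1) * in_G h * cst c"
        by (simp only: mult.assoc cst_commute[of "ix h" "A1"]) (simp only: cst_commute[of "ix h" "in_G h"] flip: mult.assoc)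
      finally have 3: "?N =
        M * (cst (ix h) * A1) * in_G h * cst c + A2 * M * in_G h * cst c" .
      have "M * in_G h * cst c * A2 = M * (in_G h * A2) * cst c"
        by (simp only: mult.assoc cst_commute)
      then have "nf ?x * ?l - ?N
        = M * (in_G h * A2 - (cst (ix h) * A1 + A2) * in_G h) * cst c + A2 ^ j * (A1 ^ i * A2 - A2 * A1 ^ i) * in_G h * cst c"
        unfolding 3 using Vgen 2 by (simp add: nf1 M_def algebra_simps power_commutes)
          (simp add: power_commutes flip: mult.assoc)
      moreover have "M * (in_G h * A2 - (cst (ix h) * A1 + A2) * in_G h) * cst c \<in> low (Suc n)"
        using low_mult_right[OF low_mult_left[OF M swap_G(2)] A_deg(4)] by simp
      moreover have "A2 ^ j * (A1 ^ i * A2 - A2 * A1 ^ i) * in_G h * cst c \<in> low (Suc n)"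
        using low_mult_right[OF low_mult_right[OF low_mult_left[OF A_power_deg(2) swap_A] A_deg(3)] A_deg(4)]
        by (simp add: n)
      ultimately show ?thesis using low_add by (simp add: deg)
    qed
  qed
qed

lemma symb_in_SVG_part: "(\<And>w. w \<in> keys a \<Longrightarrow> vdeg w = n) \<Longrightarrow> symb a \<in> SVG_part n"
  unfolding symb_def lin_ext_def
  using homog_mult[OF homog_const symw_homog] by (intro SVG_part_sum SVG_part_single) fastforce

lemma reduce_word: "single w 1 - nf (symb (single w 1)) \<in> low (vdeg w)"
proof -
  have "single (Word u) 1 - nf (symb (single (Word u) 1)) \<in> low (vdeg (Word u))" for u :: "'p cyc gen list"
  proof (induction u rule: rev_induct)
    case Nil
    have "nf (single 0 1) = in_G 0"
      using nf_single[of 0 0 1] by (simp add: nf_word_def in_G_def)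
    then have eq: "single (Word []) 1 - nf (symb (single (Word []) 1)) = - (in_G 0 - 1)"
      by (simp add: symb_single) (simp flip: single_one zero_word_def)
    show ?case unfolding eq by (rule I_low[OF I_uminus[OF rel_1]])
  next
    case (snoc l u)
    let ?u = "single (Word u) 1 :: 'p free_alg" and ?l = "single (Word [l]) 1 :: 'p free_alg"
    have split: "single (Word (u @ [l])) 1 = ?u * ?l" by (simp add: mult_single plus_word_def)
    have deg: "vdeg (Word (u @ [l])) = vdeg (Word u) + vdeg (Word [l])" by (simp add: vdeg_def)
    have 1: "(?u - nf (symb ?u)) * ?l \<in> low (vdeg (Word u) + vdeg (Word [l]))"
      by (rule low_mult_right[OF snoc]) (simp add: deg_lt_single)
    have "symb ?u \<in> SVG_part (vdeg (Word u))" by (rule symb_in_SVG_part) simp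
    from low_add[OF 1 nf_mult_letter[OF this]] show ?case
      by (simp add: split deg symb_mult algebra_simps)
  qed
  from this[of "letters w"] show ?thesis by simp
qed

lemma reduce_homog:
  assumes "\<And>w. w \<in> keys a \<Longrightarrow> vdeg w = n"
  shows "a - nf (symb a) \<in> low n"
proof -
  have *: "single w c = single w 1 * cst c" for w and c :: "'p mod_ring" by (simp add: mult_single)
  have **: "nf (symb (single w c)) = nf (symb (single w 1)) * cst c" for w and c :: "'p mod_ring"
  proof -
    have "nf (skew x (single 0 (single 0 c))) = nf x * cst c" for x :: "'p SVG"
    proof (rule additive_eqI[OF additive_compose[OF additive_nf additive_skew_left] additive_compose[OF additive_mult_right additive_nf]])
      fix h and s :: "'p SV"
      show "nf (skew (single h s) (single 0 (single 0 c))) = nf (single h s) * cst c"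
        by (rule additive_eqI[of "\<lambda>s. nf (skew (single h s) (single 0 (single 0 c)))" "\<lambda>s. nf (single h s) * cst c"])
          (simp_all add: additive_def skew_single single_add additive.add[OF additive_nf] act_SV_simps distrib_right mult_single
            nf_single)
    qed
    then show ?thesis by (subst *) (simp add: symb_mult symb_single[of "Word []"] zero_word_def)
  qed
  have "a - nf (symb a) = (\<Sum>w\<in>keys a. single w (lookup a w)) - nf (symb (\<Sum>w\<in>keys a. single w (lookup a w)))"
    by (simp only: sum_single_keys)
  also have "\<dots> = (\<Sum>w\<in>keys a. (single w 1 - nf (symb (single w 1))) * cst (lookup a w))"
    by (simp add: additive.sum[OF additive_symb] additive.sum[OF additive_nf] sum_subtractf[symmetric] left_diff_distrib
      flip: ** ) (simp add: mult_single)
  also have "\<dots> \<in> low n"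
    using assms low_mult_right[OF reduce_word A_deg(4)] by (intro low_sum) force
  finally show ?thesis .
qed

definition fpart :: "nat \<Rightarrow> 'p free_alg \<Rightarrow> 'p free_alg" where
  "fpart n = restr (\<lambda>w. vdeg w = n)"

lemma fpart_symb: "symb (fpart n a) \<in> SVG_part n" 
  by (rule symb_in_SVG_part) (auto simp: fpart_def in_keys_iff lookup_restr split: if_splits)

text \<open>
  The top part is replaced by the normal form of its symbol. The error has smaller degree and is
  absorbed by the induction.
\<close>

lemma reduce_step:
  assumes a: "a \<in> deg_lt (Suc n)"
    and IH: "\<And>a. a \<in> deg_lt n \<Longrightarrow> \<exists>x. a - nf x \<in> I \<and> (\<forall>m\<ge>n. hpart m x = 0)"
  shows "\<exists>x. a - nf x \<in> I \<and> (\<forall>m>n. hpart m x = 0) \<and> hpart n x = symb (fpart n a)"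
proof -
  define a' where "a' = a - fpart n a"
  have "vdeg w < n" if "w \<in> keys a'" for w
  proof -
    have "w \<in> keys a" "vdeg w \<noteq> n"
      using that by (auto simp: a'_def fpart_def in_keys_iff lookup_minus lookup_restr split: if_splits)
    with a show ?thesis by (auto simp: deg_lt_def less_Suc_eq)
  qed
  then have "a' \<in> deg_lt n" by (simp add: deg_lt_def)
  have "fpart n a - nf (symb (fpart n a)) \<in> low n"
    by (rule reduce_homog) (auto simp: fpart_def in_keys_iff lookup_restr split: if_splits)
  then obtain e i where e: "fpart n a - nf (symb (fpart n a)) = e + i" "e \<in> deg_lt n" "i \<in> I"
    by (auto simp: low_def)
  obtain x where x: "a' + e - nf x \<in> I" "\<forall>m\<ge>n. hpart m x = 0"
    using IH[OF deg_lt_add[OF \<open>a' \<in> deg_lt n\<close> e(2)]] by blast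
  let ?y = "symb (fpart n a) + x"
  have "a - nf ?y = (a' + e - nf x) + (fpart n a - nf (symb (fpart n a)) - e)"
    by (simp add: additive.add[OF additive_nf] a'_def)
  also have "\<dots> \<in> I" using x(1) e by (intro I_add) simp_all
  finally show ?thesis
    using x(2) fpart_symb[of n a]
    by (intro exI[of _ ?y]) (auto simp: additive.add[OF additive_hpart] SVG_part_hpart)
qed

lemma reduce_lt: "a \<in> deg_lt n \<Longrightarrow> \<exists>x. a - nf x \<in> I \<and> (\<forall>m\<ge>n. hpart m x = 0)"
proof (induction n arbitrary: a)
  case 0
  then have "a = 0" by (auto simp: deg_lt_def)
  then show ?case
    by (intro exI[of _ 0]) (simp add: additive.zero[OF additive_nf] additive.zero[OF additive_hpart])
next
  case (Suc n)
  from reduce_step[OF Suc.prems Suc.IH] show ?case by (auto simp: Suc_le_eq)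
qed

lemmas reduce = reduce_step[OF _ reduce_lt]

end

section \<open>The PBW property as linear independence of normal forms\<close>

lemma nf_sum_deg: "(\<Sum>k<n. nf (hpart k x)) \<in> deg_lt n"
proof (rule deg_lt_sum)
  fix k assume "k \<in> {..<n}"
  then have "deg_lt (Suc k) \<subseteq> (deg_lt n :: 'a free_alg set)" by (intro deg_lt_mono) auto
  with nf_deg[OF hpart_in_SVG_part, of k x] show "nf (hpart k x) \<in> deg_lt n" by blast
qed

text \<open>
  Normal forms span \<open>H\<close> by reduction, so under this assumption they are a basis.
\<close>

locale nf_basis = lam_kap L \<kappa> for L :: "'p::prime_card lam" and \<kappa> :: "'p kap" +
  assumes indep: "nf x \<in> I \<Longrightarrow> x = 0"
begin

text \<open>
  The coordinates of the class of \<open>a\<close> in the basis of normal forms.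
\<close>

definition nu :: "'p free_alg \<Rightarrow> 'p SVG" where
  "nu a = (THE x. a - nf x \<in> I)"

lemma nu_eqI: "a - nf x \<in> I \<Longrightarrow> nu a = x"
  unfolding nu_def
proof (rule the_equality)
  fix y assume "a - nf x \<in> I" "a - nf y \<in> I"
  then have "(a - nf x) - (a - nf y) \<in> I" by (rule I_diff)
  then have "nf (y - x) \<in> I" by (simp add: additive.diff[OF additive_nf])
  from indep[OF this] show "y = x" by simp
qed

lemma deg_bound: "\<exists>n. (a :: 'p free_alg) \<in> deg_lt n"
proof -
  have "vdeg w < Suc (Max (vdeg ` keys a))" if "w \<in> keys a" for w
    using that by (simp add: less_Suc_eq_le)
  then show ?thesis unfolding deg_lt_def by blast
qed

lemma nu_I: "a - nf (nu a) \<in> I"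
proof -
  obtain n where "a \<in> deg_lt n" using deg_bound by blast
  then obtain x where x: "a - nf x \<in> I" using reduce_lt by blast
  with nu_eqI[OF x] show ?thesis by simp
qed

lemma additive_nu: "additive nu"
proof (rule additive.intro, rule nu_eqI)
  fix a b
  show "a + b - nf (nu a + nu b) \<in> I"
    using I_add[OF nu_I[of a] nu_I[of b]] by (simp add: additive.add[OF additive_nf] algebra_simps)
qed

lemma nu_nf: "nu (nf x) = x"
  by (rule nu_eqI) simp

lemma nu_0: "a \<in> I \<Longrightarrow> nu a = 0"
  by (rule nu_eqI) (simp add: additive.zero[OF additive_nf])

lemma nu_cong: "cls a = cls b \<Longrightarrow> nu a = nu b"
  using nu_0[of "a - b"] by (simp add: cls_eq_iff additive.diff[OF additive_nu])

lemma nu_deg: "a \<in> deg_lt n \<Longrightarrow> n \<le> m \<Longrightarrow> hpart m (nu a) = 0"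
  using reduce_lt[of a n] by (auto dest!: nu_eqI)

lemma nu_top: "a \<in> deg_lt (Suc n) \<Longrightarrow> hpart n (nu a) = symb (fpart n a)"
  using reduce[of a n] by (auto dest!: nu_eqI)

lemma nu_low: "a \<in> low n \<Longrightarrow> n \<le> m \<Longrightarrow> hpart m (nu a) = 0"
  by (auto simp: low_def additive.add[OF additive_nu] nu_0 nu_deg)

lemma nu_low_iff: "a \<in> low n \<longleftrightarrow> (\<forall>m\<ge>n. hpart m (nu a) = 0)"
proof
  assume *: "\<forall>m\<ge>n. hpart m (nu a) = 0"
  have "nf (nu a) = (\<Sum>k<n. nf (hpart k (nu a)))"
    using SVG_sum_hpart[of n "nu a"] * by (metis additive.sum[OF additive_nf])
  also have "\<dots> \<in> deg_lt n" by (rule nf_sum_deg)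
  finally have "nf (nu a) + (a - nf (nu a)) \<in> low n"
    using low_add[OF deg_lt_low I_low[OF nu_I]] by blast
  then show "a \<in> low n" by simp
qed (auto intro: nu_low)

text \<open>
  Leading parts multiply as in \<open>S(V) \<rtimes> G\<close>, since the remaining terms of the product have smaller degree.
\<close>

lemma nu_mult_top:
  assumes "a \<in> deg_lt (Suc i)" "b \<in> deg_lt (Suc j)"
  shows "hpart (i + j) (nu (a * b)) = skew (hpart i (nu a)) (hpart j (nu b))"
proof -
  have split: "a - fpart i a \<in> deg_lt i" "fpart i a \<in> deg_lt (Suc i)" if "a \<in> deg_lt (Suc i)" for i a
  proof -
    show "fpart i a \<in> deg_lt (Suc i)"
      by (auto simp: fpart_def in_keys_iff lookup_restr deg_lt_def split: if_splits)
    have "vdeg w < i" if w: "w \<in> keys (a - fpart i a)" for w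
    proof -
      have "w \<in> keys a" "vdeg w \<noteq> i"
        using w by (auto simp: fpart_def in_keys_iff lookup_minus lookup_restr split: if_splits)
      with that show ?thesis using \<open>a \<in> deg_lt (Suc i)\<close> by (auto simp: deg_lt_def less_Suc_eq)
    qed
    then show "a - fpart i a \<in> deg_lt i" by (simp add: deg_lt_def)
  qed
  let ?P = "fpart i a * fpart j b"
  have keys: "vdeg w = i + j" if w: "w \<in> keys ?P" for w
  proof -
    obtain u v where "w = u + v" "u \<in> keys (fpart i a)" "v \<in> keys (fpart j b)"
      using w keys_mult[of "fpart i a" "fpart j b"] by blast
    then show ?thesis by (auto simp: fpart_def in_keys_iff lookup_restr split: if_splits)
  qed
  have "?P \<in> deg_lt (Suc (i + j))" by (simp add: deg_lt_def keys)
  moreover have "fpart (i + j) ?P = ?P"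
  proof (rule poly_mapping_eqI)
    fix w
    show "lookup (fpart (i + j) ?P) w = lookup ?P w"
      using keys[of w] by (cases "w \<in> keys ?P") (simp_all add: fpart_def lookup_restr not_in_keys_iff_lookup_eq_zero)
  qed
  ultimately have P: "hpart (i + j) (nu ?P) = skew (symb (fpart i a)) (symb (fpart j b))"
    by (simp add: nu_top symb_mult)
  define R where "R = fpart i a * (b - fpart j b) + (a - fpart i a) * b"
  have "a * b = ?P + R"
    by (simp add: R_def algebra_simps)
  moreover have R: "R \<in> deg_lt (i + j)"
    unfolding R_def
    by (rule deg_lt_add[OF deg_lt_mult[OF split(2)[OF assms(1)] split(1)[OF assms(2)]]
        deg_lt_mult'[OF split(1)[OF assms(1)] assms(2)]])
  ultimately have "hpart (i + j) (nu (a * b)) = hpart (i + j) (nu ?P)"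
    by (simp add: additive.add[OF additive_hpart] additive.add[OF additive_nu] nu_deg[OF R])
  with P show ?thesis using assms by (simp add: nu_top)
qed

end

context lam_kap
begin

abbreviation "gr \<equiv> gr_ring H F"
abbreviation "below n \<equiv> filt_below H F n"

text \<open>
  Computations with the cosets of the associated graded ring are done on representatives in the free
  algebra.
\<close>

definition rep :: "(nat \<Rightarrow> 'p free_alg set set) \<Rightarrow> nat \<Rightarrow> 'p free_alg \<Rightarrow> bool" where
  "rep c n a \<longleftrightarrow> a \<in> deg_lt (Suc n) \<and> cls a \<in> c n"

lemma coset_mem: "cls a \<in> below n +>\<^bsub>H\<^esub> cls b \<longleftrightarrow> a - b \<in> low n"
proof
  assume "cls a \<in> below n +>\<^bsub>H\<^esub> cls b"
  then obtain d where d: "cls a = cls d" "d - b \<in> low n" by (auto simp: coset_eq)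
  then have "(a - d) + (d - b) \<in> low n" by (intro low_add[OF I_low]) (simp_all add: cls_eq_iff)
  then show "a - b \<in> low n" by simp
qed (auto simp: coset_eq)

lemma coset_eq_iff: "below n +>\<^bsub>H\<^esub> cls a = below n +>\<^bsub>H\<^esub> cls b \<longleftrightarrow> a - b \<in> low n"
proof
  assume "below n +>\<^bsub>H\<^esub> cls a = below n +>\<^bsub>H\<^esub> cls b"
  then show "a - b \<in> low n" using coset_mem[of a n a] by (simp add: coset_mem)
next
  assume ab: "a - b \<in> low n"
  have "d - a \<in> low n \<longleftrightarrow> d - b \<in> low n" for d
    using low_add[OF _ ab, of "d - a"] low_diff[OF _ ab, of "d - b"] by auto
  then show "below n +>\<^bsub>H\<^esub> cls a = below n +>\<^bsub>H\<^esub> cls b" by (simp add: coset_eq)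
qed

lemma coset_below: "a \<in> low n \<Longrightarrow> below n +>\<^bsub>H\<^esub> cls a = below n"
proof -
  assume "a \<in> low n"
  then have "below n +>\<^bsub>H\<^esub> cls a = below n +>\<^bsub>H\<^esub> cls 0" by (simp add: coset_eq_iff)
  also have "\<dots> = below n" by (auto simp: a_r_coset_def' filt_below_eq H_simps)
  finally show ?thesis .
qed

lemma gr_coset:
  assumes "c \<in> carrier gr"
  obtains a where "a \<in> deg_lt (Suc n)" "c n = below n +>\<^bsub>H\<^esub> cls a"
  using assms by (fastforce simp: gr_ring_def F_eq)

lemma gr_rep:
  assumes "c \<in> carrier gr"
  shows "rep c n a \<Longrightarrow> c n = below n +>\<^bsub>H\<^esub> cls a"
    and "\<exists>a. rep c n a"
    and "X \<in> c n \<Longrightarrow> \<exists>a. X = cls a \<and> rep c n a"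
    and "rep c n a \<Longrightarrow> rep c n b \<Longrightarrow> a - b \<in> low n"
proof -
  obtain d where d: "d \<in> deg_lt (Suc n)" "c n = below n +>\<^bsub>H\<^esub> cls d" by (rule gr_coset[OF assms])
  show 1: "c n = below n +>\<^bsub>H\<^esub> cls a" if "rep c n a" for a
  proof -
    have "a - d \<in> low n" using that by (simp add: rep_def d(2) coset_mem)
    then have "- (a - d) \<in> low n" by (rule low_uminus)
    then show ?thesis by (simp add: d(2) coset_eq_iff)
  qed
  show "\<exists>a. rep c n a" using d by (auto simp: rep_def coset_mem)
  show "a - b \<in> low n" if "rep c n a" "rep c n b"
    using trans[OF sym[OF 1[OF that(1)]] 1[OF that(2)]] by (simp only: coset_eq_iff)
  assume "X \<in> c n"
  then obtain b e i where b: "X = cls b" "b - d = e + i" "e \<in> deg_lt n" "i \<in> I"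
    by (auto simp: d(2) coset_eq low_def)
  have "b - (d + e) = i" using b(2) by (simp add: algebra_simps)
  then have X: "X = cls (d + e)" using b by (simp add: cls_eq_iff)
  have "d + e \<in> deg_lt (Suc n)" using d(1) b(3) deg_lt_mono[of n "Suc n"] by (intro deg_lt_add) auto
  with X \<open>X \<in> c n\<close> show "\<exists>a. X = cls a \<and> rep c n a" by (auto simp: rep_def)
qed

lemma gr_memI:
  assumes "\<And>n. a n \<in> deg_lt (Suc n)" "finite {n. a n \<notin> low n}"
  shows "(\<lambda>n. below n +>\<^bsub>H\<^esub> cls (a n)) \<in> carrier gr"
proof -
  have "{n. below n +>\<^bsub>H\<^esub> cls (a n) \<noteq> below n} \<subseteq> {n. a n \<notin> low n}"
    using coset_below by blast
  from finite_subset[OF this assms(2)] show ?thesis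
    using assms(1) by (auto simp: gr_ring_def F_eq)
qed

lemma gr_bound:
  assumes "c \<in> carrier gr" obtains N where "\<And>n. n \<ge> N \<Longrightarrow> c n = below n"
proof -
  have "finite {n. c n \<noteq> below n}" using assms by (simp add: gr_ring_def)
  then obtain N where "\<forall>n\<in>{n. c n \<noteq> below n}. n < N" by (meson finite_nat_set_iff_bounded)
  then show ?thesis by (intro that[of N]) force
qed

lemma gr_add_rep:
  assumes "c \<in> carrier gr" "d \<in> carrier gr"
  shows "rep c n a \<Longrightarrow> rep d n b \<Longrightarrow> rep (c \<oplus>\<^bsub>gr\<^esub> d) n (a + b)"
    and "rep (c \<oplus>\<^bsub>gr\<^esub> d) n e \<Longrightarrow> \<exists>a b. rep c n a \<and> rep d n b \<and> cls e = cls (a + b)"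
proof -
  have eq: "(c \<oplus>\<^bsub>gr\<^esub> d) n = {x \<oplus>\<^bsub>H\<^esub> y | x y. x \<in> c n \<and> y \<in> d n}"
    by (auto simp: gr_ring_def set_add_def')
  show "rep (c \<oplus>\<^bsub>gr\<^esub> d) n (a + b)" if "rep c n a" "rep d n b"
    using that unfolding rep_def eq by (auto intro: deg_lt_add simp flip: H_simps)
  assume "rep (c \<oplus>\<^bsub>gr\<^esub> d) n e"
  then obtain x y where xy: "cls e = x \<oplus>\<^bsub>H\<^esub> y" "x \<in> c n" "y \<in> d n" unfolding rep_def eq by auto
  obtain a b where ab: "x = cls a" "rep c n a" "y = cls b" "rep d n b"
    using gr_rep(3)[OF assms(1) xy(2)] gr_rep(3)[OF assms(2) xy(3)] by auto
  show "\<exists>a b. rep c n a \<and> rep d n b \<and> cls e = cls (a + b)"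
    using ab xy(1) by (intro exI[of _ a] exI[of _ b]) (simp add: H_simps)
qed

lemma gr_mult_rep:
  assumes "c \<in> carrier gr" "d \<in> carrier gr"
  shows "\<exists>e. rep (c \<otimes>\<^bsub>gr\<^esub> d) n e"
    and "rep (c \<otimes>\<^bsub>gr\<^esub> d) n e \<Longrightarrow> \<exists>a b z. (\<forall>i\<le>n. rep c i (a i) \<and> rep d i (b i)) \<and> z \<in> deg_lt n \<and>
           cls e = cls ((\<Sum>i\<le>n. a i * b (n - i)) + z)"
proof -
  have eq: "(c \<otimes>\<^bsub>gr\<^esub> d) n = {(\<Oplus>\<^bsub>H\<^esub>i\<in>{..n}. x i \<otimes>\<^bsub>H\<^esub> y (n - i)) \<oplus>\<^bsub>H\<^esub> z | x y z.
                        (\<forall>i\<le>n. x i \<in> c i \<and> y i \<in> d i) \<and> z \<in> below n}"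
    by (simp add: gr_ring_def)
  have fs: "(\<Oplus>\<^bsub>H\<^esub>i\<in>{..n}. x i \<otimes>\<^bsub>H\<^esub> y (n - i)) = cls (\<Sum>i\<le>n. a i * b (n - i))"
    if "\<forall>i\<le>n. x i = cls (a i) \<and> y i = cls (b i)" for x y a b
  proof -
    have "(\<Oplus>\<^bsub>H\<^esub>i\<in>{..n}. x i \<otimes>\<^bsub>H\<^esub> y (n - i)) = (\<Oplus>\<^bsub>H\<^esub>i\<in>{..n}. cls (a i * b (n - i)))"
      using that by (intro abelian_monoid.finsum_cong' abelian_group.axioms ring.axioms ring_H) (auto simp: H_simps)
    then show ?thesis by (simp add: finsum_cls)
  qed
  obtain a where a: "\<And>i. rep c i (a i)" using gr_rep(2)[OF assms(1)] by metis
  obtain b where b: "\<And>i. rep d i (b i)" using gr_rep(2)[OF assms(2)] by metis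
  let ?e = "\<Sum>i\<le>n. a i * b (n - i)"
  have "a i * b (n - i) \<in> deg_lt (Suc n)" if "i \<le> n" for i
    using deg_lt_mult[of "a i" i "b (n - i)" "Suc (n - i)"] a[of i] b[of "n - i"] that by (simp add: rep_def)
  then have "?e \<in> deg_lt (Suc n)" by (intro deg_lt_sum) simp
  moreover have "cls ?e = (\<Oplus>\<^bsub>H\<^esub>i\<in>{..n}. cls (a i) \<otimes>\<^bsub>H\<^esub> cls (b (n - i))) \<oplus>\<^bsub>H\<^esub> cls 0"
    by (subst fs[of "\<lambda>i. cls (a i)" a "\<lambda>i. cls (b i)" b]) (simp_all add: H_simps)
  moreover have "cls 0 \<in> below n" by (simp add: filt_below_eq)
  ultimately have "cls ?e \<in> (c \<otimes>\<^bsub>gr\<^esub> d) n"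
    using a b unfolding eq
    by (intro CollectI exI[of _ "\<lambda>i. cls (a i)"] exI[of _ "\<lambda>i. cls (b i)"] exI[of _ "cls 0"]) (simp add: rep_def)
  with \<open>?e \<in> deg_lt (Suc n)\<close> show "\<exists>e. rep (c \<otimes>\<^bsub>gr\<^esub> d) n e" by (auto simp: rep_def)
  assume "rep (c \<otimes>\<^bsub>gr\<^esub> d) n e"
  then obtain x y z where xyz: "cls e = (\<Oplus>\<^bsub>H\<^esub>i\<in>{..n}. x i \<otimes>\<^bsub>H\<^esub> y (n - i)) \<oplus>\<^bsub>H\<^esub> z"
    "\<And>i. i \<le> n \<Longrightarrow> x i \<in> c i" "\<And>i. i \<le> n \<Longrightarrow> y i \<in> d i" "z \<in> below n" unfolding rep_def eq by auto
  obtain a where a: "\<And>i. i \<le> n \<Longrightarrow> x i = cls (a i) \<and> rep c i (a i)"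
    using gr_rep(3)[OF assms(1) xyz(2)] by metis
  obtain b where b: "\<And>i. i \<le> n \<Longrightarrow> y i = cls (b i) \<and> rep d i (b i)"
    using gr_rep(3)[OF assms(2) xyz(3)] by metis
  obtain z' where z': "z = cls z'" "z' \<in> deg_lt n" using xyz(4) by (auto simp: filt_below_eq)
  have "cls e = cls ((\<Sum>i\<le>n. a i * b (n - i)) + z')"
    unfolding xyz(1) z'(1) using a b by (subst fs[of x a y b]) (simp_all add: H_simps)
  then show "\<exists>a b z. (\<forall>i\<le>n. rep c i (a i) \<and> rep d i (b i)) \<and> z \<in> deg_lt n \<and>
           cls e = cls ((\<Sum>i\<le>n. a i * b (n - i)) + z)"
    using a b z'(2) by (intro exI[of _ a] exI[of _ b] exI[of _ z']) simp
qed

lemma gr_one_rep: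
  "rep \<one>\<^bsub>gr\<^esub> 0 1" "rep \<one>\<^bsub>gr\<^esub> n a \<Longrightarrow> n = 0 \<Longrightarrow> cls a = cls 1" "n > 0 \<Longrightarrow> rep \<one>\<^bsub>gr\<^esub> n a \<Longrightarrow> a \<in> low n"
  "n > 0 \<Longrightarrow> rep \<one>\<^bsub>gr\<^esub> n 0"
proof -
  have low0: "low 0 = I" by (auto simp: low_def deg_lt_def)
  have one: "\<one>\<^bsub>gr\<^esub> n = (if n = 0 then below 0 +>\<^bsub>H\<^esub> cls 1 else below n +>\<^bsub>H\<^esub> cls 0)" for n
    by (simp add: gr_ring_def H_simps coset_below)
  have "(1 :: 'p free_alg) \<in> deg_lt (Suc 0)" using A_deg(4)[of 1] by simp
  then show "rep \<one>\<^bsub>gr\<^esub> 0 1" by (simp add: rep_def one coset_mem)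
  show "cls a = cls 1" if "rep \<one>\<^bsub>gr\<^esub> n a" "n = 0"
    using that by (simp add: rep_def one coset_mem cls_eq_iff low0)
  show "a \<in> low n" if "n > 0" "rep \<one>\<^bsub>gr\<^esub> n a"
    using that by (simp add: rep_def one coset_mem)
  show "rep \<one>\<^bsub>gr\<^esub> n 0" if "n > 0"
    using that by (simp add: rep_def one coset_mem)
qed

end

context nf_basis
begin

abbreviation "SG \<equiv> skew_group_ring (act_SV :: 'p cyc \<Rightarrow> 'p SV \<Rightarrow> 'p SV)"

text \<open>
  The isomorphism sends a sequence of cosets to the sum of the leading parts of its members. It is
  characterised by its homogeneous parts, each of which may be read off from any representative, so
  that no choice of representatives enters.
\<close>

definition is_symbol :: "(nat \<Rightarrow> 'p free_alg set set) \<Rightarrow> 'p SVG \<Rightarrow> bool" where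
  "is_symbol c x \<longleftrightarrow> (\<forall>n a. rep c n a \<longrightarrow> hpart n x = hpart n (nu a))"

definition phi :: "(nat \<Rightarrow> 'p free_alg set set) \<Rightarrow> 'p SVG" where
  "phi c = (THE x. is_symbol c x)"

lemma phi_eqI:
  assumes "is_symbol c x" "\<And>n. \<exists>a. rep c n a" shows "phi c = x"
  unfolding phi_def
proof (rule the_equality)
  show "is_symbol c x" by (rule assms(1))
  fix y assume "is_symbol c y"
  show "y = x"
  proof (rule SVG_eqI)
    fix n
    obtain a where "rep c n a" using assms(2) by blast
    with assms(1) \<open>is_symbol c y\<close> show "hpart n y = hpart n x" by (simp add: is_symbol_def)
  qed
qed

lemma is_symbol_phi:
  assumes c: "c \<in> carrier gr" shows "is_symbol c (phi c)"
proof -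
  obtain N where N: "\<And>n. n \<ge> N \<Longrightarrow> c n = below n" using gr_bound[OF c] by blast
  obtain a where a: "\<And>n. rep c n (a n)" using gr_rep(2)[OF c] by metis
  define x where "x = (\<Sum>n<N. hpart n (nu (a n)))"
  have x: "hpart n x = (if n < N then hpart n (nu (a n)) else 0)" for n
  proof -
    have "hpart n x = (\<Sum>m<N. if n = m then hpart m (nu (a m)) else 0)"
      by (simp add: x_def additive.sum[OF additive_hpart] SVG_part_hpart[OF hpart_in_SVG_part])
    then show ?thesis by simp
  qed
  have "hpart n x = hpart n (nu b)" if "rep c n b" for n b
  proof (cases "n < N")
    case True
    have "hpart n (nu (a n - b)) = 0" by (rule nu_low[OF gr_rep(4)[OF c a that] order_refl])
    with True show ?thesis by (simp add: x additive.diff[OF additive_nu] additive.diff[OF additive_hpart])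
  next
    case False
    then have "cls b \<in> below n +>\<^bsub>H\<^esub> cls 0" using that N[of n] by (simp add: rep_def coset_below)
    then have "b \<in> low n" by (simp add: coset_mem)
    with False show ?thesis by (simp add: x nu_low[OF \<open>b \<in> low n\<close>])
  qed
  then have "is_symbol c x" by (simp add: is_symbol_def)
  moreover have "phi c = x" by (rule phi_eqI[OF \<open>is_symbol c x\<close>]) (rule gr_rep(2)[OF c])
  ultimately show ?thesis by simp
qed

lemma hpart_phi: "c \<in> carrier gr \<Longrightarrow> rep c n a \<Longrightarrow> hpart n (phi c) = hpart n (nu a)"
  using is_symbol_phi by (simp add: is_symbol_def)

lemma phi_add:
  assumes "c \<in> carrier gr" "d \<in> carrier gr"
  shows "phi (c \<oplus>\<^bsub>gr\<^esub> d) = phi c + phi d"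
proof (rule phi_eqI)
  show "\<exists>a. rep (c \<oplus>\<^bsub>gr\<^esub> d) n a" for n
    using gr_add_rep(1)[OF assms] gr_rep(2)[OF assms(1)] gr_rep(2)[OF assms(2)] by blast
  show "is_symbol (c \<oplus>\<^bsub>gr\<^esub> d) (phi c + phi d)"
    unfolding is_symbol_def
  proof (intro allI impI)
    fix n e assume "rep (c \<oplus>\<^bsub>gr\<^esub> d) n e"
    then obtain a b where ab: "rep c n a" "rep d n b" "cls e = cls (a + b)"
      using gr_add_rep(2)[OF assms] by blast
    show "hpart n (phi c + phi d) = hpart n (nu e)"
      by (simp add: nu_cong[OF ab(3)] additive.add[OF additive_hpart] additive.add[OF additive_nu]
        hpart_phi[OF assms(1) ab(1)] hpart_phi[OF assms(2) ab(2)])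
  qed
qed

lemma phi_mult:
  assumes "c \<in> carrier gr" "d \<in> carrier gr"
  shows "phi (c \<otimes>\<^bsub>gr\<^esub> d) = skew (phi c) (phi d)"
proof (rule phi_eqI)
  show "\<exists>a. rep (c \<otimes>\<^bsub>gr\<^esub> d) n a" for n
    by (rule gr_mult_rep(1)[OF assms])
  show "is_symbol (c \<otimes>\<^bsub>gr\<^esub> d) (skew (phi c) (phi d))"
    unfolding is_symbol_def
  proof (intro allI impI)
    fix n e assume "rep (c \<otimes>\<^bsub>gr\<^esub> d) n e"
    from gr_mult_rep(2)[OF assms this]
    obtain a b z where ab: "\<forall>i\<le>n. rep c i (a i) \<and> rep d i (b i)" and z: "z \<in> deg_lt n"
      and e: "cls e = cls ((\<Sum>i\<le>n. a i * b (n - i)) + z)" by blast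
    have r: "rep c i (a i)" "rep d i (b i)" if "i \<le> n" for i using ab that by auto
    have "hpart n (nu e) = (\<Sum>i\<le>n. hpart n (nu (a i * b (n - i))))"
      by (simp add: nu_cong[OF e] additive.add[OF additive_nu] additive.sum[OF additive_nu]
        additive.add[OF additive_hpart] additive.sum[OF additive_hpart] nu_deg[OF z])
    also have "\<dots> = (\<Sum>i\<le>n. skew (hpart i (phi c)) (hpart (n - i) (phi d)))"
    proof (rule sum.cong[OF refl])
      fix i assume "i \<in> {..n}"
      then have i: "i \<le> n" "n - i \<le> n" by auto
      have "hpart (i + (n - i)) (nu (a i * b (n - i))) = skew (hpart i (nu (a i))) (hpart (n - i) (nu (b (n - i))))"
        using r(1)[OF i(1)] r(2)[OF i(2)] by (intro nu_mult_top) (simp_all add: rep_def)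
      then show "hpart n (nu (a i * b (n - i))) = skew (hpart i (phi c)) (hpart (n - i) (phi d))"
        using i by (simp add: hpart_phi[OF assms(1) r(1)] hpart_phi[OF assms(2) r(2)])
    qed
    also have "\<dots> = hpart n (skew (phi c) (phi d))" by (simp add: hpart_skew)
    finally show "hpart n (skew (phi c) (phi d)) = hpart n (nu e)" ..
  qed
qed

lemma phi_one: "phi \<one>\<^bsub>gr\<^esub> = single 0 1"
proof (rule phi_eqI)
  show "\<exists>a. rep \<one>\<^bsub>gr\<^esub> n a" for n using gr_one_rep(1) gr_one_rep(4) by (cases "n = 0") auto
  have one: "nu 1 = (single 0 1 :: 'p SVG)"
  proof (rule nu_eqI)
    have "nf (single 0 1 :: 'p SVG) = in_G 0"
      using nf_single[of 0 0 1] by (simp add: nf_word_def in_G_def)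
    then show "1 - nf (single 0 1) \<in> I" using I_uminus[OF rel_1] by simp
  qed
  have "(single 0 1 :: 'p SVG) \<in> SVG_part 0" by (rule SVG_part_single) (simp add: homog_def mdeg_def)
  then have zero: "hpart n (single 0 1 :: 'p SVG) = 0" if "n > 0" for n using that by (simp add: SVG_part_hpart)
  show "is_symbol \<one>\<^bsub>gr\<^esub> (single 0 1)"
    unfolding is_symbol_def
  proof (intro allI impI)
    fix n a assume a: "rep \<one>\<^bsub>gr\<^esub> n a"
    show "hpart n (single 0 1) = hpart n (nu a)"
    proof (cases "n = 0")
      case True
      with nu_cong[OF gr_one_rep(2)[OF a]] one show ?thesis by (simp del: single_one)
    next
      case False
      then have "a \<in> low n" using gr_one_rep(3) a by simp
      with False show ?thesis by (simp add: nu_low[OF \<open>a \<in> low n\<close>] zero del: single_one)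
    qed
  qed
qed

lemma phi_coset:
  assumes "\<And>n. a n \<in> deg_lt (Suc n)" "finite {n. a n \<notin> low n}"
  shows "hpart n (phi (\<lambda>n. below n +>\<^bsub>H\<^esub> cls (a n))) = hpart n (nu (a n))"
  by (rule hpart_phi[OF gr_memI[OF assms]]) (simp add: rep_def assms coset_mem)

lemma phi_inj:
  assumes c: "c \<in> carrier gr" and d: "d \<in> carrier gr" and eq: "phi c = phi d" shows "c = d"
proof
  fix n
  obtain a where a: "rep c n a" using gr_rep(2)[OF c] by blast
  obtain b where b: "rep d n b" using gr_rep(2)[OF d] by blast
  have "hpart m (nu (a - b)) = 0" if "m \<ge> n" for m
  proof (cases "m = n")
    case True
    then show ?thesis
      using hpart_phi[OF c a] hpart_phi[OF d b] eq by (simp add: additive.diff[OF additive_nu] additive.diff[OF additive_hpart])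
  next
    case False
    then show ?thesis
      using a b that nu_deg[of a "Suc n" m] nu_deg[of b "Suc n" m]
      by (simp add: rep_def additive.diff[OF additive_nu] additive.diff[OF additive_hpart])
  qed
  then have "a - b \<in> low n" by (simp add: nu_low_iff)
  then show "c n = d n" by (simp add: gr_rep(1)[OF c a] gr_rep(1)[OF d b] coset_eq_iff)
qed

lemma phi_surj:
  obtains c where "c \<in> carrier gr" "phi c = x" "\<And>n. hpart n x = 0 \<Longrightarrow> c n = below n"
proof -
  let ?a = "\<lambda>n. nf (hpart n x)"
  obtain N where N: "\<And>n. n \<ge> N \<Longrightarrow> hpart n x = 0" using SVG_bound by blast
  have zero: "?a n \<in> low n" if "hpart n x = 0" for n using that by (simp add: additive.zero[OF additive_nf])
  have "{n. ?a n \<notin> low n} \<subseteq> {..<N}"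
  proof
    fix n assume "n \<in> {n. ?a n \<notin> low n}"
    then have "hpart n x \<noteq> 0" using zero[of n] by auto
    then show "n \<in> {..<N}" using N[of n] by force
  qed
  then have fin: "finite {n. ?a n \<notin> low n}" by (rule finite_subset) simp
  note deg = nf_deg[OF hpart_in_SVG_part]
  show ?thesis
  proof (rule that[OF gr_memI[OF deg fin]])
    show "phi (\<lambda>n. below n +>\<^bsub>H\<^esub> cls (?a n)) = x"
      by (rule SVG_eqI) (simp add: phi_coset[OF deg fin] nu_nf SVG_part_hpart[OF hpart_in_SVG_part])
    show "below n +>\<^bsub>H\<^esub> cls (?a n) = below n" if "hpart n x = 0" for n
      using zero[OF that] by (rule coset_below)
  qed
qed

lemma PBW: "PBW_deformation L \<kappa>"
  unfolding PBW_deformation_def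
proof (rule bexI[of _ phi], intro allI equalityI subsetI)
  show "phi \<in> ring_iso gr SG"
    unfolding ring_iso_def
  proof (intro CollectI conjI ring_hom_memI)
    show "bij_betw phi (carrier gr) (carrier SG)"
      unfolding bij_betw_def
    proof (intro conjI inj_onI phi_inj equalityI subsetI)
      fix x :: "'p SVG"
      obtain c where "c \<in> carrier gr" "phi c = x" by (rule phi_surj)
      then show "x \<in> phi ` carrier gr" by blast
    qed (simp_all add: skew_group_ring_simps)
  qed (simp_all add: skew_group_ring_simps phi_add phi_mult phi_one)
next
  fix n x assume "x \<in> phi ` gr_part H F n"
  then obtain c where c: "c \<in> carrier gr" "\<And>m. m \<noteq> n \<Longrightarrow> c m = below m" and x: "x = phi c"
    by (auto simp: gr_part_def)
  show "x \<in> SVG_part n" unfolding x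
  proof (rule hpart_eq_imp_SVG_part)
    fix m assume "m \<noteq> n"
    then have "rep c m 0" using c(2)[of m] coset_mem[of 0 m 0] by (simp add: rep_def coset_below)
    from hpart_phi[OF c(1) this] show "hpart m (phi c) = 0"
      by (simp add: additive.zero[OF additive_nu] additive.zero[OF additive_hpart])
  qed
next
  fix n and x :: "'p SVG" assume x: "x \<in> SVG_part n"
  obtain c where c: "c \<in> carrier gr" "phi c = x" "\<And>m. hpart m x = 0 \<Longrightarrow> c m = below m" by (rule phi_surj) blast
  have "c \<in> gr_part H F n" using c(1,3) x by (auto simp: gr_part_def SVG_part_hpart)
  with c(2) show "x \<in> phi ` gr_part H F n" by blast
qed

end

lemma finite_SVG_part: "finite (SVG_part n :: 'p::prime_card SVG set)"
proof -
  define M where "M = {m. mdeg m = n}"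
  have inj: "inj_on (\<lambda>m. (lookup m 1, lookup m 2)) M" by (auto intro!: inj_onI exp2_eqI)
  have "(\<lambda>m. (lookup m 1, lookup m 2)) ` M \<subseteq> {..n} \<times> {..n}" by (auto simp: M_def mdeg_def)
  then have "finite ((\<lambda>m. (lookup m 1, lookup m 2)) ` M)" by (rule finite_subset) simp
  then have M: "finite M" by (rule finite_imageD[OF _ inj])
  define e :: "'p SVG \<Rightarrow> 'p cyc \<times> (2 \<Rightarrow>\<^sub>0 nat) \<Rightarrow> 'p mod_ring" where "e x = (\<lambda>(h, m). lookup (lookup x h) m)" for x
  have "e ` SVG_part n \<subseteq> {f. \<forall>k. (k \<in> UNIV \<times> M \<longrightarrow> f k \<in> UNIV) \<and> (k \<notin> UNIV \<times> M \<longrightarrow> f k = 0)}"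
  proof (clarsimp simp: e_def M_def)
    fix x :: "'p SVG" and h m assume "x \<in> SVG_part n" "mdeg m \<noteq> n"
    then have "m \<notin> keys (lookup x h)" by (auto simp: SVG_part_iff homog_def)
    then show "lookup (lookup x h) m = 0" by (simp add: in_keys_iff)
  qed
  moreover have "finite {f :: 'p cyc \<times> (2 \<Rightarrow>\<^sub>0 nat) \<Rightarrow> 'p mod_ring. \<forall>k. (k \<in> UNIV \<times> M \<longrightarrow> f k \<in> UNIV) \<and> (k \<notin> UNIV \<times> M \<longrightarrow> f k = 0)}"
    by (rule finite_set_of_finite_funs) (use M finite_cyc in auto)
  ultimately have "finite (e ` SVG_part n)" by (rule finite_subset)
  moreover have "inj_on e (SVG_part n)"
    by (intro inj_onI poly_mapping_eqI) (metis (no_types, lifting) e_def case_prod_conv)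
  ultimately show ?thesis by (rule finite_imageD)
qed

context lam_kap
begin

text \<open>
  Normal forms give a map \<open>\<psi>\<close> from the degree \<open>n\<close> part of \<open>S(V) \<rtimes> G\<close> onto the degree \<open>n\<close> part of the
  associated graded ring. The given isomorphism, which is unrelated to \<open>\<psi>\<close>, maps back onto the same
  finite set, so \<open>\<psi>\<close> is injective.
\<close>

lemma PBW_imp_homog_indep:
  assumes "PBW_deformation L \<kappa>" "x \<in> SVG_part n" "nf x \<in> low n"
  shows "x = 0"
proof -
  obtain \<phi> where \<phi>: "\<phi> ` gr_part H F n = (SVG_part n :: 'p SVG set)"
    using assms(1) unfolding PBW_deformation_def by blast
  define \<psi> where "\<psi> x = (\<lambda>m. below m +>\<^bsub>H\<^esub> cls (if m = n then nf x else 0))" for x :: "'p SVG"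
  have onto: "\<psi> ` SVG_part n \<supseteq> gr_part H F n"
  proof
    fix c assume "c \<in> gr_part H F n"
    then have c: "c \<in> carrier gr" "\<And>m. m \<noteq> n \<Longrightarrow> c m = below m" by (auto simp: gr_part_def)
    obtain a where a: "a \<in> deg_lt (Suc n)" "c n = below n +>\<^bsub>H\<^esub> cls a" by (rule gr_coset[OF c(1)])
    obtain y where y: "a - nf y \<in> I" "\<forall>m>n. hpart m y = 0" using reduce[OF a(1)] by blast
    have "nf y = (\<Sum>k<n. nf (hpart k y)) + nf (hpart n y)"
      using SVG_sum_hpart[of "Suc n" y] y(2)
      by (metis Suc_le_lessD additive.sum[OF additive_nf] sum.lessThan_Suc)
    then have "nf y - nf (hpart n y) \<in> low n"
      using deg_lt_low[OF nf_sum_deg] by (metis add_diff_cancel_right')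
    with low_add[OF I_low[OF y(1)]] have "(a - nf y) + (nf y - nf (hpart n y)) \<in> low n" by blast
    then have "c n = below n +>\<^bsub>H\<^esub> cls (nf (hpart n y))" by (simp add: a(2) coset_eq_iff)
    then have "c m = \<psi> (hpart n y) m" for m using c(2)[of m] by (cases "m = n") (simp_all add: \<psi>_def coset_below)
    then have "c = \<psi> (hpart n y)" by (rule ext)
    then show "c \<in> \<psi> ` SVG_part n" using hpart_in_SVG_part by blast
  qed
  have \<psi>_gr: "\<psi> y \<in> gr_part H F n" if "y \<in> SVG_part n" for y
  proof -
    have "\<psi> y \<in> carrier gr" unfolding \<psi>_def
      by (rule gr_memI) (use nf_deg[OF that] in \<open>auto intro: finite_subset[of _ "{n}"]\<close>)
    then show ?thesis by (simp add: gr_part_def \<psi>_def coset_below)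
  qed
  have "(\<phi> \<circ> \<psi>) ` SVG_part n = SVG_part n"
    using \<phi> onto \<psi>_gr by (metis image_comp image_subsetI subset_antisym)
  then have "inj_on (\<phi> \<circ> \<psi>) (SVG_part n)"
    using finite_SVG_part[of n, where 'p = 'p] by (intro eq_card_imp_inj_on) simp_all
  moreover have "\<psi> x m = \<psi> 0 m" for m
    using assms(3) by (cases "m = n") (simp_all add: \<psi>_def coset_eq_iff additive.zero[OF additive_nf])
  then have "\<psi> x = \<psi> 0" by (rule ext)
  ultimately show ?thesis using assms(2) by (metis SVG_part_0 comp_apply inj_onD)
qed

text \<open>
  A nonzero combination of normal forms that vanishes in \<open>H\<close> has a highest homogeneous part, which
  vanishes in the associated graded ring. This reduces the independence to the homogeneous case.
\<close>

theorem PBW_iff_independent: "PBW_deformation L \<kappa> \<longleftrightarrow> (\<forall>x. nf x \<in> I \<longrightarrow> x = 0)"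
proof
  assume "\<forall>x. nf x \<in> I \<longrightarrow> x = 0"
  then interpret nf_basis by unfold_locales blast
  show "PBW_deformation L \<kappa>" by (rule PBW)
next
  assume PBW: "PBW_deformation L \<kappa>"
  show "\<forall>x. nf x \<in> I \<longrightarrow> x = 0"
  proof (intro allI impI)
    fix x :: "'p SVG" assume x: "nf x \<in> I"
    have all: "\<forall>m. hpart m x = 0" if "\<And>m. m \<ge> n \<Longrightarrow> hpart m x = 0" for n
      using that
    proof (induction n)
      case (Suc n)
      have "nf x = (\<Sum>k<n. nf (hpart k x)) + nf (hpart n x)"
        using SVG_sum_hpart[of "Suc n" x] Suc.prems by (metis additive.sum[OF additive_nf] sum.lessThan_Suc)
      then have "nf (hpart n x) \<in> low n"
        using low_diff[OF I_low[OF x] deg_lt_low[OF nf_sum_deg]] by (metis add_diff_cancel_left')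
      from PBW_imp_homog_indep[OF PBW hpart_in_SVG_part this] Suc show ?case
        by (metis le_neq_implies_less Suc_leI)
    qed simp
    obtain N where "\<And>m. m \<ge> N \<Longrightarrow> hpart m x = 0" using SVG_bound[of x] by blast
    then have "\<forall>m. hpart m x = 0" by (rule all)
    then show "x = 0" by - (rule SVG_eqI[of x 0], simp add: additive.zero[OF additive_hpart])
  qed
qed

end

section \<open>Parameter pairs in coordinates\<close>

lemma scale_FG_eq: "scale_FG c r = single 0 c * r"
  by (simp add: scale_FG_def mult_map_scale_conv_mult)

lemma lookup_scale_VFG: "lookup (scale_VFG c u) h = c *s lookup u h"
  by (simp add: scale_VFG_def Poly_Mapping.map.rep_eq when_def vec_eq_iff)

lemma vector_space_scale_FG: "vector_space scale_FG"
  by unfold_locales (simp_all add: scale_FG_eq distrib_left distrib_right single_add mult_single flip: mult.assoc)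

lemma vector_space_scale_sum: "vector_space scale_sum"
proof -
  have "scale_VFG a (u + v) = scale_VFG a u + scale_VFG a v" "scale_VFG (a + b) u = scale_VFG a u + scale_VFG b u"
    "scale_VFG a (scale_VFG b u) = scale_VFG (a * b) u" "scale_VFG 1 u = u" for a b and u v :: "'p::prime_card VFG"
    by (rule poly_mapping_eqI, simp add: lookup_scale_VFG lookup_add vec_eq_iff algebra_simps)+
  then show ?thesis
    by unfold_locales
      (auto simp: scale_sum_def scale_FG_eq distrib_left distrib_right single_add mult_single simp flip: mult.assoc)
qed

lemma V_decompose: "v = (v $ 1) *s v1 + (v $ 2) *s v2" for v :: "'p::prime_card V"
  by (simp add: vec_eq_iff forall_2 axis_def)

lemma bilinear_lam_iff: "bilinear_lam L \<longleftrightarrow>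
  (\<forall>x v w. L x (v + w) = L x v + L x w) \<and> (\<forall>x c v. L x (c *s v) = single 0 c * L x v) \<and>
  (\<forall>x y v. L (x + y) v = L x v + L y v) \<and> (\<forall>x c v. L (single 0 c * x) v = single 0 c * L x v)"
  unfolding bilinear_lam_def Vector_Spaces.linear_iff
  using vector_space_scale_FG vec.vector_space_axioms by (auto simp: scale_FG_eq)

lemma alternating_kap_iff: "alternating_kap \<kappa> \<longleftrightarrow>
  (\<forall>u v w. \<kappa> u (v + w) = \<kappa> u v + \<kappa> u w) \<and> (\<forall>u c v. \<kappa> u (c *s v) = scale_sum c (\<kappa> u v)) \<and>
  (\<forall>u v w. \<kappa> (u + v) w = \<kappa> u w + \<kappa> v w) \<and> (\<forall>u c v. \<kappa> (c *s u) v = scale_sum c (\<kappa> u v)) \<and>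
  (\<forall>v. \<kappa> v v = 0)"
  unfolding alternating_kap_def Vector_Spaces.linear_iff
  using vector_space_scale_sum vec.vector_space_axioms by auto

lemma lam_eqI:
  assumes L: "bilinear_lam L" and L': "bilinear_lam L'"
    and eq: "\<And>h. L (single h 1) v1 = L' (single h 1) v1" "\<And>h. L (single h 1) v2 = L' (single h 1) v2"
  shows "L = (L' :: 'p::prime_card lam)"
proof (intro ext)
  fix r :: "'p FG" and v :: "'p V"
  have split: "L (single h c) v = single 0 c * (single 0 (v $ 1) * L (single h 1) v1 + single 0 (v $ 2) * L (single h 1) v2)"
    if "bilinear_lam L" for L :: "'p lam" and h c
  proof -
    have "L (single h c) v = L (single 0 c * single h 1) ((v $ 1) *s v1 + (v $ 2) *s v2)"
      by (simp add: mult_single flip: V_decompose)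
    then show ?thesis
      using that by (simp only: bilinear_lam_iff) (simp only: algebra_simps)
  qed
  show "L r v = L' r v"
    by (rule additive_eqI) (use L L' in \<open>auto simp: additive_def bilinear_lam_iff[of L] bilinear_lam_iff[of L'] split eq\<close>)
qed

lemma lam_eqI_gp:
  assumes "bilinear_lam L" "bilinear_lam L'"
    and "\<And>i. i < CARD('p) \<Longrightarrow> L (gp i) v1 = L' (gp i) v1" "\<And>i. i < CARD('p) \<Longrightarrow> L (gp i) v2 = L' (gp i) v2"
  shows "L = (L' :: 'p::prime_card lam)"
  by (rule lam_eqI[OF assms(1,2)]) (metis assms(3,4) gpow_surj)+

lemma kap_eqI:
  assumes "alternating_kap \<kappa>" "alternating_kap \<kappa>'" "\<kappa> v1 v2 = \<kappa>' v1 v2"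
  shows "\<kappa> = (\<kappa>' :: 'p::prime_card kap)"
proof (intro ext)
  interpret S: vector_space "scale_sum :: 'p mod_ring \<Rightarrow> _" by (rule vector_space_scale_sum)
  fix v w :: "'p V"
  have split: "\<kappa> v w = scale_sum (v $ 1) (scale_sum (w $ 2) (\<kappa> v1 v2)) + scale_sum (v $ 2) (scale_sum (w $ 1) (- \<kappa> v1 v2))"
    if "alternating_kap \<kappa>" for \<kappa> :: "'p kap"
  proof -
    have add_r: "\<kappa> u (v + w) = \<kappa> u v + \<kappa> u w" and scale_r: "\<kappa> u (c *s v) = scale_sum c (\<kappa> u v)"
      and add_l: "\<kappa> (u + v) w = \<kappa> u w + \<kappa> v w" and scale_l: "\<kappa> (c *s u) v = scale_sum c (\<kappa> u v)"
      and alt: "\<kappa> v v = 0" for u v w c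
      using that unfolding alternating_kap_iff by auto
    have "\<kappa> (v1 + v2) (v1 + v2) = \<kappa> v1 v1 + \<kappa> v2 v1 + (\<kappa> v1 v2 + \<kappa> v2 v2)"
      by (simp only: add_l add_r)
    then have "\<kappa> v1 v2 + \<kappa> v2 v1 = 0" by (simp only: alt add_0 add_0_right add.commute)
    then have 21: "\<kappa> v2 v1 = - \<kappa> v1 v2" by (rule minus_unique[symmetric])
    have "\<kappa> v w = \<kappa> ((v $ 1) *s v1 + (v $ 2) *s v2) ((w $ 1) *s v1 + (w $ 2) *s v2)"
      by (simp flip: V_decompose)
    then show ?thesis
      by (simp only: add_l add_r scale_l scale_r alt 21 S.scale_zero_right add_0 add_0_right)
        (simp only: S.scale_scale mult.commute add.commute)
  qed
  show "\<kappa> v w = \<kappa>' v w" using assms by (simp only: split)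
qed

text \<open>
  The element \<open>v1 x + v2 y\<close> of \<open>V \<otimes> R\<close>.
\<close>

definition vfg :: "'p::prime_card FG \<Rightarrow> 'p FG \<Rightarrow> 'p VFG" where
  "vfg x y = lin_ext (\<lambda>h c. single h (c *s v1)) x + lin_ext (\<lambda>h c. single h (c *s v2)) y"

lemma additive_vfg_aux: "additive (lin_ext (\<lambda>h c. single h (c *s v)))" for v :: "'p::prime_card V"
  by (rule additive_lin_ext) (simp add: additive_def vec.scale_left_distrib single_add)

lemma lookup_vfg_aux: "lookup (lin_ext (\<lambda>h c. single h (c *s v)) x) h = lookup x h *s v" for v :: "'p::prime_card V"
  by (rule additive_eqI[of "\<lambda>x. lookup (lin_ext (\<lambda>h c. single h (c *s v)) x) h" "\<lambda>x. lookup x h *s v"])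
    (auto simp: additive_def additive.add[OF additive_vfg_aux] lookup_add vec.scale_left_distrib lookup_single when_def)

lemma lookup_vfg: "lookup (vfg x y) h = lookup x h *s v1 + lookup y h *s v2"
  by (simp add: vfg_def lookup_add lookup_vfg_aux)

lemma vfg_inj: "vfg x y = vfg x' y' \<longleftrightarrow> x = x' \<and> y = y'"
proof
  assume eq: "vfg x y = vfg x' y'"
  have "lookup (vfg x y) h $ 1 = lookup (vfg x' y') h $ 1 \<and> lookup (vfg x y) h $ 2 = lookup (vfg x' y') h $ 2" for h
    by (simp add: eq)
  then show "x = x' \<and> y = y'" by (auto simp: lookup_vfg axis_def intro: poly_mapping_eqI)
qed simp

lemma vfg_surj: obtains x y where "u = vfg x y"
proof -
  have "\<exists>x y. u = vfg x y"
  proof (induction u rule: poly_mapping_additive_induct)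
    case (single h v)
    have "single h v = vfg (single h (v $ 1)) (single h (v $ 2))"
      by (simp add: vfg_def flip: single_add V_decompose)
    then show ?case by blast
  next
    case (add u v)
    then obtain x y x' y' where "u = vfg x y" "v = vfg x' y'" by blast
    then have "u + v = vfg (x + x') (y + y')"
      by (simp add: vfg_def additive.add[OF additive_vfg_aux] add_ac)
    then show ?case by blast
  qed
  then show ?thesis using that by blast
qed

lemma vfg_add: "vfg (x + x') (y + y') = vfg x y + vfg x' y'"
  by (simp add: vfg_def additive.add[OF additive_vfg_aux] add_ac)

text \<open>
  On \<open>g\<^sup>i\<close> these values are \<open>i b g\<^sup>i\<close> at \<open>v1\<close> and \<open>(i a + (i choose 2) b) g\<^sup>i\<close> at \<open>v2\<close>, the general
  solution of the cocycle condition on a cyclic group.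
\<close>

definition lam_of :: "'p::prime_card FG \<Rightarrow> 'p FG \<Rightarrow> 'p lam" where
  "lam_of a b r v = single 0 (v $ 1) * (b * eul r) + single 0 (v $ 2) * (a * eul r + b * eul2 r)"

definition kap_of :: "'p::prime_card FG \<Rightarrow> 'p FG \<Rightarrow> 'p FG \<Rightarrow> 'p kap" where
  "kap_of C x y v w = scale_sum (v $ 1 * w $ 2 - v $ 2 * w $ 1) (C, vfg x y)"

definition param :: "'p::prime_card FG \<Rightarrow> 'p FG \<Rightarrow> 'p FG \<Rightarrow> 'p FG \<Rightarrow> 'p FG \<Rightarrow> 'p lam \<times> 'p kap" where
  "param a b x y C = (lam_of a b, kap_of C x y)"

lemma lam_of_v: "lam_of a b r v1 = b * eul r" "lam_of a b r v2 = a * eul r + b * eul2 r"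
  by (simp_all add: lam_of_def axis_def)

lemma kap_of_v: "kap_of C x y v1 v2 = (C, vfg x y)"
proof -
  interpret S: vector_space "scale_sum :: 'a mod_ring \<Rightarrow> _" by (rule vector_space_scale_sum)
  show ?thesis by (simp add: kap_of_def axis_def)
qed

lemma bilinear_lam_of: "bilinear_lam (lam_of a b)"
proof -
  have e: "eul (single 0 c * r) = single 0 c * eul r" for c and r :: "'a FG"
    by (simp add: eul_mult eul_simps)
  have e2: "eul2 (single 0 c * r) = single 0 c * eul2 r" for c and r :: "'a FG"
    by (rule additive_eqI[OF additive_compose[OF _ additive_mult_left] additive_compose[OF additive_mult_left]])
      (simp_all add: additive_def eul2_simps mult_single mult_ac)
  have s: "single 0 (c * d) = (single 0 c * single 0 d :: 'a FG)" for c d by (simp add: mult_single)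
  show ?thesis
    unfolding bilinear_lam_iff lam_of_def
    by (intro conjI allI; simp only: e e2 s eul_simps eul2_simps single_add vector_add_component
        vector_smult_component; simp only: algebra_simps)
qed

lemma alternating_kap_of: "alternating_kap (kap_of C x y)"
proof -
  interpret vector_space "scale_sum :: 'a mod_ring \<Rightarrow> _" by (rule vector_space_scale_sum)
  have "0 = (0 :: 'a FG \<times> 'a VFG)" ..
  then show ?thesis
    unfolding alternating_kap_iff kap_of_def
    by (simp add: mult_ac algebra_simps flip: scale_left_distrib)
qed

lemma param_in_parameters: "param a b x y C \<in> parameters"
  by (simp add: param_def parameters_def bilinear_lam_of alternating_kap_of)

lemma gp_1_inverse: "gp (CARD('p) - 1) * gp 1 = (1 :: 'p::prime_card FG)"
proof -
  have "CARD('p) - 1 + 1 = CARD('p)" using zero_less_card_finite[where 'a = 'p] by linarith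
  then show ?thesis by (metis gp_add gp_card)
qed

lemma gp_1_cancel: "gp 1 * c = 0 \<Longrightarrow> c = (0 :: 'p::prime_card FG)"
proof -
  assume "gp 1 * c = 0"
  then have "gp (CARD('p) - 1) * gp 1 * c = 0" by (simp only: mult.assoc mult_zero_right)
  then show "c = 0" by (simp only: gp_1_inverse mult_1_left)
qed

lemma param_inj: "param a b x y C = param a' b' x' y' C' \<longleftrightarrow> a = a' \<and> b = b' \<and> x = x' \<and> y = y' \<and> C = C'"
proof
  assume eq: "param a b x y C = param a' b' x' y' C'"
  have cancel: "c = d" if "c * gp 1 = d * gp 1" for c d :: "'a FG"
    using that gp_1_cancel[of "c - d"] by (simp add: algebra_simps)
  from eq have "lam_of a b (gp 1) v1 = lam_of a' b' (gp 1) v1" "lam_of a b (gp 1) v2 = lam_of a' b' (gp 1) v2"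
    "kap_of C x y v1 v2 = kap_of C' x' y' v1 v2"
    by (auto simp: param_def)
  then show "a = a' \<and> b = b' \<and> x = x' \<and> y = y' \<and> C = C'"
    by (auto simp: lam_of_v eul_simps eul2_simps kap_of_v vfg_inj simp del: One_nat_def intro: cancel)
qed simp

lemma parameters_eq_param:
  assumes "(L, \<kappa>) \<in> parameters" "\<And>h. L (single h 1) v1 = b * eul (single h 1)"
    "\<And>h. L (single h 1) v2 = a * eul (single h 1) + b * eul2 (single h 1)" "\<kappa> v1 v2 = (C, vfg x y)"
  shows "(L, \<kappa>) = param a b x y C"
  using assms unfolding param_def parameters_def
  by (auto intro!: lam_eqI kap_eqI simp: bilinear_lam_of alternating_kap_of lam_of_v kap_of_v)

section \<open>Necessary conditions\<close>

lemma in_FG_eq: "in_FG = lin_ext (\<lambda>h. single (Word [Ggen h]))"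
  by (simp add: fun_eq_iff in_FG_def lin_ext_def)

lemma additive_in_FG: "additive in_FG"
  unfolding in_FG_eq by (intro additive_intros)

lemma in_FG_single: "in_FG (single h c) = cst c * in_G h"
  by (simp add: in_FG_eq in_G_def mult_single)

lemma in_FG_gp: "in_FG (single h 1) = in_G h"
  by (simp add: in_FG_single)

lemma cst_left_commute: "a * (cst c * b) = cst c * (a * b)"
  by (simp only: cst_commute[of c a] mult.assoc[symmetric])

lemma cst_mult: "cst c * cst d = cst (c * d)"
  by (simp add: mult_single)

lemma in_FG_cst: "in_FG (single 0 c * r) = cst c * in_FG r"
  by (rule additive_eqI[of "\<lambda>r. in_FG (single 0 c * r)" "\<lambda>r. cst c * in_FG r"])
    (simp_all add: additive_def additive.add[OF additive_in_FG] distrib_left mult_single in_FG_single flip: mult.assoc)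

lemma in_VFG_eq: "in_VFG = lin_ext (\<lambda>h v. in_V v * in_G h)"
  by (simp add: fun_eq_iff in_VFG_def lin_ext_def)

lemma in_VFG_vfg: "in_VFG (vfg x y) = A1 * in_FG x + A2 * in_FG y"
proof -
  have add: "additive in_VFG"
    unfolding in_VFG_eq by (rule additive_lin_ext) (simp add: additive_def in_V_eq single_add algebra_simps)
  have single: "in_VFG (single h v) = in_V v * in_G h" for h and v :: "'a V"
    unfolding in_VFG_eq by (simp add: in_V_eq)
  have aux: "in_VFG (lin_ext (\<lambda>h c. single h (c *s v)) x) = in_V v * in_FG x" for v and x :: "'a FG"
  proof (rule additive_eqI[OF additive_compose[OF add additive_vfg_aux] additive_compose[OF additive_mult_left additive_in_FG]])
    fix h and c :: "'a mod_ring"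
    have "in_V (c *s v) = in_V v * cst c"
      by (simp only: cst_commute[of c, symmetric] in_V_eq vector_smult_component distrib_left)
        (simp add: mult_single flip: mult.assoc)
    then show "in_VFG (lin_ext (\<lambda>h c. single h (c *s v)) (single h c)) = in_V v * in_FG (single h c)"
      by (simp add: single in_FG_single mult.assoc)
  qed
  show ?thesis by (simp add: vfg_def additive.add[OF add] aux in_V_v)
qed

context lam_kap
begin

lemma in_FG_mult: "in_FG r * in_FG s - in_FG (r * s) \<in> I"
proof (induction r rule: poly_mapping_additive_induct)
  case (single h c)
  show ?case
  proof (induction s rule: poly_mapping_additive_induct)
    case (single h' c')
    have "cst c * in_G h * (cst c' * in_G h') = cst (c * c') * (in_G h * in_G h')"
      by (simp only: mult.assoc cst_left_commute[of "in_G h"]) (simp add: mult_single flip: mult.assoc)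
    then have "in_FG (single h c) * in_FG (single h' c') - in_FG (single h c * single h' c')
      = cst (c * c') * (in_G h * in_G h' - in_G (h + h'))"
      by (simp add: in_FG_single mult_single[of h] right_diff_distrib)
    then show ?case using I_mult_left[OF rel_G] by simp
  next
    case (add s s')
    from I_add[OF add] show ?case by (simp add: additive.add[OF additive_in_FG] algebra_simps)
  qed
next
  case (add r r')
  from I_add[OF add] show ?case by (simp add: additive.add[OF additive_in_FG] algebra_simps)
qed

end

text \<open>
  The same for the two ways of sorting \<open>G v w\<close>, by first moving \<open>G\<close> or by first exchanging \<open>v\<close> and
  \<open>w\<close>. The letters on the left-hand side stand for the reduced products that occur.
\<close>

lemma overlap_identity:
  fixes G v w b a D e f C x y GC CG xG yG Gx Gy bx ay :: "'a::ring"
  shows "(e + CG - f - GC - bx - ay) + v * (D + xG - b - Gx - Gy) + w * (yG - Gy) =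
    G * (v * w - w * v - C - v * x - w * y) - (G * v - v * G - b) * w - v * (G * w - w * G - v * G - a)
    - (b * w - w * b - v * D - e) - (v * w - w * v - C - v * x - w * y) * G
    + (G * w - w * G - v * G - a) * v + w * (G * v - v * G - b) + v * (G * v - v * G - b)
    + (a * v - v * a - f) + (G * v - v * G - b) * x + (G * w - w * G - v * G - a) * y
    + (G * C - GC) - (C * G - CG) - v * (x * G - xG) - w * (y * G - yG)
    + v * (G * x - Gx) + w * (G * y - Gy) + v * (G * y - Gy) + (b * x - bx) + (a * y - ay)"
  by (simp add: algebra_simps)

text \<open>
  The difference between moving \<open>w\<close> past the product \<open>P\<close> of \<open>H\<close> and \<open>H'\<close> at once and past the two
  factors in turn, as a combination of relators.
\<close>

lemma cocycle_identity:
  fixes H H' P v w c d k l m m' n p q r :: "'a::ring"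
  shows "n - (p + d * q + r) =
    H * (H' * w - w * H' - d * (v * H') - m') + (H * w - w * H - c * (v * H) - m) * H'
    + d * ((H * v - v * H - l) * H') - (P * w - w * P - (c + d) * (v * P) - n)
    - (H * H' - P) * w + w * (H * H' - P) + (c + d) * (v * (H * H' - P))
    + (m * H' - p) + (H * m' - r) + d * (l * H' - q) + (H * d - d * H) * (v * H')"
  by (simp add: algebra_simps)

context nf_basis
begin

text \<open>
  Independence of normal forms in degrees zero and one, which suffices to compare coefficients below.
\<close>

lemma embed_indep:
  assumes "in_FG r0 + A1 * in_FG r1 + A2 * in_FG r2 \<in> I"
  shows "r0 = 0 \<and> r1 = 0 \<and> r2 = 0"
proof -
  define emb :: "(2 \<Rightarrow>\<^sub>0 nat) \<Rightarrow> 'p FG \<Rightarrow> 'p SVG" where "emb m = lin_ext (\<lambda>h c. single h (single m c))" for m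
  have add: "additive (emb m)" for m unfolding emb_def by (rule additive_lin_ext) (simp add: additive_def single_add)
  have emb_single: "emb m (single h c) = single h (single m c)" for m h c by (simp add: emb_def)
  have nf_emb: "nf (emb m r) = A2 ^ lookup m 2 * A1 ^ lookup m 1 * in_FG r" for m r
    by (rule additive_eqI[OF additive_compose[OF additive_nf add] additive_compose[OF additive_mult_left additive_in_FG]])
      (simp add: emb_single nf_single nf_word_eq in_FG_single mult.assoc cst_commute)
  have look: "lookup (lookup (emb m r) h) k = (if m = k then lookup r h else 0)" for m r h k
    by (rule additive_eqI[of "\<lambda>r. lookup (lookup (emb m r) h) k" "\<lambda>r. if m = k then lookup r h else 0"])
      (auto simp: additive_def additive.add[OF add] lookup_add emb_single lookup_single when_def)
  define x where "x = emb 0 r0 + emb (single 1 1) r1 + emb (single 2 1) r2"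
  have "nf x = in_FG r0 + A1 * in_FG r1 + A2 * in_FG r2"
    by (simp add: x_def additive.add[OF additive_nf] nf_emb lookup_single)
  with assms have "x = 0" using indep by simp
  have ne: "(single 1 1 :: 2 \<Rightarrow>\<^sub>0 nat) \<noteq> 0" "(single 2 1 :: 2 \<Rightarrow>\<^sub>0 nat) \<noteq> 0" "(single 1 1 :: 2 \<Rightarrow>\<^sub>0 nat) \<noteq> single 2 1"
    by (auto dest: arg_cong[of _ _ "\<lambda>m. lookup m 1"] arg_cong[of _ _ "\<lambda>m. lookup m 2"] simp: lookup_single)
  have "lookup (lookup x h) 0 = lookup r0 h" "lookup (lookup x h) (single 1 1) = lookup r1 h"
    "lookup (lookup x h) (single 2 1) = lookup r2 h" for h
    using ne ne[symmetric] by (simp_all add: x_def lookup_add look del: One_nat_def)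
  then show ?thesis unfolding \<open>x = 0\<close> by (auto intro!: poly_mapping_eqI)
qed

lemma in_FG_cancel: "in_FG r - in_FG s \<in> I \<Longrightarrow> r = s"
  using embed_indep[of "r - s" 0 0] by (simp add: additive.diff[OF additive_in_FG] additive.zero[OF additive_in_FG])

abbreviation "l1 h \<equiv> L (single h 1) v1"
abbreviation "l2 h \<equiv> L (single h 1) v2"

lemma G_A1: "in_G h * A1 - A1 * in_G h - in_FG (l1 h) \<in> I"
  and G_A2: "in_G h * A2 - A2 * in_G h - cst (ix h) * (A1 * in_G h) - in_FG (l2 h) \<in> I"
  using rel_L[of h v1] rel_L[of h v2]
  by (simp_all add: in_V_v act_v2) (simp add: in_V_eq axis_def algebra_simps)

text \<open>
  Both cocycle conditions compare \<open>(h h') v\<close> with \<open>h (h' v)\<close>.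
\<close>

lemma l1_add: "l1 (h + h') = l1 h * single h' 1 + single h 1 * l1 h'"
proof (rule in_FG_cancel)
  have "in_FG (l1 (h + h')) - in_FG (l1 h * single h' 1 + single h 1 * l1 h') =
    in_G h * (in_G h' * A1 - A1 * in_G h' - in_FG (l1 h')) + (in_G h * A1 - A1 * in_G h - in_FG (l1 h)) * in_G h'
    - (in_G (h + h') * A1 - A1 * in_G (h + h') - in_FG (l1 (h + h')))
    - (in_G h * in_G h' - in_G (h + h')) * A1 + A1 * (in_G h * in_G h' - in_G (h + h'))
    + (in_FG (l1 h) * in_FG (single h' 1) - in_FG (l1 h * single h' 1))
    + (in_FG (single h 1) * in_FG (l1 h') - in_FG (single h 1 * l1 h'))"
    by (simp add: additive.add[OF additive_in_FG] in_FG_gp algebra_simps)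
  also have "\<dots> \<in> I"
    by (intro I_add I_diff I_mult_left[OF G_A1] I_mult_right[OF G_A1] G_A1 I_mult_left[OF rel_G] I_mult_right[OF rel_G] in_FG_mult)
  finally show "in_FG (l1 (h + h')) - in_FG (l1 h * single h' 1 + single h 1 * l1 h') \<in> I" .
qed

lemma l2_add: "l2 (h + h') = l2 h * single h' 1 + single 0 (ix h') * (l1 h * single h' 1) + single h 1 * l2 h'"
proof (rule in_FG_cancel)
  let ?c = "cst (ix h')"
  have c: "in_FG (single 0 (ix h') * (l1 h * single h' 1)) = ?c * in_FG (l1 h * single h' 1)"
    by (rule in_FG_cst)
  have ix: "cst (ix (h + h')) = cst (ix h) + ?c" by (simp add: single_add)
  have comm: "in_G h * ?c - ?c * in_G h = 0" by (simp add: cst_commute)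
  note G2 = G_A2[of "h + h'", unfolded ix]
  note mult = in_FG_mult[of _ "single h' 1", unfolded in_FG_gp] and mult' = in_FG_mult[of "single h 1", unfolded in_FG_gp]
  show "in_FG (l2 (h + h')) - in_FG (l2 h * single h' 1 + single 0 (ix h') * (l1 h * single h' 1) + single h 1 * l2 h') \<in> I"
    unfolding additive.add[OF additive_in_FG] c
    unfolding cocycle_identity[where n = "in_FG (l2 (h + h'))" and d = ?c and H = "in_G h" and H' = "in_G h'"
        and P = "in_G (h + h')" and v = A1 and w = A2 and c = "cst (ix h)" and l = "in_FG (l1 h)" and m = "in_FG (l2 h)"
        and m' = "in_FG (l2 h')" and p = "in_FG (l2 h * single h' 1)" and q = "in_FG (l1 h * single h' 1)"
        and r = "in_FG (single h 1 * l2 h')"] comm mult_zero_left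
    by (intro I_add I_diff I_mult_left[OF G_A2] I_mult_right[OF G_A2] I_mult_left[OF I_mult_right[OF G_A1]] G2
        I_mult_right[OF rel_G] I_mult_left[OF rel_G] I_mult_left[OF I_mult_left[OF rel_G]] mult mult' I_mult_left[OF mult] I_zero)
qed

text \<open>
  A cocycle on a cyclic group is determined by its values at the generator, which are \<open>b g\<close> and \<open>a g\<close>.
\<close>

lemma lam_coordinates:
  assumes "odd CARD('p)"
  obtains a b where "\<And>h. l1 h = b * eul (single h 1)" "\<And>h. l2 h = a * eul (single h 1) + b * eul2 (single h 1)"
proof -
  let ?g = "gp 1 :: 'p FG" and ?g' = "gp (CARD('p) - 1) :: 'p FG"
  note inv = gp_1_inverse[where 'p = 'p]
  define b where "b = l1 (gpow 1) * ?g'"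
  define a where "a = l2 (gpow 1) * ?g'"
  have ab: "l1 (gpow 1) = b * ?g" "l2 (gpow 1) = a * ?g" by (simp_all only: a_def b_def mult.assoc inv mult_1_right)
  have step: "gpow (Suc i) = gpow i + gpow 1" for i by (simp flip: gpow_add)
  have step': "gp (Suc i) = gp i * ?g" for i by (simp add: mult_single flip: gpow_add)
  have eg: "eul ?g = ?g" "eul2 ?g = 0" by (simp_all add: eul_simps eul2_simps)
  have 1: "l1 (gpow i) = b * eul (gp i)" for i
  proof (induction i)
    case 0
    have "l1 (0 + 0) = l1 0 + l1 0" by (simp add: l1_add[of 0 0] del: add_0 add_0_right)
    then show ?case by (simp add: eul_simps)
  next
    case (Suc i)
    have "l1 (gpow (Suc i)) = l1 (gpow i) * ?g + gp i * l1 (gpow 1)" by (simp only: step l1_add)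
    also have "\<dots> = b * eul (gp (Suc i))" unfolding Suc ab step' eul_mult eg by (simp only: algebra_simps)
    finally show ?case .
  qed
  have 2: "l2 (gpow i) = a * eul (gp i) + b * eul2 (gp i)" for i
  proof (induction i)
    case 0
    have "l2 (0 + 0) = l2 0 + l2 0" by (simp add: l2_add[of 0 0] del: add_0 add_0_right)
    then show ?case by (simp add: eul_simps eul2_simps)
  next
    case (Suc i)
    have "l2 (gpow (Suc i)) = l2 (gpow i) * ?g + l1 (gpow i) * ?g + gp i * l2 (gpow 1)"
      by (simp only: step l2_add) simp
    also have "\<dots> = a * eul (gp (Suc i)) + b * eul2 (gp (Suc i))"
      unfolding Suc 1 ab step' eul_mult eul2_mult[OF assms] eg by (simp only: algebra_simps mult_zero_right mult_zero_left add_0 add_0_right)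
    finally show ?case .
  qed
  show ?thesis using 1 2 by (intro that[of b a]) (metis gpow_surj)+
qed

text \<open>
  In the overlap \<open>g v\<^sub>1 v\<^sub>2\<close> the coefficient of \<open>v\<^sub>1\<close> gives \<open>g (D b - y) = 0\<close> and the constant term
  gives \<open>g b m = 0\<close>.
\<close>

lemma PBW_conditions:
  assumes odd: "odd CARD('p)" and l1: "\<And>h. l1 h = b * eul (single h 1)"
    and l2: "\<And>h. l2 h = a * eul (single h 1) + b * eul2 (single h 1)"
    and K: "\<kappa> v1 v2 = (C, vfg x y)"
  shows "y = eul b \<and> b * (x + eul a - eul b - eul2 b) = 0"
proof -
  have E: "eul (single h c) = single 0 c * eul (single h 1)" "eul2 (single h c) = single 0 c * eul2 (single h 1)"
    for h and c :: "'p mod_ring"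
    by (simp_all add: eul_simps eul2_simps mult_single mult.commute)
  \<comment> \<open>The relations between group elements and vectors, extended to the whole group algebra.\<close>
  have R1: "in_FG r * A1 - A1 * in_FG r - in_FG (b * eul r) \<in> I" for r
  proof (induction r rule: poly_mapping_additive_induct)
    case (single h c)
    have "b * eul (single h c) = single 0 c * (b * eul (single h 1))"
      by (simp only: E[of h c] mult.left_commute)
    then have "in_FG (b * eul (single h c)) = cst c * in_FG (b * eul (single h 1))"
      by (simp only: in_FG_cst)
    then have "in_FG (single h c) * A1 - A1 * in_FG (single h c) - in_FG (b * eul (single h c)) =
      cst c * (in_G h * A1 - A1 * in_G h - in_FG (l1 h)) + (cst c * A1 - A1 * cst c) * in_G h"
      by (simp add: in_FG_single l1 algebra_simps)
    then show ?case using I_mult_right[OF G_A1] by (simp add: cst_commute)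
  next
    case (add r r')
    from I_add[OF add] show ?case by (simp add: eul_simps additive.add[OF additive_in_FG] algebra_simps)
  qed
  have R2: "in_FG r * A2 - A2 * in_FG r - A1 * in_FG (eul r) - in_FG (a * eul r + b * eul2 r) \<in> I" for r
  proof (induction r rule: poly_mapping_additive_induct)
    case (single h c)
    have "a * eul (single h c) + b * eul2 (single h c) = single 0 c * (a * eul (single h 1) + b * eul2 (single h 1))"
      by (simp only: E[of h c] mult.left_commute[of _ "single 0 c"] distrib_left)
    then have "in_FG (a * eul (single h c) + b * eul2 (single h c)) = cst c * in_FG (a * eul (single h 1) + b * eul2 (single h 1))"
      by (simp only: in_FG_cst)
    moreover have "in_FG (eul (single h c)) = cst c * (cst (ix h) * in_G h)"
      by (simp add: eul_simps in_FG_single mult_single mult.commute[of "ix h"] flip: mult.assoc)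
    ultimately have eq: "in_FG (single h c) * A2 - A2 * in_FG (single h c) - A1 * in_FG (eul (single h c))
        - in_FG (a * eul (single h c) + b * eul2 (single h c)) =
      cst c * (in_G h * A2 - A2 * in_G h - cst (ix h) * (A1 * in_G h) - in_FG (l2 h)) + (cst c * A2 - A2 * cst c) * in_G h
      + (cst c * (cst (ix h) * A1) - A1 * (cst c * cst (ix h))) * in_G h"
      by (simp add: in_FG_single l2 algebra_simps)
    have zero: "cst c * (cst (ix h) * A1) - A1 * (cst c * cst (ix h)) = 0"
      by (simp only: mult.assoc[symmetric] cst_mult) (simp only: mult.assoc cst_mult cst_commute[of _ A1] diff_self)
    have zero': "cst c * A2 - A2 * cst c = 0" by (simp only: cst_commute[of c A2] diff_self)
    show ?case unfolding eq zero zero' mult_zero_left add_0_right by (rule I_mult_left[OF G_A2])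
  next
    case (add r r')
    from I_add[OF add] show ?case by (simp add: eul_simps eul2_simps additive.add[OF additive_in_FG] algebra_simps)
  qed
  have R3: "A1 * A2 - A2 * A1 - in_FG C - A1 * in_FG x - A2 * in_FG y \<in> I"
    using rel_K[of v1 v2] by (simp add: in_V_v K in_VFG_vfg algebra_simps)
  let ?g = "gp 1 :: 'p FG"
  let ?G = "in_FG ?g"
  define D e f where "D = eul (b * ?g)" and "e = a * D + b * eul2 (b * ?g)" and "f = b * eul (a * ?g)"
  have eg: "eul ?g = ?g" "eul2 ?g = 0" by (simp_all add: eul_simps eul2_simps)
  note r1 = R1[of ?g, unfolded eg] and r2 = R2[of ?g, unfolded eg mult_zero_right add_0_right]
    and r1a = R1[of "a * ?g", folded f_def] and r2b = R2[of "b * ?g", folded D_def, folded e_def]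
  have E0: "in_FG (e + C * ?g - f - ?g * C - (b * ?g) * x - (a * ?g) * y)
      + A1 * in_FG (D + x * ?g - b * ?g - ?g * x - ?g * y) + A2 * in_FG (y * ?g - ?g * y) \<in> I"
    unfolding additive.add[OF additive_in_FG] additive.diff[OF additive_in_FG]
      overlap_identity[of _ _ _ _ _ _ A1 _ _ _ _ _ A2 _ ?G "in_FG C" "in_FG x" "in_FG y" "in_FG (a * ?g)"]
    by (intro I_add I_diff I_mult_left[OF R3] I_mult_right[OF R3] I_mult_left[OF r1] I_mult_right[OF r1]
        I_mult_left[OF r2] I_mult_right[OF r2] r1a r2b in_FG_mult I_mult_left[OF in_FG_mult])
  note * = embed_indep[OF E0]
  have gy: "?g * (eul b - y) = D + x * ?g - b * ?g - ?g * x - ?g * y"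
    unfolding D_def eul_mult eg by (simp only: algebra_simps)
  have "?g * (eul b - y) = 0" unfolding gy using * by blast
  from gp_1_cancel[OF this] have y: "y = eul b" by simp
  have gb: "?g * (b * (eul b + eul2 b - x - eul a)) = e + C * ?g - f - ?g * C - (b * ?g) * x - (a * ?g) * y"
    unfolding e_def f_def D_def eul_mult eul2_mult[OF odd] eg y
    by (simp only: algebra_simps mult_zero_right mult_zero_left add_0 add_0_right)
  have "?g * (b * (eul b + eul2 b - x - eul a)) = 0" unfolding gb using * by blast
  from gp_1_cancel[OF this] y show ?thesis by (simp add: algebra_simps)
qed

end

theorem drinfeld_orbifold_conditions:
  assumes odd: "odd CARD('p::prime_card)" and q: "q \<in> (drinfeld_orbifold :: ('p lam \<times> 'p kap) set)"
  obtains a b x C where "q = param a b x (eul b) C" "b * (x + eul a - eul b - eul2 b) = 0"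
proof -
  obtain L \<kappa> where q': "q = (L, \<kappa>)" "(L, \<kappa>) \<in> parameters" "PBW_deformation L \<kappa>"
    using q by (cases q) (auto simp: drinfeld_orbifold_def)
  interpret nf_basis L \<kappa>
    by unfold_locales (use lam_kap.PBW_iff_independent q'(3) in blast)
  obtain a b where ab: "\<And>h. L (single h 1) v1 = b * eul (single h 1)"
      "\<And>h. L (single h 1) v2 = a * eul (single h 1) + b * eul2 (single h 1)"
    by (rule lam_coordinates[OF odd]) blast
  obtain C u where "\<kappa> v1 v2 = (C, u)" by fastforce
  moreover obtain x y where "u = vfg x y" by (rule vfg_surj)
  ultimately have K: "\<kappa> v1 v2 = (C, vfg x y)" by simp
  from PBW_conditions[OF odd ab K] have cond: "y = eul b" "b * (x + eul a - eul b - eul2 b) = 0" by auto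
  have "q = param a b x y C" unfolding q'(1) by (rule parameters_eq_param[OF q'(2) ab K])
  with cond show ?thesis by (intro that[of a b x C]) simp_all
qed

section \<open>A coinduced module and sufficiency of the conditions\<close>

text \<open>
  A sequence \<open>f\<close> stands for the right linear functional on \<open>H\<close> with value \<open>f n k\<close> at \<open>v2\<^sup>n v1\<^sup>k\<close>, and
  \<open>H\<close> acts on the right by \<open>(f u) z = f (u z)\<close>. In particular \<open>v2\<close> acts by the shift of \<open>n\<close>.
\<close>

type_synonym 'p seq2 = "nat \<Rightarrow> nat \<Rightarrow> 'p FG"

definition shift :: "'p::prime_card seq2 \<Rightarrow> 'p seq2" where "shift f = (\<lambda>n. f (Suc n))"

locale orbifold_data =
  fixes a b x C :: "'p::prime_card FG"
  assumes odd: "odd CARD('p)" and cond: "b * (x + eul a - eul b - eul2 b) = 0"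
begin

definition d0 :: "'p FG \<Rightarrow> 'p FG" where "d0 r = a * eul r + b * eul2 r"

text \<open>
  The actions of \<open>r \<in> R\<close> and of \<open>v1\<close>. The recursion evaluates \<open>f (r v2 z)\<close> and \<open>f (v1 v2 z)\<close>, where
  \<open>r v2 = v2 r + v1 D r + d0 r\<close> and \<open>v1 v2 = v2 v1 + C + v1 x + v2 D b\<close>. At \<open>n = 0\<close> the value of
  \<open>f v1\<close> at \<open>v1\<^sup>k\<close> is taken to be \<open>f 0 (k + 1) + b D (f 0 k)\<close>. The extra term yields
  \<open>r v1 = v1 r + b D r\<close> while \<open>R\<close> acts by plain multiplication, and it vanishes for values in the
  prime field. The cut-off at \<open>n\<close> in the nested calls only serves termination: by \<open>op_local\<close> it does not
  change the value.
\<close>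

function opA :: "'p FG \<Rightarrow> 'p seq2 \<Rightarrow> 'p seq2" and opB :: "'p seq2 \<Rightarrow> 'p seq2" where
  "opA r f 0 = (\<lambda>k. r * f 0 k)"
| "opA r f (Suc n) = opA r (shift f) n + opA (eul r) (\<lambda>m. if m \<le> n then opB f m else 0) n + opA (d0 r) f n"
| "opB f 0 = (\<lambda>k. f 0 (Suc k) + b * eul (f 0 k))"
| "opB f (Suc n) = opB (shift f) n + opA C f n + opA x (\<lambda>m. if m \<le> n then opB f m else 0) n + opA (eul b) (shift f) n"
  by pat_completeness auto
termination
  by (relation "measure (\<lambda>p. case p of Inl (r, f, n) \<Rightarrow> n | Inr (f, n) \<Rightarrow> n)") auto

declare opA.simps [simp del] opB.simps [simp del]

lemma op_local:
  "(\<And>m. m \<le> n \<Longrightarrow> f m = f' m) \<Longrightarrow> opA r f n = opA r f' n \<and> opB f n = opB f' n"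
proof (induction n arbitrary: f f' r rule: less_induct)
  case (less n)
  show ?case
  proof (cases n)
    case 0
    then show ?thesis using less.prems by (simp add: opA.simps opB.simps)
  next
    case (Suc k)
    have sh: "opA r (shift f) k = opA r (shift f') k" "opB (shift f) k = opB (shift f') k" for r
      using less.IH[of k "shift f" "shift f'"] less.prems Suc by (auto simp: shift_def)
    have f: "opA r f k = opA r f' k" for r
      using less.IH[of k f f'] less.prems Suc by simp
    have "opB f m = opB f' m" if "m \<le> k" for m
      using less.IH[of m f f'] less.prems Suc that by simp
    then have "(\<lambda>m. if m \<le> k then opB f m else 0) = (\<lambda>m. if m \<le> k then opB f' m else 0)" by auto
    with sh f show ?thesis by (simp add: Suc opA.simps opB.simps)
  qed
qed

lemma opA_local: "(\<And>m. m \<le> n \<Longrightarrow> f m = f' m) \<Longrightarrow> opA r f n = opA r f' n"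
  using op_local by blast

lemma opA_Suc: "opA r f (Suc n) = opA r (shift f) n + opA (eul r) (opB f) n + opA (d0 r) f n"
  unfolding opA.simps using opA_local[of n "\<lambda>m. if m \<le> n then opB f m else 0" "opB f"] by simp

lemma opB_Suc: "opB f (Suc n) = opB (shift f) n + opA C f n + opA x (opB f) n + opA (eul b) (shift f) n"
  unfolding opB.simps using opA_local[of n "\<lambda>m. if m \<le> n then opB f m else 0" "opB f"] by simp

lemmas op_0 = opA.simps(1) opB.simps(1)

lemma d0_add: "d0 (r + s) = d0 r + d0 s"
  by (simp add: d0_def eul_simps eul2_simps algebra_simps)

lemma shift_add: "shift (f + g) = shift f + shift g"
  by (simp add: shift_def fun_eq_iff)

lemma op_additive:
  "opA r (f + g) n = opA r f n + opA r g n \<and> opA (r + s) f n = opA r f n + opA s f n \<and> opB (f + g) n = opB f n + opB g n"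
proof (induction n arbitrary: f g r s rule: less_induct)
  case (less n)
  show ?case
  proof (cases n)
    case 0
    then show ?thesis by (simp add: op_0 fun_eq_iff eul_simps algebra_simps)
  next
    case (Suc k)
    have IH: "opA r (f + g) m = opA r f m + opA r g m" "opA (r + s) f m = opA r f m + opA s f m"
      "opB (f + g) m = opB f m + opB g m" if "m \<le> k" for m r s f g
    proof -
      have "m < n" using that Suc by simp
      from less.IH[OF this] show "opA r (f + g) m = opA r f m + opA r g m" "opA (r + s) f m = opA r f m + opA s f m"
        "opB (f + g) m = opB f m + opB g m" by blast+
    qed
    have "opA r (opB (f + g)) k = opA r (opB f + opB g) k" for r
      by (rule opA_local) (simp only: IH plus_fun_apply)
    then have nested: "opA r (opB (f + g)) k = opA r (opB f) k + opA r (opB g) k" for r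
      by (simp only: IH order_refl)
    show ?thesis
      unfolding Suc opA_Suc opB_Suc shift_add eul_simps d0_add nested
      by (simp only: IH order_refl) (simp only: add_ac)
  qed
qed

lemma opA_add: "opA r (f + g) = opA r f + opA r g" and opA_add_left: "opA (r + s) f = opA r f + opA s f"
  and opB_add: "opB (f + g) = opB f + opB g"
  by (rule ext, simp add: op_additive)+

lemma additive_op: "additive (opA r)" "additive (\<lambda>r. opA r f)" "additive opB" "additive shift"
  by (simp_all add: additive_def opA_add opA_add_left opB_add shift_add)

lemma shift_opA: "shift (opA r f) = opA r (shift f) + opA (eul r) (opB f) + opA (d0 r) f"
  by (intro ext) (simp only: shift_def opA_Suc plus_fun_apply)

lemma shift_opB: "shift (opB f) = opB (shift f) + opA C f + opA x (opB f) + opA (eul b) (shift f)"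
  by (intro ext) (simp only: shift_def opB_Suc plus_fun_apply)

lemma d0_mult: "d0 (r * s) = r * d0 s + s * d0 r + eul r * (b * eul s)"
  by (simp add: d0_def eul_mult eul2_mult[OF odd] algebra_simps)

lemma eul_eul2: "eul (eul2 r) = eul2 (eul r)"
  by (rule poly_mapping_eqI) (simp add: eul_simps eul2_simps)

text \<open>
  The place where the condition on the data enters. The left-hand side minus the right-hand side is
  \<open>b m D r\<close>.
\<close>

lemma overlap: "b * eul (d0 r) + x * (b * eul r) + eul b * d0 r = d0 (b * eul r)"
proof -
  have e: "eul (eul r) = eul2 r + eul2 r + eul r" by (simp add: two_eul2[OF odd])
  have "b * eul (d0 r) + x * (b * eul r) + eul b * d0 r - d0 (b * eul r) = b * (x + eul a - eul b - eul2 b) * eul r"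
    by (simp add: d0_def eul_mult eul2_mult[OF odd] eul_eul2 e eul_simps eul2_simps algebra_simps)
  then show ?thesis by (simp add: cond)
qed

text \<open>
  Both relations are proved together for all functionals by induction on the index of evaluation. The
  second one at \<open>n + 1\<close> is the overlap \<open>r v1 v2\<close> and uses \<open>overlap\<close>.
\<close>

lemma op_relations:
  "opA r (opA s f) n = opA (r * s) f n \<and> opB (opA r f) n = opA r (opB f) n + opA (b * eul r) f n"
proof (induction n arbitrary: f r s rule: less_induct)
  case (less n)
  show ?case
  proof (cases n)
    case 0
    then show ?thesis by (simp add: op_0 fun_eq_iff eul_mult algebra_simps)
  next
    case (Suc k)
    have IH1: "opA r (opA s f) m = opA (r * s) f m" and IH2: "opB (opA r f) m = opA r (opB f) m + opA (b * eul r) f m"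
      if "m \<le> k" for m r s f
      using less.IH[of m r s f] that Suc by auto
    have swap: "opA s (opB (opA r f)) k = opA (s * r) (opB f) k + opA (s * (b * eul r)) f k" for r s
    proof -
      have "opA s (opB (opA r f)) k = opA s (opA r (opB f) + opA (b * eul r) f) k"
        by (rule opA_local) (simp add: IH2)
      then show ?thesis by (simp add: opA_add IH1)
    qed
    have "opA r (opA s f) (Suc k) =
        opA (r * s) (shift f) k + opA (r * eul s + eul r * s) (opB f) k + opA (r * d0 s + eul r * (b * eul s) + d0 r * s) f k"
      by (simp add: opA_Suc shift_opA opA_add IH1 swap opA_add_left add_ac)
    also have "\<dots> = opA (r * s) f (Suc k)"
      by (simp add: opA_Suc eul_mult d0_mult ac_simps)
    finally have 1: "opA r (opA s f) (Suc k) = opA (r * s) f (Suc k)" .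
    have "opB (opA r f) (Suc k) = opA r (opB (shift f)) k + opA (b * eul r) (shift f) k
        + opA (eul r) (opB (opB f)) k + opA (b * eul (eul r)) (opB f) k
        + opA (d0 r) (opB f) k + opA (b * eul (d0 r)) f k
        + opA (C * r) f k + opA (x * r) (opB f) k + opA (x * (b * eul r)) f k
        + opA (eul b * r) (shift f) k + opA (eul b * eul r) (opB f) k + opA (eul b * d0 r) f k"
      by (simp add: opB_Suc shift_opA opA_add opB_add IH1 IH2 swap add_ac)
    also have "\<dots> = (opA r (opB (shift f)) k + opA (r * C) f k + opA (r * x) (opB f) k + opA (r * eul b) (shift f) k)
        + opA (eul r) (opB (opB f)) k + opA (d0 r) (opB f) k
        + (opA (b * eul r) (shift f) k + opA (b * eul (eul r) + eul r * eul b) (opB f) k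
        + opA (b * eul (d0 r) + x * (b * eul r) + eul b * d0 r) f k)"
      by (simp add: opA_add_left ac_simps)
    also have "\<dots> = opA r (opB f) (Suc k) + opA (b * eul r) f (Suc k)"
      by (simp add: opA_Suc[of r "opB f"] opA_Suc[of "b * eul r"] shift_opB opA_add IH1 overlap eul_mult)
    finally show ?thesis using 1 by (simp add: Suc)
  qed
qed

lemma opA_opA: "opA r (opA s f) = opA (r * s) f" and opB_opA: "opB (opA r f) = opA r (opB f) + opA (b * eul r) f"
  by (rule ext, simp add: op_relations)+

lemma opA_0: "opA 0 f = 0" using additive.zero[OF additive_op(2)] .

lemma d0_const: "d0 (single 0 c) = 0"
  by (simp add: d0_def eul_simps eul2_simps)

lemma opA_1: "opA 1 f = f"
proof
  show "opA 1 f n = f n" for n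
  proof (induction n arbitrary: f)
    case (Suc n)
    then show ?case using d0_const[of 1] by (simp add: opA_Suc eul_simps opA_0 shift_def)
  qed (simp add: op_0)
qed

fun lop :: "'p cyc gen \<Rightarrow> 'p seq2 \<Rightarrow> 'p seq2" where
  "lop (Vgen i) f = (if i = 1 then opB f else shift f)"
| "lop (Ggen h) f = opA (single h 1) f"

lemma additive_lop: "additive (lop l)"
  by (cases l) (auto simp: additive_def opA_add opB_add shift_add)

lemma lop_const: "lop l (opA (single 0 c) f) = opA (single 0 c) (lop l f)"
  by (cases l) (auto simp: opB_opA shift_opA opA_opA d0_const eul_simps opA_0 mult.commute)

definition wop :: "'p cyc gen word \<Rightarrow> 'p seq2 \<Rightarrow> 'p seq2" where
  "wop w = fold lop (letters w)"

lemma wop_simps: "wop (u + w) f = wop w (wop u f)" "wop 0 f = f" "wop (Word [l]) f = lop l f"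
  by (simp_all add: wop_def plus_word_def zero_word_def)

lemma wop_const: "wop w (opA (single 0 c) f) = opA (single 0 c) (wop w f)"
proof -
  have "fold lop ls (opA (single 0 c) f) = opA (single 0 c) (fold lop ls f)" for ls
    by (induction ls arbitrary: f) (simp_all add: lop_const)
  then show ?thesis by (simp add: wop_def)
qed

lemma additive_wop: "additive (wop w)"
proof -
  have "additive (fold lop ls)" for ls
    by (induction ls) (simp_all add: additive_def additive.add[OF additive_lop])
  then show ?thesis by (simp add: wop_def)
qed

text \<open>
  The right action of the free algebra; letters of a word act from left to right.
\<close>

definition ev :: "'p free_alg \<Rightarrow> 'p seq2 \<Rightarrow> 'p seq2" where
  "ev u f = lin_ext (\<lambda>w c. opA (single 0 c) (wop w f)) u"

lemma additive_ev: "additive (\<lambda>u. ev u f)"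
  unfolding ev_def by (rule additive_lin_ext) (simp add: additive_def single_add opA_add_left)

lemma ev_single: "ev (single w c) f = opA (single 0 c) (wop w f)"
  by (simp add: ev_def opA_0)

lemma additive_ev': "additive (ev u)"
  by (rule additive.intro, rule additive_eqI[OF additive_ev additive_plus[OF additive_ev additive_ev]])
    (simp add: ev_single additive.add[OF additive_wop] opA_add)

lemma ev_mult: "ev (u * u') f = ev u' (ev u f)"
proof (rule biadditive_eqI[of "\<lambda>u u'. ev (u * u') f" "\<lambda>u u'. ev u' (ev u f)"])
  fix w w' :: "'p cyc gen word" and c c' :: "'p mod_ring"
  show "ev (single w c * single w' c') f = ev (single w' c') (ev (single w c) f)"
    by (simp add: mult_single[of w] ev_single wop_simps wop_const opA_opA mult_single[of 0 _ 0] mult.commute)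
qed (simp_all add: additive_def distrib_left distrib_right additive.add[OF additive_ev] additive.add[OF additive_ev'])

lemma ev_simps: "ev A1 f = opB f" "ev A2 f = shift f" "ev (in_G h) f = opA (single h 1) f" "ev (cst c) f = opA (single 0 c) f"
  "ev 1 f = f"
  using ev_single[of 0 1] by (simp_all add: ev_single wop_simps opA_1 in_G_def)

lemma ev_in_FG: "ev (in_FG r) f = opA r f"
  by (rule additive_eqI[OF additive_compose[OF additive_ev additive_in_FG] additive_op(2)])
    (simp add: in_FG_single ev_mult ev_simps opA_opA mult_single)

abbreviation "Lam \<equiv> lam_of a b"
abbreviation "Kap \<equiv> kap_of C x (eul b)"

definition ann :: "'p free_alg set" where "ann = {u. \<forall>f. ev u f = 0}"

lemma ann_closed:
  "0 \<in> ann" "u \<in> ann \<Longrightarrow> v \<in> ann \<Longrightarrow> u - v \<in> ann" "u \<in> ann \<Longrightarrow> v \<in> ann \<Longrightarrow> u + v \<in> ann"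
  "u \<in> ann \<Longrightarrow> w * u \<in> ann" "u \<in> ann \<Longrightarrow> u * w \<in> ann"
  by (simp_all add: ann_def additive.zero[OF additive_ev] additive.diff[OF additive_ev] additive.add[OF additive_ev]
     ev_mult additive.zero[OF additive_ev'])

lemma ann_G_V: "in_G h * in_V v - in_V (act h v) * in_G h - in_FG (Lam (single h 1) v) \<in> ann"
proof -
  have 1: "in_G h * A1 - A1 * in_G h - in_FG (b * eul (single h 1)) \<in> ann"
    by (simp add: ann_def additive.diff[OF additive_ev] ev_mult ev_simps ev_in_FG opB_opA)
  have 2: "in_G h * A2 - A2 * in_G h - cst (ix h) * (A1 * in_G h) - in_FG (d0 (single h 1)) \<in> ann"
    by (simp add: ann_def additive.diff[OF additive_ev] ev_mult ev_simps ev_in_FG shift_opA opB_opA opA_opA opA_add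
        eul_simps mult_single opA_0)
  have act: "act h v = (v $ 1 + v $ 2 * ix h) *s v1 + (v $ 2) *s v2"
  proof -
    have "act h v = (v $ 1) *s act h v1 + (v $ 2) *s act h v2"
      by (subst (1) V_decompose) (simp add: act_def matrix_vector_right_distrib vector_scalar_commute)
    then show ?thesis unfolding act_v1 act_v2 by (simp add: vec_eq_iff forall_2 axis_def)
  qed
  have V: "in_V (act h v) = cst (v $ 1) * A1 + cst (v $ 2) * (cst (ix h) * A1) + cst (v $ 2) * A2"
    unfolding act in_V_eq by (simp add: axis_def single_add distrib_right cst_mult flip: mult.assoc del: mult_single)
  have L: "in_FG (Lam (single h 1) v) = cst (v $ 1) * in_FG (b * eul (single h 1)) + cst (v $ 2) * in_FG (d0 (single h 1))"
    by (simp only: lam_of_def additive.add[OF additive_in_FG] in_FG_cst flip: d0_def)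
  have "in_G h * in_V v - in_V (act h v) * in_G h - in_FG (Lam (single h 1) v) =
    cst (v $ 1) * (in_G h * A1 - A1 * in_G h - in_FG (b * eul (single h 1)))
    + cst (v $ 2) * (in_G h * A2 - A2 * in_G h - cst (ix h) * (A1 * in_G h) - in_FG (d0 (single h 1)))"
    unfolding V L in_V_eq[of v] by (simp only: algebra_simps cst_left_commute[of "in_G h"])
  then show ?thesis using 1 2 by (simp only: ann_closed)
qed

lemma ann_V_V: "in_V v * in_V w - in_V w * in_V v - (in_FG (fst (Kap v w)) + in_VFG (snd (Kap v w))) \<in> ann"
proof -
  let ?E = "A1 * A2 - A2 * A1 - in_FG C - A1 * in_FG x - A2 * in_FG (eul b)"
  let ?d = "v $ 1 * w $ 2 - v $ 2 * w $ 1"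
  have E: "?E \<in> ann"
    by (simp add: ann_def additive.diff[OF additive_ev] ev_mult ev_simps ev_in_FG shift_opB)
  have "snd (Kap v w) = vfg (single 0 ?d * x) (single 0 ?d * eul b)"
    unfolding kap_of_def scale_sum_def
    by (rule poly_mapping_eqI) (simp add: lookup_scale_VFG lookup_vfg lookup_const_mult vec.scale_right_distrib)
  then have snd: "in_VFG (snd (Kap v w)) = cst ?d * (A1 * in_FG x) + cst ?d * (A2 * in_FG (eul b))"
    by (simp only: in_VFG_vfg in_FG_cst cst_left_commute)
  have fst: "in_FG (fst (Kap v w)) = cst ?d * in_FG C"
    by (simp add: kap_of_def scale_sum_def scale_FG_eq in_FG_cst)
  have c: "cst p * X * (cst q * Y) = cst (p * q) * (X * Y)" for p q and X Y :: "'p free_alg"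
    by (simp only: mult.assoc cst_left_commute[of X] cst_mult[symmetric])
  have "cst ?d = cst (v $ 1 * w $ 2) - cst (v $ 2 * w $ 1)" by (simp add: single_diff)
  then have "in_V v * in_V w - in_V w * in_V v = cst ?d * (A1 * A2 - A2 * A1)"
    unfolding in_V_eq distrib_left distrib_right c
    by (simp add: left_diff_distrib right_diff_distrib mult.commute[of "w $ _"])
  then have "in_V v * in_V w - in_V w * in_V v - (in_FG (fst (Kap v w)) + in_VFG (snd (Kap v w))) = cst ?d * ?E"
    by (simp only: fst snd) (simp only: algebra_simps)
  then show ?thesis using E by (simp only: ann_closed)
qed

sublocale lam_kap Lam Kap .

lemma I_ann: "I \<subseteq> ann"
proof (rule I_subset)
  show "relations Lam Kap \<subseteq> ann"
  proof
    fix u assume "u \<in> relations Lam Kap"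
    then consider (G) h h' where "u = in_G h * in_G h' - in_G (h + h')" | (one) "u = in_G 0 - 1"
      | (L) h v where "u = in_G h * in_V v - in_V (act h v) * in_G h - in_FG (Lam (single h 1) v)"
      | (K) v w where "u = in_V v * in_V w - in_V w * in_V v - (in_FG (fst (Kap v w)) + in_VFG (snd (Kap v w)))"
      unfolding relations_def by blast
    then show "u \<in> ann"
    proof cases
      case G
      then show ?thesis
        by (simp add: ann_def additive.diff[OF additive_ev] ev_mult ev_simps opA_opA mult_single add.commute)
    next
      case one
      then show ?thesis by (simp add: ann_def additive.diff[OF additive_ev] ev_simps opA_1)
    next
      case L
      then show ?thesis using ann_G_V by simp
    next
      case K
      then show ?thesis using ann_V_V by simp
    qed
  qed
qed (rule ann_closed; assumption)+

text \<open>
  The functional that is \<open>1\<close> at \<open>v2\<^sup>j v1\<^sup>i\<close> and \<open>0\<close> at all other such monomials has values in the prime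
  field, on which \<open>D\<close> vanishes, so powers of \<open>v1\<close> act on it by shifting \<open>k\<close>. It reads off
  the coefficients of \<open>v2\<^sup>j v1\<^sup>i h\<close> for all \<open>h\<close> at once.
\<close>

lemma nf_independent:
  assumes "nf z \<in> I" shows "z = 0"
proof (rule poly_mapping_eqI, rule poly_mapping_eqI)
  fix h0 and m0 :: "2 \<Rightarrow>\<^sub>0 nat"
  define f :: "'p seq2" where "f n k = (if n = lookup m0 2 \<and> k = lookup m0 1 then 1 else 0)" for n k
  have shift_pow: "(shift ^^ j) g n = g (n + j)" for j n and g :: "'p seq2"
    by (induction j arbitrary: n) (simp_all add: shift_def)
  have opB_pow: "(opB ^^ i) g 0 k = g 0 (k + i)" if "\<And>k. eul (g 0 k) = 0" for i k g
    by (induction i arbitrary: k) (simp_all add: op_0 that)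
  have wop: "wop (nf_word m h) f 0 0 = (if m = m0 then single h 1 else 0)" for m h
  proof -
    have fold_rep: "fold lop (replicate j l) = lop l ^^ j" for j l
      by (induction j) (simp_all add: funpow_swap1 fun_eq_iff)
    have "lop (Vgen 1) = opB" "lop (Vgen 2) = shift" by (simp_all add: fun_eq_iff)
    then have "wop (nf_word m h) f = opA (single h 1) ((opB ^^ lookup m 1) ((shift ^^ lookup m 2) f))"
      by (simp add: wop_def nf_word_def fold_rep)
    moreover have "(opB ^^ lookup m 1) ((shift ^^ lookup m 2) f) 0 0 = f (lookup m 2) (lookup m 1)"
      by (subst opB_pow) (simp_all add: shift_pow f_def eul_simps)
    moreover have "f (lookup m 2) (lookup m 1) = (if m = m0 then 1 else 0)"
      using exp2_eqI[of m m0] by (auto simp: f_def)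
    ultimately show ?thesis by (simp add: op_0)
  qed
  have add: "additive (\<lambda>u. ev u f 0 0)"
    by (simp add: additive_def additive.add[OF additive_ev])
  have look: "lookup (ev (nf y) f 0 0) h0 = lookup (lookup y h0) m0" for y
  proof (rule additive_eqI[of "\<lambda>y. lookup (ev (nf y) f 0 0) h0" "\<lambda>y. lookup (lookup y h0) m0"])
    fix h and s :: "'p SV"
    show "lookup (ev (nf (single h s)) f 0 0) h0 = lookup (lookup (single h s) h0) m0"
    proof (rule additive_eqI[of "\<lambda>s. lookup (ev (nf (single h s)) f 0 0) h0" "\<lambda>s. lookup (lookup (single h s) h0) m0"])
      fix m c
      show "lookup (ev (nf (single h (single m c))) f 0 0) h0 = lookup (lookup (single h (single m c)) h0) m0"
        by (simp add: nf_single ev_single op_0 wop mult_single lookup_single when_def)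
    qed (simp_all add: additive_def single_add lookup_add additive.add[OF additive_nf] additive.add[OF additive_ev])
  qed (simp_all add: additive_def lookup_add additive.add[OF additive_nf] additive.add[OF additive_ev])
  have "ev (nf z) f = 0" using assms I_ann by (auto simp: ann_def)
  then show "lookup (lookup z h0) m0 = lookup (lookup 0 h0) m0" using look[of z] by simp
qed

lemma PBW_param: "PBW_deformation Lam Kap"
  using PBW_iff_independent nf_independent by blast

end

theorem param_drinfeld_orbifold:
  assumes "odd CARD('p::prime_card)" "b * (x + eul a - eul b - eul2 b) = (0 :: 'p FG)"
  shows "param a b x (eul b) C \<in> drinfeld_orbifold"
proof -
  interpret orbifold_data a b x C by unfold_locales (fact assms)+
  show ?thesis
    using PBW_param param_in_parameters[of a b x "eul b" C] by (simp add: drinfeld_orbifold_def param_def)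
qed

section \<open>The explicit family\<close>

lemma eul_gp: "eul (gp i) = of_nat i * gp i"
  by (simp add: eul_simps mult_single flip: single_of_nat)

lemma of_nat_choose_two:
  assumes "odd CARD('p)"
  shows "of_nat (i choose 2) = (of_nat i * (of_nat i - 1) / 2 :: 'p::prime_card mod_ring)"
proof -
  have "of_nat (i choose 2) * (2 :: 'p mod_ring) = of_nat i * (of_nat i - 1)"
  proof (cases i)
    case (Suc n)
    have "(i choose 2) * 2 = i * n" unfolding choose_two Suc by (simp add: algebra_simps)
    from arg_cong[OF this, of "of_nat :: nat \<Rightarrow> 'p mod_ring"] show ?thesis by (simp add: Suc algebra_simps)
  qed (simp add: binomial_eq_0)
  then show ?thesis using two_neq_0[OF assms] by (simp add: eq_divide_eq)
qed

lemma mult_gp: "r * gp i = (\<Sum>j<CARD('p). single (gpow (i + j)) (gcoeff r j))" for r :: "'p::prime_card FG"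
  by (subst FG_eq_sum[of r]) (simp add: sum_distrib_right mult_single gpow_add add.commute)

text \<open>
  The data of the pair that the explicit formulas describe. Here \<open>j\<^sup>p\<^sup>-\<^sup>2\<close> is the inverse of \<open>j\<close>,
  and \<open>0\<close> for \<open>j = 0\<close>.
\<close>

definition fam_x :: "'p::prime_card mod_ring list \<Rightarrow> 'p FG" where
  "fam_x d = single 0 (\<Sum>l=1..length d. (-1) ^ (l + 1) * d ! (l - 1))"

definition fam_a :: "'p::prime_card FG \<Rightarrow> 'p mod_ring list \<Rightarrow> 'p FG" where
  "fam_a b d = (\<Sum>j<CARD('p). single (gpow j)
     (of_nat j ^ (CARD('p) - 2) * of_nat ((j + 1) choose 2) * gcoeff b j + of_nat j ^ (CARD('p) - 2) * mu d j))"

lemma gcoeff_sum: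
  assumes "j < CARD('p)"
  shows "gcoeff (\<Sum>i<CARD('p). single (gpow i) (c i)) j = (c j :: 'p::prime_card mod_ring)"
proof -
  have "gcoeff (\<Sum>i<CARD('p). single (gpow i) (c i)) j = (\<Sum>i<CARD('p). if i = j then c i else 0)"
    unfolding lookup_sum using assms by (intro sum.cong) (auto simp: lookup_single when_def gpow_eq_less)
  then show ?thesis using assms by simp
qed

lemma vfg_sum: "(\<Sum>j<CARD('p). single (gpow j) (gcoeff r j *s v1)) = vfg r 0"
  "(\<Sum>j<CARD('p). single (gpow j) (gcoeff r j *s v2)) = vfg 0 (r :: 'p::prime_card FG)"
proof -
  have *: "(\<Sum>j<CARD('p). single (gpow j) (gcoeff r j *s v)) = lin_ext (\<lambda>h c. single h (c *s v)) r" for v :: "'p V"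
    by (subst (2) FG_eq_sum[of r]) (simp add: additive.sum[OF additive_vfg_aux])
  show "(\<Sum>j<CARD('p). single (gpow j) (gcoeff r j *s v1)) = vfg r 0"
    "(\<Sum>j<CARD('p). single (gpow j) (gcoeff r j *s v2)) = vfg 0 r"
    unfolding * by (simp_all add: vfg_def additive.zero[OF additive_vfg_aux])
qed

lemma family_values:
  assumes odd: "odd CARD('p::prime_card)"
  shows "lam_of (fam_a b d) b (gp i) v1 = of_nat i * b * gp i"
    and "lam_of (fam_a b d) b (gp i) v2 =
          (\<Sum>j<CARD('p). single (gpow (i + j))
             ((of_nat (i choose 2) + of_nat i * of_nat j ^ (CARD('p) - 2) * of_nat ((j + 1) choose 2))
                * gcoeff b j)) +
          of_nat i * (\<Sum>j<CARD('p). single (gpow (i + j)) (of_nat j ^ (CARD('p) - 2) * mu d j))" (is "_ = ?R")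
    and "kap_of C (fam_x d) (eul b) v1 v2 = (C,
        single 0 ((\<Sum>l=1..length d. (-1) ^ (l + 1) * d ! (l - 1)) *s v1) +
        (\<Sum>j<CARD('p). single (gpow j) ((of_nat j * gcoeff b j) *s (v2 :: 'p V))))" (is "_ = ?K")
proof -
  show "lam_of (fam_a b d) b (gp i) v1 = of_nat i * b * gp i"
    by (simp add: lam_of_v eul_gp ac_simps)
  have "eul2 (gp i) = single 0 (of_nat (i choose 2)) * (gp i :: 'p FG)"
    by (simp add: eul2_simps of_nat_choose_two[OF odd] mult_single)
  then have "lam_of (fam_a b d) b (gp i) v2 =
      single 0 (of_nat i) * (fam_a b d * gp i) + single 0 (of_nat (i choose 2)) * (b * gp i)"
    by (simp add: lam_of_v eul_gp ac_simps)
  also have "\<dots> = (\<Sum>j<CARD('p). single (gpow (i + j)) (of_nat i * (of_nat j ^ (CARD('p) - 2) * of_nat ((j + 1) choose 2) * gcoeff b j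
        + of_nat j ^ (CARD('p) - 2) * mu d j)))
      + (\<Sum>j<CARD('p). single (gpow (i + j)) (of_nat (i choose 2) * gcoeff b j))"
    unfolding mult_gp sum_distrib_left
    by (intro arg_cong2[where f = "(+)"] sum.cong refl) (simp_all add: mult_single fam_a_def gcoeff_sum del: single_of_nat)
  also have "\<dots> = (\<Sum>j<CARD('p). single (gpow (i + j))
             ((of_nat (i choose 2) + of_nat i * of_nat j ^ (CARD('p) - 2) * of_nat ((j + 1) choose 2)) * gcoeff b j)) +
          (\<Sum>j<CARD('p). single (gpow (i + j)) (of_nat i * (of_nat j ^ (CARD('p) - 2) * mu d j)))"
    unfolding sum.distrib[symmetric] single_add[symmetric]
    by (intro sum.cong refl arg_cong[where f = "single _"]) (simp add: algebra_simps)
  also have "(\<Sum>j<CARD('p). single (gpow (i + j)) (of_nat i * (of_nat j ^ (CARD('p) - 2) * mu d j))) =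
      of_nat i * (\<Sum>j<CARD('p). single (gpow (i + j)) (of_nat j ^ (CARD('p) - 2) * mu d j))"
    unfolding sum_distrib_left by (simp add: mult_single flip: single_of_nat)
  finally show "lam_of (fam_a b d) b (gp i) v2 = ?R" .
  have "vfg (fam_x d) (eul b) = vfg (fam_x d) 0 + vfg 0 (eul b)" by (simp flip: vfg_add)
  moreover have "vfg (fam_x d) 0 = single 0 ((\<Sum>l=1..length d. (-1) ^ (l + 1) * d ! (l - 1)) *s v1)"
    by (simp add: vfg_def fam_x_def additive.zero[OF additive_vfg_aux] del: One_nat_def)
  moreover have "vfg 0 (eul b) = (\<Sum>j<CARD('p). single (gpow j) ((of_nat j * gcoeff b j) *s v2))"
    by (simp add: vfg_sum(2)[symmetric] eul_simps)
  ultimately show "kap_of C (fam_x d) (eul b) v1 v2 = ?K"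
    by (simp only: kap_of_v)
qed

lemma family_iff:
  assumes odd: "odd CARD('p::prime_card)"
  shows "family b d C q \<longleftrightarrow> q = param (fam_a b d) b (fam_x d) (eul b) (C :: 'p FG)"
proof
  assume fam: "family b d C q"
  obtain L \<kappa> where q: "q = (L, \<kappa>)" by fastforce
  from fam have par: "bilinear_lam L" "alternating_kap \<kappa>" by (auto simp: family_def q parameters_def)
  have "L = lam_of (fam_a b d) b"
    by (rule lam_eqI_gp[OF par(1) bilinear_lam_of]; unfold family_values[OF odd]; use fam in \<open>simp add: family_def q\<close>)
  moreover have "\<kappa> = kap_of C (fam_x d) (eul b)"
    by (rule kap_eqI[OF par(2) alternating_kap_of]; unfold family_values[OF odd]; use fam in \<open>simp add: family_def q\<close>)
  ultimately show "q = param (fam_a b d) b (fam_x d) (eul b) C" by (simp add: q param_def)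
next
  assume "q = param (fam_a b d) b (fam_x d) (eul b) C"
  then show "family b d C q"
    using param_in_parameters[of "fam_a b d" b "fam_x d" "eul b" C]
    unfolding family_def param_def by (auto simp only: family_values[OF odd] prod.case)
qed

text \<open>
  At \<open>g\<^sup>0\<close> only \<open>x\<close> contributes, and all powers of \<open>1 - g\<^sup>-\<^sup>1\<close> have coefficient \<open>1\<close>. At \<open>g\<^sup>j\<close> with
  \<open>j \<noteq> 0\<close> the derivation cancels the inverse of \<open>j\<close>, the terms with \<open>b\<close> cancel because
  \<open>j + (j choose 2) = (j + 1 choose 2)\<close>, and \<open>mu d j\<close> remains.
\<close>

lemma fam_invariant:
  assumes odd: "odd CARD('p::prime_card)"
  shows "fam_x d + eul (fam_a b d) - eul b - eul2 b = (s_comb d :: 'p FG)"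
proof (rule FG_eqI)
  fix j assume j: "j < CARD('p)"
  let ?F = "\<lambda>l. (-1) ^ (l + 1) * d ! (l - 1) :: 'p mod_ring"
  have rhs: "gcoeff (s_comb d) j = (\<Sum>l=1..length d. ?F l *
      (if j = 0 then 1 else (-1) ^ (CARD('p) - j) * of_nat ((CARD('p) - l) choose (CARD('p) - j))))"
    unfolding s_comb_def lookup_sum lookup_const_mult
    by (rule sum.cong[OF refl], subst gcoeff_s_power) (auto simp: j)
  show "gcoeff (fam_x d + eul (fam_a b d) - eul b - eul2 b) j = gcoeff (s_comb d) j"
  proof (cases "j = 0")
    case True
    then show ?thesis unfolding rhs by (simp add: lookup_add lookup_minus eul_simps eul2_simps fam_x_def del: One_nat_def)
  next
    case False
    have "(of_nat j :: 'p mod_ring) \<noteq> 0"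
      using of_nat_0_mod_ring_dvd[of j, where 'a = 'p] False j by (meson dvd_imp_le neq0_conv not_le)
    moreover have "(of_nat j :: 'p mod_ring) * (of_nat j * of_nat j ^ (CARD('p) - 2)) = of_nat j"
    proof -
      have "2 \<le> CARD('p)" using prime_card[where 'a = 'p] by (simp add: prime_ge_2_nat)
      then have "CARD('p) = Suc (Suc (CARD('p) - 2))" by simp
      then show ?thesis using mod_ring_power_card[of "of_nat j :: 'p mod_ring"] by (metis power_Suc)
    qed
    ultimately have inv: "of_nat j * of_nat j ^ (CARD('p) - 2) = (1 :: 'p mod_ring)" by simp
    have tri: "of_nat ((j + 1) choose 2) = of_nat j + of_nat j * (of_nat j - 1) / (2 :: 'p mod_ring)"
    proof -
      have "of_nat j + of_nat j * (of_nat j - 1) / (2 :: 'p mod_ring) = (of_nat j * 2 + of_nat j * (of_nat j - 1)) / 2"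
        by (simp only: add_divide_distrib nonzero_mult_div_cancel_right[OF two_neq_0[OF odd]])
      moreover have "of_nat (j + 1) * (of_nat (j + 1) - 1) = of_nat j * 2 + of_nat j * (of_nat j - 1 :: 'p mod_ring)"
        by (simp add: algebra_simps)
      ultimately show ?thesis by (simp only: of_nat_choose_two[OF odd])
    qed
    have "h = gpow j \<Longrightarrow> h \<noteq> 0" for h :: "'p cyc"
      using gpow_eq_less[of j 0, where 'p = 'p] j False by auto
    then have x: "gcoeff (fam_x d) j = 0" by (simp add: fam_x_def lookup_single when_def)
    have "gcoeff (eul (fam_a b d)) j = (of_nat j * of_nat j ^ (CARD('p) - 2)) * of_nat ((j + 1) choose 2) * gcoeff b j
        + (of_nat j * of_nat j ^ (CARD('p) - 2)) * mu d j"
      by (simp add: eul_simps fam_a_def gcoeff_sum[OF j] distrib_left mult.assoc)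
    then have "gcoeff (fam_x d + eul (fam_a b d) - eul b - eul2 b) j = mu d j"
      unfolding inv tri by (simp add: lookup_add lookup_minus x eul_simps(7) eul2_simps(7) algebra_simps)
    also have "\<dots> = gcoeff (s_comb d) j"
      unfolding rhs mu_def sum_distrib_left using False by (intro sum.cong refl) (simp add: ac_simps)
    finally show ?thesis .
  qed
qed

section \<open>Coboundaries and the count\<close>

text \<open>
  A coboundary is itself a pair in coordinates, so adding one translates \<open>a\<close> and \<open>x\<close>.
\<close>

lemma is_coboundary_iff:
  "is_coboundary f q \<longleftrightarrow> q = param (- f v1) 0 (eul (f v1)) 0 0" for q :: "'p::prime_card lam \<times> 'p kap"
proof -
  obtain L \<kappa> where q: "q = (L, \<kappa>)" by fastforce
  have v: "lam_of (- f v1) 0 (gp i) v1 = 0" "lam_of (- f v1) 0 (gp i) v2 = - (of_nat i * f v1 * gp i)"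
    "kap_of 0 (eul (f v1)) 0 v1 v2 = (0, \<Sum>j<CARD('p). single (gpow j) ((of_nat j * gcoeff (f v1) j) *s v1))" for i
    by (simp_all add: lam_of_v eul_gp kap_of_v vfg_sum(1)[symmetric] eul_simps(7) ac_simps)
  show ?thesis
  proof
    assume cob: "is_coboundary f q"
    then have par: "bilinear_lam L" "alternating_kap \<kappa>" by (auto simp: is_coboundary_def q parameters_def)
    have "L = lam_of (- f v1) 0"
      by (rule lam_eqI_gp[OF par(1) bilinear_lam_of]; unfold v; use cob in \<open>simp add: is_coboundary_def q\<close>)
    moreover have "\<kappa> = kap_of 0 (eul (f v1)) 0"
      by (rule kap_eqI[OF par(2) alternating_kap_of]; unfold v; use cob in \<open>simp add: is_coboundary_def q\<close>)
    ultimately show "q = param (- f v1) 0 (eul (f v1)) 0 0" by (simp add: q param_def)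
  next
    assume "q = param (- f v1) 0 (eul (f v1)) 0 0"
    then show "is_coboundary f q"
      using param_in_parameters[of "- f v1" 0 "eul (f v1)" 0 0]
      unfolding is_coboundary_def param_def by (auto simp only: v prod.case)
  qed
qed

lemma lam_of_add: "lam_of (a + a') (b + b') r v = lam_of a b r v + lam_of a' b' r v"
  by (simp add: lam_of_def algebra_simps)

lemma kap_of_add: "kap_of (C + C') (x + x') (y + y') v w = kap_of C x y v w + kap_of C' x' y' v w"
proof -
  interpret S: vector_space "scale_sum :: 'a mod_ring \<Rightarrow> _" by (rule vector_space_scale_sum)
  show ?thesis by (simp add: kap_of_def vfg_add flip: S.scale_right_distrib)
qed

lemma coboundary_rel_iff:
  "(param a b x y C, q) \<in> coboundary_rel \<longleftrightarrow> (\<exists>F. q = param (a - F) b (x + eul F) y C)"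
  for q :: "'p::prime_card lam \<times> 'p kap"
proof
  assume rel: "(param a b x y C, q) \<in> coboundary_rel"
  obtain L \<kappa> where q: "q = (L, \<kappa>)" by fastforce
  from rel obtain f Lf \<kappa>f where f: "is_coboundary f (Lf, \<kappa>f)"
    and L: "\<And>r v. L r v = lam_of a b r v + Lf r v" and K: "\<And>v w. \<kappa> v w = kap_of C x y v w + \<kappa>f v w"
    unfolding coboundary_rel_def q param_def by auto
  from f have "Lf = lam_of (- f v1) 0" "\<kappa>f = kap_of 0 (eul (f v1)) 0"
    by (simp_all add: is_coboundary_iff param_def)
  then have "L = lam_of (a - f v1) b" "\<kappa> = kap_of C (x + eul (f v1)) y"
    using L K lam_of_add[of a "- f v1" b 0] kap_of_add[of C 0 x "eul (f v1)" y 0] by (auto simp: fun_eq_iff)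
  then have "q = param (a - f v1) b (x + eul (f v1)) y C" by (simp add: q param_def)
  then show "\<exists>F. q = param (a - F) b (x + eul F) y C" ..
next
  assume "\<exists>F. q = param (a - F) b (x + eul F) y C"
  then obtain F where q: "q = param (a - F) b (x + eul F) y C" ..
  define f :: "'p V \<Rightarrow> 'p FG" where "f v = single 0 (v $ 1) * F" for v
  have f1: "f v1 = F" by (simp add: f_def axis_def)
  have lin: "Vector_Spaces.linear (*s) scale_FG f"
    unfolding Vector_Spaces.linear_iff
    using vector_space_scale_FG vec.vector_space_axioms
    by (auto simp: f_def scale_FG_eq single_add distrib_right mult_single simp flip: mult.assoc)
  have cob: "is_coboundary f (lam_of (- F) 0, kap_of 0 (eul F) 0)"
    by (simp add: is_coboundary_iff f1 param_def)
  have "lam_of (a - F) b r v = lam_of a b r v + lam_of (- F) 0 r v" for r v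
    using lam_of_add[of a "- F" b 0] by simp
  moreover have "kap_of C (x + eul F) y v w = kap_of C x y v w + kap_of 0 (eul F) 0 v w" for v w
    using kap_of_add[of C 0 x "eul F" y 0] by simp
  ultimately show "(param a b x y C, q) \<in> coboundary_rel"
    using lin cob param_in_parameters[of a b x y C] param_in_parameters[of "a - F" b "x + eul F" y C]
    unfolding coboundary_rel_def q param_def by auto
qed

lemma coboundary_class:
  "coboundary_rel `` {param a b x y C} = range (\<lambda>F. param (a - F) b (x + eul F) y C)"
  for a :: "'p::prime_card FG"
  by (auto simp: coboundary_rel_iff)

text \<open>
  Each class has exactly one member with \<open>a = 0\<close>, which is labelled by \<open>((b, m), C)\<close>.
\<close>

lemma card_coboundary_classes:
  assumes odd: "odd CARD('p::prime_card)"
  shows "card ((drinfeld_orbifold :: ('p lam \<times> 'p kap) set) // coboundary_rel) = CARD('p) ^ (2 * CARD('p) + 1)"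
proof -
  define T where "T = {(b, m). b * m = (0 :: 'p FG)} \<times> (UNIV :: 'p FG set)"
  define cl where "cl = (\<lambda>((b, m), C). coboundary_rel `` {param 0 b (m + eul b + eul2 b) (eul b) C} :: ('p lam \<times> 'p kap) set)"
  have "inj_on cl T"
  proof (rule inj_onI)
    fix s t assume st: "cl s = cl t"
    obtain b m C where s: "s = ((b, m), C)" by (cases s) auto
    obtain b' m' C' where t: "t = ((b', m'), C')" by (cases t) auto
    have eq: "cl ((b, m), C) = cl ((b', m'), C')" using st by (simp only: s t)
    have "param (0 - 0) b (m + eul b + eul2 b + eul 0) (eul b) C \<in> cl ((b, m), C)"
      unfolding cl_def prod.case coboundary_class by (rule rangeI)
    then obtain F where "param (0 - 0) b (m + eul b + eul2 b + eul 0) (eul b) C =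
        param (0 - F) b' (m' + eul b' + eul2 b' + eul F) (eul b') C'"
      unfolding eq unfolding cl_def prod.case coboundary_class by blast
    then have "F = 0" "b = b'" "m + eul b + eul2 b = m' + eul b' + eul2 b' + eul F" "C = C'"
      by (auto simp: param_inj eul_simps)
    then show "s = t" by (simp add: s t eul_simps)
  qed
  moreover have "cl ` T = (drinfeld_orbifold :: ('p lam \<times> 'p kap) set) // coboundary_rel"
  proof (intro equalityI subsetI)
    fix X assume "X \<in> cl ` T"
    then obtain b m C where bm: "b * m = 0" and X: "X = cl ((b, m), C)" by (auto simp: T_def)
    have "param 0 b (m + eul b + eul2 b) (eul b) C \<in> drinfeld_orbifold"
      using bm by (intro param_drinfeld_orbifold[OF odd]) (simp add: eul_simps)
    then show "X \<in> drinfeld_orbifold // coboundary_rel" unfolding X cl_def prod.case by (rule quotientI)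
  next
    fix X assume "X \<in> (drinfeld_orbifold :: ('p lam \<times> 'p kap) set) // coboundary_rel"
    then obtain q where q: "q \<in> drinfeld_orbifold" and X: "X = coboundary_rel `` {q}" by (auto simp: quotient_def)
    obtain a b x C where abx: "q = param a b x (eul b) C" "b * (x + eul a - eul b - eul2 b) = 0"
      by (rule drinfeld_orbifold_conditions[OF odd q])
    let ?P = "\<lambda>F. param (a - F) b (x + eul F) (eul b) C" and ?Q = "\<lambda>F. param (0 - F) b (x + eul a + eul F) (eul b) C"
    have PQ: "?P F = ?Q (F - a)" and QP: "?Q F = ?P (F + a)" for F by (simp_all add: eul_simps add_ac)
    have "range ?P \<subseteq> range ?Q" by (rule image_subsetI, subst PQ, rule rangeI)
    moreover have "range ?Q \<subseteq> range ?P" by (rule image_subsetI, subst QP, rule rangeI)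
    ultimately have "range ?P = range ?Q" by (rule subset_antisym)
    then have "X = cl ((b, x + eul a - eul b - eul2 b), C)"
      unfolding X abx(1) cl_def prod.case coboundary_class by simp
    moreover have "((b, x + eul a - eul b - eul2 b), C) \<in> T" using abx(2) by (simp add: T_def)
    ultimately show "X \<in> cl ` T" by blast
  qed
  ultimately have "card ((drinfeld_orbifold :: ('p lam \<times> 'p kap) set) // coboundary_rel) = card T"
    by (metis card_image)
  also have "\<dots> = CARD('p) ^ (CARD('p) + 1) * CARD('p) ^ CARD('p)"
    unfolding T_def card_cartesian_product card_annihilating_pairs card_FG ..
  also have "\<dots> = CARD('p) ^ (2 * CARD('p) + 1)" by (simp add: mult_2 flip: power_add)
  finally show ?thesis .
qed

text \<open>
  For a given pair with invariant \<open>m\<close>, the family member is found by expanding \<open>m\<close> in powers of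
  \<open>1 - g\<^sup>-\<^sup>1\<close>, and the coboundary is the difference of the two elements \<open>a\<close>.
\<close>

theorem theorem8p2:
  fixes p :: nat
  assumes "p = CARD('p::prime_card)" and "odd p"
  shows "card ((drinfeld_orbifold :: ('p lam \<times> 'p kap) set) // coboundary_rel) = p ^ (2 * p + 1) \<and>
    (\<forall>b :: 'p FG. \<exists>!k. aug_exponent b k) \<and>
    (\<forall>(b :: 'p FG) k d \<kappa>C. aug_exponent b k \<and> length d = k \<longrightarrow>
       (\<exists>!q. family b d \<kappa>C q) \<and> (\<forall>q. family b d \<kappa>C q \<longrightarrow> q \<in> drinfeld_orbifold)) \<and>
    (\<forall>q \<in> (drinfeld_orbifold :: ('p lam \<times> 'p kap) set). \<exists>(b :: 'p FG) k d \<kappa>C q'.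
       aug_exponent b k \<and> length d = k \<and> family b d \<kappa>C q' \<and> (q, q') \<in> coboundary_rel)"
proof (intro conjI allI impI ballI)
  have odd: "odd CARD('p)" using assms by simp
  show "card ((drinfeld_orbifold :: ('p lam \<times> 'p kap) set) // coboundary_rel) = p ^ (2 * p + 1)"
    unfolding assms(1) by (rule card_coboundary_classes[OF odd])
  show "\<exists>!k. aug_exponent b k" for b :: "'p FG" by (rule aug_exponent_ex1)
  show "\<exists>!q. family b d \<kappa>C q" for b \<kappa>C :: "'p FG" and d by (simp add: family_iff[OF odd])
  show "q \<in> drinfeld_orbifold" if "aug_exponent b k \<and> length d = k" "family b d \<kappa>C q" for b \<kappa>C :: "'p FG" and k d q
  proof -
    have "b * s_comb d = 0"
      using that(1) annihilator[of b k] t_power_dvd_s_comb[of d] by auto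
    then have "b * (fam_x d + eul (fam_a b d) - eul b - eul2 b) = 0" by (simp only: fam_invariant[OF odd])
    from param_drinfeld_orbifold[OF odd this] that(2) show ?thesis by (simp add: family_iff[OF odd])
  qed
  show "\<exists>(b :: 'p FG) k d \<kappa>C q'. aug_exponent b k \<and> length d = k \<and> family b d \<kappa>C q' \<and> (q, q') \<in> coboundary_rel"
    if q: "q \<in> drinfeld_orbifold" for q :: "'p lam \<times> 'p kap"
  proof -
    obtain a b x C where abx: "q = param a b x (eul b) C" "b * (x + eul a - eul b - eul2 b) = 0"
      by (rule drinfeld_orbifold_conditions[OF odd q])
    obtain k where k: "aug_exponent b k" using aug_exponent_ex by blast
    then have "k \<le> CARD('p)" by (simp add: aug_exponent_def)
    moreover have "\<t> ^ (CARD('p) - k) dvd x + eul a - eul b - eul2 b" using annihilator[OF k] abx(2) by blast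
    ultimately obtain d where d: "length d = k" "x + eul a - eul b - eul2 b = s_comb d"
      using s_comb_surj by blast
    let ?F = "a - fam_a b d"
    have "x + eul a = fam_x d + eul (fam_a b d)"
      using fam_invariant[OF odd, of d b] unfolding d(2)[symmetric] by (simp add: algebra_simps)
    then have "x + eul ?F = fam_x d" by (simp add: eul_simps algebra_simps)
    then have "param (fam_a b d) b (fam_x d) (eul b) C = param (a - ?F) b (x + eul ?F) (eul b) C" by simp
    then have "(q, param (fam_a b d) b (fam_x d) (eul b) C) \<in> coboundary_rel"
      unfolding abx(1) coboundary_rel_iff by blast
    with k d(1) show ?thesis using family_iff[OF odd] by blast
  qed
qed

end
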